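(* Let $d\ge 2$, let $\mathcal{T}$ be a simplex tree, and let $k$ be an integer with $1 \le k < \frac{d+1}{2}$. Define $$N_k \;=\; k+\sum_{\substack{S \in \mathcal{T} \\ \dim(S) > k}} (\dim(S) -k).$$ Put $s =\max \left(\frac{dN_k + 1}{N_k+1}, \; k + \frac{d-1}{2} \right)$. If $E \subset \mathbb{F}_q^d$ satisfies $|E| \gtrsim q^{s}$, then $E$ contains a positive proportion of congruence classes of embeddings of $\mathcal{T}$ in $\mathbb{F}_q^d$.
   Context: $q$ is a prime power, treated as an asymptotic parameter. For $x,y\in\mathbb{F}_q^d$, $\|x-y\| = (x_1-y_1)^2+\cdots+(x_d-y_d)^2$. $X\lesssim Y$ ($X \gtrsim Y$) means $X\le CY$ ($X\ge CY$) for a constant $C$ independent of $q$; $X\approx Y$ means both. A statement "if $|E|\gtrsim q^s$ then ..." means there are constants independent of $q$ and $E$ so that the lower bound $|E|\ge Cq^s$ implies the conclusion with implied constants independent of $q$. For a finite graph $G$, an embedding of $G$ is a map $p: V(G)\to\mathbb{F}_q^d$; two embeddings $p,p'$ are congruent if $\|p(v_i)-p(v_j)\| = \|p'(v_i)-p'(v_j)\|$ for every edge $(v_i,v_j)$ of $G$. A congruence class is an equivalence class of this relation (determined by the tuple of edge-distances). $E$ "contains a positive proportion of congruence classes of $G$" means the number of congruence classes of $G$ in $\mathbb{F}_q^d$ containing an embedding $p$ with $p(V(G))\subset E$ is $\gtrsim$ the total number of congruence classes of $G$ in $\mathbb{F}_q^d$. A $k$-simplex is the complete graph on $k+1$ vertices;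 its dimension is $k$. A simplex tree is a finite set $\mathcal{T}=\{S_i: i\in I\}$ of simplices (the graph being their union) such that either $|\mathcal{T}|=1$, or: (1) for distinct $i,j$, $|V(S_i)\cap V(S_j)|\le 1$; (2) for any $a,b\in I$ there are distinct $i_1,\dots,i_n$ with $S_{i_1}=S_a$, $S_{i_n}=S_b$ and $S_{i_{j+1}}$ sharing a vertex with $S_{i_j}$ for each $j$; (3) there are no distinct $i_1,\dots,i_n$ ($n\ge 3$) with $S_{i_{j+1}}$ sharing a vertex with $S_{i_j}$ for all $j$ and $S_{i_n}$ sharing a vertex with $S_{i_1}$. Simplices in the tree may have different dimensions.
   Formalization: The formal theorem takes q odd; in characteristic 2 the claim is false, since ||x-y|| is the square of a linear form φ(x-y) and E = φ^{-1}(A), with A a suitable additive subgroup of F_q, meets the size bound but contains a vanishing proportion of classes. *)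

theory Defs
  imports Complex_Main "HOL-Algebra.Ring" "HOL-Algebra.Coset" "HOL-Library.FuncSet"
begin

text \<open>
  The field must be quantified inside the scope of the implied constants, so it is a
  \<^const>\<open>field\<close> record rather than a type of class \<^class>\<open>field\<close>.
  Every finite field has an isomorphic copy whose carrier is a set of natural numbers, so
  fields of type \<^typ>\<open>nat ring\<close> with finite carrier represent all finite fields.
\<close>

definition points :: "('f, 'm) ring_scheme \<Rightarrow> nat \<Rightarrow> (nat \<Rightarrow> 'f) set" where
  "points R d = {..<d} \<rightarrow>\<^sub>E carrier R"

text \<open>
  In characteristic 2 this is the square of the linear form
  \<open>\<Sum>i<d. x i - y i\<close>, and distance problems over such fields degenerate; the order of the
  field is therefore taken to be odd wherever distance sets are estimated.
\<close>

definition sq_dist ::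
  "('f, 'm) ring_scheme \<Rightarrow> nat \<Rightarrow> (nat \<Rightarrow> 'f) \<Rightarrow> (nat \<Rightarrow> 'f) \<Rightarrow> 'f" where
  "sq_dist R d x y = (\<Oplus>\<^bsub>R\<^esub>i\<in>{..<d}. (x i \<ominus>\<^bsub>R\<^esub> y i) [^]\<^bsub>R\<^esub> (2::nat))"

text \<open>
  A finite simple graph is given by its vertex set \<open>V\<close> and its symmetric adjacency relation
  \<open>A\<close>. Embeddings need not be injective.
\<close>

definition embeddings ::
  "('f, 'm) ring_scheme \<Rightarrow> nat \<Rightarrow> 'v set \<Rightarrow> ('v \<Rightarrow> nat \<Rightarrow> 'f) set" where
  "embeddings R d V = V \<rightarrow>\<^sub>E points R d"

definition congruence ::
  "('f, 'm) ring_scheme \<Rightarrow> nat \<Rightarrow> 'v set \<Rightarrow> ('v \<times> 'v) set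
    \<Rightarrow> (('v \<Rightarrow> nat \<Rightarrow> 'f) \<times> ('v \<Rightarrow> nat \<Rightarrow> 'f)) set" where
  "congruence R d V A =
    {(p, p'). p \<in> embeddings R d V \<and> p' \<in> embeddings R d V \<and>
       (\<forall>(u, v)\<in>A. sq_dist R d (p u) (p v) = sq_dist R d (p' u) (p' v))}"

lemma equiv_congruence: "equiv (embeddings R d V) (congruence R d V A)"
  by (rule equivI) (fastforce simp: congruence_def refl_on_def sym_def trans_def)+

definition congruence_classes ::
  "('f, 'm) ring_scheme \<Rightarrow> nat \<Rightarrow> 'v set \<Rightarrow> ('v \<times> 'v) set
    \<Rightarrow> ('v \<Rightarrow> nat \<Rightarrow> 'f) set set" where
  "congruence_classes R d V A = embeddings R d V // congruence R d V A"

definition congruence_classes_in ::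
  "('f, 'm) ring_scheme \<Rightarrow> nat \<Rightarrow> 'v set \<Rightarrow> ('v \<times> 'v) set \<Rightarrow> (nat \<Rightarrow> 'f) set
    \<Rightarrow> ('v \<Rightarrow> nat \<Rightarrow> 'f) set set" where
  "congruence_classes_in R d V A E =
    {K \<in> congruence_classes R d V A. \<exists>p\<in>K. p ` V \<subseteq> E}"

text \<open>A simplex, being a complete graph, is represented by its finite nonempty vertex set.\<close>

definition simplex_dim :: "'v set \<Rightarrow> nat" where
  "simplex_dim S = card S - 1"

definition tree_verts :: "'v set set \<Rightarrow> 'v set" where
  "tree_verts T = \<Union>T"

definition tree_adj :: "'v set set \<Rightarrow> ('v \<times> 'v) set" where
  "tree_adj T = {(u, v). u \<noteq> v \<and> (\<exists>S\<in>T. u \<in> S \<and> v \<in> S)}"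

definition share_vertex :: "'v set \<Rightarrow> 'v set \<Rightarrow> bool" where
  "share_vertex S S' \<longleftrightarrow> S \<inter> S' \<noteq> {}"

text \<open>
  The last clause also excludes three distinct simplices meeting in one common vertex.
\<close>

definition simplex_tree :: "'v set set \<Rightarrow> bool" where
  "simplex_tree T \<longleftrightarrow>
    finite T \<and> (\<forall>S\<in>T. finite S \<and> S \<noteq> {}) \<and>
    (card T = 1 \<or>
      (\<forall>S\<in>T. \<forall>S'\<in>T. S \<noteq> S' \<longrightarrow> card (S \<inter> S') \<le> 1) \<and>
      (\<forall>S\<in>T. \<forall>S'\<in>T. \<exists>Ss. Ss \<noteq> [] \<and> distinct Ss \<and> set Ss \<subseteq> T \<and>
          hd Ss = S \<and> last Ss = S' \<and> successively share_vertex Ss) \<and>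
      \<not> (\<exists>Ss. length Ss \<ge> 3 \<and> distinct Ss \<and> set Ss \<subseteq> T \<and>
          successively share_vertex Ss \<and> share_vertex (last Ss) (hd Ss)))"

end

theory Submission
  imports Defs "HOL-Library.Function_Algebras" "HOL-Analysis.Convex"
begin

text \<open>
  Pairs of congruent simplices in \<open>E\<close> are counted through the isometries carrying one to the other,
  which Witt's theorem supplies. For an isometry \<open>g\<close> let \<open>\<lambda> g\<close> be the number of points of \<open>E\<close> that
  \<open>g\<close> maps into \<open>E\<close>; its mean is \<open>\<bar>E\<bar>\<^sup>2 / q\<^sup>d\<close>. Two inputs drive the proof. First, the squared
  deviations of \<open>\<lambda>\<close> from its mean add up to at most \<open>q \<bar>E\<bar>\<^sup>2\<close> times the order of a point
  stabilizer, up to a constant; this bounds the moment of order \<open>N + 1\<close> as soon as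
  \<open>\<bar>E\<bar>\<^sup>N\<^sup>+\<^sup>1\<close> exceeds \<open>q\<^sup>d\<^sup>N\<^sup>+\<^sup>1\<close>. Secondly, after discarding half of \<open>E\<close>, the sum of \<open>\<lambda>\<^sup>k\<close> over
  the isometries taking \<open>x\<close> to \<open>y\<close> has the expected order for all \<open>x\<close> and \<open>y\<close>: this is a count of
  cliques in the graph on pairs of points given by the quadratic form \<open>Q x - Q y\<close> in dimension
  \<open>2d\<close>.

  In a tree, each simplex of dimension \<open>n > k\<close> contributes \<open>\<lambda>\<^sup>k\<close>, which is absorbed by the pinned
  estimate when the simplex is removed as a leaf, and a surplus \<open>\<lambda>\<^sup>n\<^sup>-\<^sup>k\<close>. All surplus powers are
  moved to the simplex with the largest \<open>\<lambda>\<close>, which is taken as the root, so a single moment of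
  order \<open>N + 1\<close> remains. Cauchy-Schwarz then gives the lower bound for the number of classes, and
  a count of Gram matrices of rank at most \<open>d\<close> gives the matching upper bound for their total
  number.
\<close>

section \<open>Simplex trees\<close>

text \<open>Isotropic vectors shape the argument: the form may vanish on subspaces, so reflections
  that move one point to another while fixing given points need not exist, and orbit sizes become
  irregular. Counting is therefore confined to generic tuples, where the complement of the points
  already placed contains an anisotropic vector. From 2k \<le> d this is automatic for the k points
  spent on a pinned simplex; longer tuples rely on non-generic ones being rare. The two terms of s
  are the two places where an error must stay below a main term. With n = |E| and m = n^2/q^d, the
  first is equivalent to q n^(N+1) \<le> q^d m^(N+1): the variance, inflated by the trivial bound
  n^(N-1), must not exceed the expected moment. The second gives q^(d+k) \<le> n^2 (as k \<ge> 1),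
  which lets the expected term dominate the count of cliques with a pinned vertex. Constants must be
  chosen before the field, while the linear algebra lives in a locale over one type; placing all the
  fields inside one product ring reconciles the two.\<close>

lemma successively_crossing:
  assumes "successively P xs" "xs \<noteq> []" "hd xs \<in> A" "last xs \<notin> A"
  shows "\<exists>x\<in>set xs \<inter> A. \<exists>y\<in>set xs - A. P x y"
  using assms
proof (induction xs rule: induct_list012)
  case (3 x y zs)
  then show ?case by (cases "y \<in> A") auto
qed auto

text \<open>Take a maximal connected subfamily containing \<open>S0\<close>. If a simplex is
  missing, a path from \<open>S0\<close> towards it leaves the subfamily through a simplex touching
  it. A second contact point would either close a cycle or make two simplices share two vertices.
  Growth may start at any prescribed root, which the summation over trees exploits.\<close>

lemma simplex_tree_grow [consumes 2, case_names base step]: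
  assumes tree: "simplex_tree T" and S0: "S0 \<in> T"
    and base: "P {S0}"
    and step: "\<And>T' S v. \<lbrakk>T' \<subseteq> T; S0 \<in> T'; S \<in> T - T'; S \<inter> \<Union>T' = {v}; P T'\<rbrakk> \<Longrightarrow> P (insert S T')"
  shows "P T"
proof -
  define linked where "linked T' \<longleftrightarrow> (\<forall>S\<in>T'. \<forall>S'\<in>T'. \<exists>Ss. Ss \<noteq> [] \<and> distinct Ss \<and> set Ss \<subseteq> T' \<and>
          hd Ss = S \<and> last Ss = S' \<and> successively share_vertex Ss)" for T' :: "'a set set"
  have fin: "finite T" using tree by (simp add: simplex_tree_def)
  show ?thesis
  proof (cases "card T = 1")
    case True
    then have "T = {S0}" using S0 by (metis card_1_singletonE singletonD)
    then show ?thesis using base by simp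
  next
    case False
    then have two: "\<And>S S'. S \<in> T \<Longrightarrow> S' \<in> T \<Longrightarrow> S \<noteq> S' \<Longrightarrow> card (S \<inter> S') \<le> 1"
      and conn: "linked T"
      and acyc: "\<And>Ss. length Ss \<ge> 3 \<Longrightarrow> distinct Ss \<Longrightarrow> set Ss \<subseteq> T \<Longrightarrow>
          successively share_vertex Ss \<Longrightarrow> share_vertex (last Ss) (hd Ss) \<Longrightarrow> False"
      and finS: "\<And>S. S \<in> T \<Longrightarrow> finite S"
      using tree unfolding simplex_tree_def linked_def by blast+
    \<comment> \<open>\<open>P T'\<close> is part of membership in \<open>F\<close>, so that
      maximality carries out the induction itself.\<close>
    define F where "F = {T'. T' \<subseteq> T \<and> S0 \<in> T' \<and> linked T' \<and> P T'}"
    have "linked {S0}"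
      unfolding linked_def by (auto intro!: exI[of _ "[S0]"])
    then have F0: "{S0} \<in> F" using S0 base by (auto simp: F_def)
    have "finite F" using fin by (auto simp: F_def)
    then obtain T' where T': "T' \<in> F" and max: "\<And>T''. T'' \<in> F \<Longrightarrow> T' \<subseteq> T'' \<Longrightarrow> T'' = T'"
      using F0 finite_has_maximal[of F] by blast
    have sub: "T' \<subseteq> T" and S0': "S0 \<in> T'" and lk: "linked T'" and PT: "P T'"
      using T' by (auto simp: F_def)
    have "T' = T"
    proof (rule ccontr)
      assume "T' \<noteq> T"
      then obtain S where S: "S \<in> T" "S \<notin> T'" using sub by blast
      then obtain Ss where Ss: "Ss \<noteq> []" "set Ss \<subseteq> T" "hd Ss = S0" "last Ss = S"
          "successively share_vertex Ss"
        using conn[unfolded linked_def, rule_format, OF S0 S(1)] by metis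
      then obtain S' S1 where S1: "S' \<in> T'" "S1 \<in> T - T'" "share_vertex S' S1"
        using successively_crossing[of share_vertex Ss T'] S S0' by blast
      then obtain v where v: "v \<in> S'" "v \<in> S1" by (auto simp: share_vertex_def)
      have uniq: "w = v" if w: "w \<in> S1" "w \<in> S''" "S'' \<in> T'" for w S''
      proof (rule ccontr)
        assume ne: "w \<noteq> v"
        have "S'' \<noteq> S'"
        proof
          assume "S'' = S'"
          then have "{v, w} \<subseteq> S' \<inter> S1" using v w by auto
          then have "card {v, w} \<le> card (S' \<inter> S1)"
            using finS S1 by (intro card_mono) auto
          moreover have "card (S' \<inter> S1) \<le> 1" using S1 sub by (intro two) auto
          ultimately show False using ne by simp
        qed
        obtain Ls where Ls: "Ls \<noteq> []" "distinct Ls" "set Ls \<subseteq> T'" "hd Ls = S'" "last Ls = S''"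
          "successively share_vertex Ls"
          using lk[unfolded linked_def, rule_format, OF S1(1) w(3)] by metis
        obtain L Ls' where L: "Ls = L # Ls'" using Ls(1) by (meson neq_Nil_conv)
        have "Ls' \<noteq> []" using L Ls(4,5) \<open>S'' \<noteq> S'\<close> by fastforce
        then have "length Ls \<ge> 2" using L by (simp add: Suc_le_eq)
        have "length (S1 # Ls) \<ge> 3" using \<open>length Ls \<ge> 2\<close> by simp
        moreover have "distinct (S1 # Ls)" "set (S1 # Ls) \<subseteq> T"
          using Ls(2,3) S1(2) sub by auto
        moreover have "successively share_vertex (S1 # Ls)"
          using Ls(4,6) S1(3) L by (simp add: share_vertex_def Int_commute)
        moreover have "share_vertex (last (S1 # Ls)) (hd (S1 # Ls))"
          using Ls(1,5) w by (auto simp: share_vertex_def)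
        ultimately show False using acyc by blast
      qed
      have "S1 \<inter> \<Union>T' = {v}" using uniq v S1 by blast
      then have P1: "P (insert S1 T')" using step sub S0' S1 PT by blast
      have "linked (insert S1 T')"
        unfolding linked_def
      proof (intro ballI)
        fix X Y assume X: "X \<in> insert S1 T'" and Y: "Y \<in> insert S1 T'"
        have from_S1: "\<exists>Ss. Ss \<noteq> [] \<and> distinct Ss \<and> set Ss \<subseteq> insert S1 T' \<and> hd Ss = S1 \<and>
            last Ss = Y \<and> successively share_vertex Ss" if Y: "Y \<in> T'" for Y
        proof -
          obtain Ls where "Ls \<noteq> []" "distinct Ls" "set Ls \<subseteq> T'" "hd Ls = S'" "last Ls = Y"
          "successively share_vertex Ls"
            using lk[unfolded linked_def, rule_format, OF S1(1) Y] by metis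
          moreover from this obtain L Ls' where L: "Ls = L # Ls'" by (cases Ls) auto
          ultimately have "successively share_vertex (S1 # Ls)"
            using S1(3) by (simp add: share_vertex_def Int_commute)
          then show ?thesis
            using \<open>distinct Ls\<close> \<open>set Ls \<subseteq> T'\<close> \<open>last Ls = Y\<close> L S1(2)
            by (intro exI[of _ "S1 # Ls"]) auto
        qed
        have sym: "(\<lambda>x y. share_vertex y x) = (share_vertex :: 'a set \<Rightarrow> _)"
          by (auto simp: share_vertex_def fun_eq_iff)
        consider "X = S1" "Y = S1" | "X = S1" "Y \<in> T'" | "X \<in> T'" "Y = S1" | "X \<in> T'" "Y \<in> T'"
          using X Y by blast
        then show "\<exists>Ss. Ss \<noteq> [] \<and> distinct Ss \<and> set Ss \<subseteq> insert S1 T' \<and> hd Ss = X \<and>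
            last Ss = Y \<and> successively share_vertex Ss"
        proof cases
          case 1 then show ?thesis by (intro exI[of _ "[S1]"]) auto
        next
          case 2 then show ?thesis using from_S1 by blast
        next
          case 3
          then obtain Ss where "Ss \<noteq> []" "distinct Ss" "set Ss \<subseteq> insert S1 T'" "hd Ss = S1"
            "last Ss = X" "successively share_vertex Ss"
            using from_S1[OF 3(1)] by metis
          moreover from this have "successively share_vertex (rev Ss)"
            unfolding successively_rev sym by blast
          ultimately show ?thesis using 3
            by (intro exI[of _ "rev Ss"]) (simp add: hd_rev last_rev)
        next
          case 4 then show ?thesis using lk unfolding linked_def by (meson subset_insertI2)
        qed
      qed
      then have "insert S1 T' \<in> F" using P1 S1 sub S0' by (auto simp: F_def)
      from max[OF this] show False using S1 by blast
    qed
    then show ?thesis using PT by simp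
  qed
qed

text \<open>While the tree grows, each simplex shares exactly one vertex with what is already there
  and contributes \<open>card S - 1\<close> new ones.\<close>

lemma card_simplex_tree_verts:
  assumes "simplex_tree T" "T \<noteq> {}"
  shows "card (\<Union>T) = 1 + (\<Sum>S\<in>T. card S - 1)"
proof -
  obtain S0 where S0: "S0 \<in> T" using assms by blast
  have fin: "finite T" and finS: "\<And>S. S \<in> T \<Longrightarrow> finite S \<and> S \<noteq> {}"
    using assms by (auto simp: simplex_tree_def)
  have "finite T \<and> card (\<Union>T) = 1 + (\<Sum>S\<in>T. card S - 1)"
    using assms(1) S0
  proof (induction rule: simplex_tree_grow)
    case base
    have "card S0 > 0" using finS S0 by (simp add: card_gt_0_iff)
    then show ?case by simp
  next
    case (step T' S v)
    have "finite (\<Union>T')" using step finS by (meson finite_Union in_mono)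
    moreover have "finite S" "card S > 0" using step finS by (auto simp: card_gt_0_iff)
    ultimately have "card (S \<union> \<Union>T') + 1 = card S + card (\<Union>T')"
      using card_Un_Int[of S "\<Union>T'"] step(4) by simp
    then show ?case using step \<open>card S > 0\<close> by (auto simp: sum.insert)
  qed
  then show ?thesis by blast
qed

text \<open>A map on \<open>S \<union> U\<close> amounts to a pair of maps that agree at the single
  common vertex \<open>v\<close>; so one may sum over \<open>U\<close> first and then over
  \<open>S\<close> with the value at \<open>v\<close> prescribed.\<close>

lemma sum_PiE_glue:
  fixes f :: "('v \<Rightarrow> 'z) \<Rightarrow> real"
  assumes "finite U" "finite S" "S \<inter> U = {v}" "finite Z"
  shows "(\<Sum>z\<in>(S \<union> U) \<rightarrow>\<^sub>E Z. f (restrict z U) * h (restrict z S))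
    = (\<Sum>y\<in>U \<rightarrow>\<^sub>E Z. f y * (\<Sum>z | z \<in> S \<rightarrow>\<^sub>E Z \<and> z v = y v. h z))"
proof -
  define glue where "glue y z = (\<lambda>x. if x \<in> U then y x else if x \<in> S then z x else undefined)"
    for y z :: "'v \<Rightarrow> 'z"
  have fS: "finite (S \<rightarrow>\<^sub>E Z)" and fU: "finite (U \<rightarrow>\<^sub>E Z)" using assms by (auto intro: finite_PiE)
  have g1: "restrict (glue y z) U = y" if "y \<in> U \<rightarrow>\<^sub>E Z" for y z
  proof
    fix x show "restrict (glue y z) U x = y x"
      using PiE_arb[OF that, of x] by (simp add: glue_def)
  qed
  have g2: "restrict (glue y z) S = z" if "z \<in> S \<rightarrow>\<^sub>E Z" "z v = y v" for y z
  proof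
    fix x
    have "x = v" if "x \<in> S" "x \<in> U" using assms(3) that by blast
    then show "restrict (glue y z) S x = z x"
      using PiE_arb[OF that(1), of x] that(2) by (auto simp: glue_def)
  qed
  have g3: "glue y z \<in> (S \<union> U) \<rightarrow>\<^sub>E Z" if "y \<in> U \<rightarrow>\<^sub>E Z" "z \<in> S \<rightarrow>\<^sub>E Z" for y z
    using that by (intro PiE_I) (auto simp: glue_def)
  have g4: "glue (restrict w U) (restrict w S) = w" if "w \<in> (S \<union> U) \<rightarrow>\<^sub>E Z" for w
  proof
    fix x show "glue (restrict w U) (restrict w S) x = w x"
      using PiE_arb[OF that, of x] by (simp add: glue_def)
  qed
  have v: "v \<in> S" "v \<in> U" using assms(3) by auto
  have "(\<Sum>y\<in>U \<rightarrow>\<^sub>E Z. f y * (\<Sum>z | z \<in> S \<rightarrow>\<^sub>E Z \<and> z v = y v. h z))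
      = (\<Sum>(y,z)\<in>(SIGMA y:U \<rightarrow>\<^sub>E Z. {z. z \<in> S \<rightarrow>\<^sub>E Z \<and> z v = y v}). f y * h z)"
    using fS fU by (simp add: sum_distrib_left sum.Sigma)
  also have "\<dots> = (\<Sum>z\<in>(S \<union> U) \<rightarrow>\<^sub>E Z. f (restrict z U) * h (restrict z S))"
  proof (rule sum.reindex_bij_witness[where j = "\<lambda>(y,z). glue y z"
        and i = "\<lambda>z. (restrict z U, restrict z S)"], goal_cases)
    case (1 a) then show ?case by (cases a) (simp add: g1 g2)
  next
    case (2 a) then show ?case by (cases a) (simp add: g3)
  next
    case (3 b) then show ?case by (simp add: g4)
  next
    case (4 b) then show ?case using v by (auto intro: PiE_mem)
  next
    case (5 a) then show ?case by (cases a) (simp add: g1 g2)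
  qed
  finally show ?thesis by simp
qed

text \<open>Leaves are summed out one after another: with its attaching vertex held fixed, a simplex
  costs at most \<open>A S\<close>, uniformly in the position \<open>a\<close>. Only the root
  \<open>S0\<close> keeps its full, unpinned sum.\<close>

lemma tree_sum_le:
  fixes K :: "'v set \<Rightarrow> ('v \<Rightarrow> 'z) \<Rightarrow> real"
  assumes tree: "simplex_tree T" and S0: "S0 \<in> T" and Z: "finite Z"
    and nonneg: "\<And>S z. S \<in> T \<Longrightarrow> K S z \<ge> 0"
    and local: "\<And>S z. S \<in> T \<Longrightarrow> K S (restrict z S) = K S z"
    and pin: "\<And>S v a. \<lbrakk>S \<in> T; S \<noteq> S0; v \<in> S; a \<in> Z\<rbrakk> \<Longrightarrow>
        (\<Sum>z | z \<in> S \<rightarrow>\<^sub>E Z \<and> z v = a. K S z) \<le> A S"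
    and A: "\<And>S. S \<in> T \<Longrightarrow> A S \<ge> 0"
  shows "(\<Sum>z\<in>\<Union>T \<rightarrow>\<^sub>E Z. \<Prod>S\<in>T. K S z)
    \<le> (\<Prod>S\<in>T - {S0}. A S) * (\<Sum>z\<in>S0 \<rightarrow>\<^sub>E Z. K S0 z)"
proof -
  have fin: "finite T" and finS: "\<And>S. S \<in> T \<Longrightarrow> finite S"
    using assms by (auto simp: simplex_tree_def)
  show ?thesis
    using tree S0
  proof (induction rule: simplex_tree_grow)
    case base
    show ?case by simp
  next
    case (step T' S v)
    have fT': "finite T'" using step fin finite_subset by blast
    have fU: "finite (\<Union>T')" using step finS fT' by blast
    have fS: "finite S" using step finS by blast
    have v: "v \<in> S" "v \<in> \<Union>T'" using step(4) by auto
    have ne: "S \<noteq> S0" using step by auto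
    define h where "h z = (\<Prod>S\<in>T'. K S z)" for z
    have hr: "h (restrict z (\<Union>T')) = h z" for z
    proof -
      have "K X (restrict z (\<Union>T')) = K X z" if "X \<in> T'" for X
      proof -
        have "restrict (restrict z (\<Union>T')) X = restrict z X"
          using that by (auto simp: fun_eq_iff)
        then show ?thesis using local that step(1) by (metis in_mono)
      qed
      then show ?thesis by (simp add: h_def)
    qed
    have "(\<Sum>z\<in>\<Union>(insert S T') \<rightarrow>\<^sub>E Z. \<Prod>X\<in>insert S T'. K X z)
      = (\<Sum>z\<in>(S \<union> \<Union>T') \<rightarrow>\<^sub>E Z. h (restrict z (\<Union>T')) * K S (restrict z S))"
    proof (rule sum.cong)
      fix z
      show "(\<Prod>X\<in>insert S T'. K X z) = h (restrict z (\<Union>T')) * K S (restrict z S)"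
        unfolding hr using step(3) local[of S z] fT' by (simp add: h_def)
    qed simp
    also have "\<dots> = (\<Sum>y\<in>\<Union>T' \<rightarrow>\<^sub>E Z. h y * (\<Sum>z | z \<in> S \<rightarrow>\<^sub>E Z \<and> z v = y v. K S z))"
      by (rule sum_PiE_glue[OF fU fS step(4) Z])
    also have "\<dots> \<le> (\<Sum>y\<in>\<Union>T' \<rightarrow>\<^sub>E Z. h y * A S)"
    proof (intro sum_mono mult_left_mono)
      fix y assume "y \<in> \<Union>T' \<rightarrow>\<^sub>E Z"
      then have "y v \<in> Z" using v by (auto simp: PiE_def)
      then show "(\<Sum>z | z \<in> S \<rightarrow>\<^sub>E Z \<and> z v = y v. K S z) \<le> A S"
        using pin[of S v "y v"] step(3) ne v by auto
      show "0 \<le> h y" unfolding h_def using nonneg step(1) by (auto intro!: prod_nonneg)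
    qed
    also have "\<dots> = (\<Sum>y\<in>\<Union>T' \<rightarrow>\<^sub>E Z. h y) * A S" by (simp add: sum_distrib_right)
    also have "\<dots> \<le> (\<Prod>S\<in>T' - {S0}. A S) * (\<Sum>z\<in>S0 \<rightarrow>\<^sub>E Z. K S0 z) * A S"
      using step(5) A step(3) unfolding h_def by (intro mult_right_mono) auto
    also have "\<dots> = (\<Prod>S\<in>insert S T' - {S0}. A S) * (\<Sum>z\<in>S0 \<rightarrow>\<^sub>E Z. K S0 z)"
    proof -
      have "insert S T' - {S0} = insert S (T' - {S0})" using ne by auto
      then show ?thesis using step(3) fT' by simp
    qed
    finally show ?case .
  qed
qed

section \<open>Second moments and cliques\<close>

lemma sum_of_bool_eq:
  assumes "finite C" "a \<in> C"
  shows "(\<Sum>c\<in>C. of_bool (a = c) * f c) = (f a :: real)"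
proof -
  have "(\<Sum>c\<in>C. of_bool (a = c) * f c) = (\<Sum>c\<in>C. if a = c then f c else 0)"
    by (intro sum.cong) auto
  then show ?thesis using assms by simp
qed

text \<open>
  A pairwise balance condition on \<open>\<delta>\<close> replaces the usual Fourier analysis:
  the off-diagonal terms cancel exactly.
\<close>

lemma second_moment_identity:
  fixes \<phi> :: "'x \<Rightarrow> real" and \<delta> :: "'x \<Rightarrow> 'x \<Rightarrow> 'c"
  assumes X: "finite X" and C: "finite C" "C \<noteq> {}"
    and \<delta>: "\<And>u w. u \<in> X \<Longrightarrow> w \<in> X \<Longrightarrow> \<delta> u w \<in> C"
    and bal: "\<And>u u'. \<lbrakk>u \<in> X; u' \<in> X; u \<noteq> u'\<rbrakk> \<Longrightarrow>
        real (card {w\<in>X. \<delta> u w = \<delta> u' w}) = real (card X) / real (card C)"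
  shows "(\<Sum>w\<in>X. \<Sum>c\<in>C. ((\<Sum>u\<in>X. \<phi> u * of_bool (\<delta> u w = c)) - (\<Sum>u\<in>X. \<phi> u) / card C)\<^sup>2)
    \<le> real (card X) * (\<Sum>u\<in>X. (\<phi> u)\<^sup>2)"
proof -
  define q where "q = real (card C)"
  have q: "q > 0" using C by (simp add: q_def card_gt_0_iff)
  define s where "s = (\<Sum>u\<in>X. \<phi> u)"
  define F where "F w c = (\<Sum>u\<in>X. \<phi> u * of_bool (\<delta> u w = c))" for w c
  have F1: "(\<Sum>c\<in>C. F w c) = s" if "w \<in> X" for w
  proof -
    have "(\<Sum>c\<in>C. F w c) = (\<Sum>u\<in>X. \<Sum>c\<in>C. of_bool (\<delta> u w = c) * \<phi> u)"
      unfolding F_def by (subst sum.swap) (simp add: mult.commute)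
    also have "\<dots> = s" unfolding s_def
      by (intro sum.cong refl sum_of_bool_eq[OF C(1)] \<delta> that)
    finally show ?thesis .
  qed
  have F2: "(\<Sum>c\<in>C. (F w c)\<^sup>2) = (\<Sum>u\<in>X. \<Sum>u'\<in>X. \<phi> u * \<phi> u' * of_bool (\<delta> u w = \<delta> u' w))"
    if "w \<in> X" for w
  proof -
    have "(\<Sum>c\<in>C. (F w c)\<^sup>2) = (\<Sum>c\<in>C. \<Sum>u\<in>X. \<Sum>u'\<in>X. of_bool (\<delta> u w = c) * (\<phi> u * \<phi> u' * of_bool (\<delta> u' w = c)))"
      unfolding F_def power2_eq_square sum_product by (simp add: mult_ac)
    also have "\<dots> = (\<Sum>u\<in>X. \<Sum>u'\<in>X. \<Sum>c\<in>C. of_bool (\<delta> u w = c) * (\<phi> u * \<phi> u' * of_bool (\<delta> u' w = c)))"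
      by (subst sum.swap, rule sum.cong[OF refl], subst sum.swap) simp
    also have "\<dots> = (\<Sum>u\<in>X. \<Sum>u'\<in>X. \<phi> u * \<phi> u' * of_bool (\<delta> u' w = \<delta> u w))"
      by (intro sum.cong refl sum_of_bool_eq[OF C(1)] \<delta> that)
    also have "\<dots> = (\<Sum>u\<in>X. \<Sum>u'\<in>X. \<phi> u * \<phi> u' * of_bool (\<delta> u w = \<delta> u' w))"
      by (simp add: eq_commute)
    finally show ?thesis .
  qed
  have "(\<Sum>w\<in>X. \<Sum>c\<in>C. (F w c - s / q)\<^sup>2) = (\<Sum>w\<in>X. (\<Sum>c\<in>C. (F w c)\<^sup>2) - s\<^sup>2 / q)"
  proof (rule sum.cong[OF refl])
    fix w assume w: "w \<in> X"
    have "(\<Sum>c\<in>C. (F w c - s / q)\<^sup>2) = (\<Sum>c\<in>C. (F w c)\<^sup>2 - 2 * (s/q) * F w c + (s/q)\<^sup>2)"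
      by (intro sum.cong refl) (simp add: power2_diff algebra_simps)
    also have "\<dots> = (\<Sum>c\<in>C. (F w c)\<^sup>2) - 2 * (s/q) * (\<Sum>c\<in>C. F w c) + q * (s/q)\<^sup>2"
      by (simp add: sum.distrib sum_subtractf sum_distrib_left q_def)
    also have "\<dots> = (\<Sum>c\<in>C. (F w c)\<^sup>2) - s\<^sup>2 / q"
      using q by (simp add: F1[OF w] field_simps power2_eq_square)
    finally show "(\<Sum>c\<in>C. (F w c - s / q)\<^sup>2) = (\<Sum>c\<in>C. (F w c)\<^sup>2) - s\<^sup>2 / q" .
  qed
  also have "\<dots> = (\<Sum>w\<in>X. \<Sum>u\<in>X. \<Sum>u'\<in>X. \<phi> u * \<phi> u' * of_bool (\<delta> u w = \<delta> u' w)) - card X * s\<^sup>2 / q"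
    by (simp add: sum_subtractf F2)
  also have "(\<Sum>w\<in>X. \<Sum>u\<in>X. \<Sum>u'\<in>X. \<phi> u * \<phi> u' * of_bool (\<delta> u w = \<delta> u' w))
     = (\<Sum>u\<in>X. \<Sum>u'\<in>X. \<phi> u * \<phi> u' * (\<Sum>w\<in>X. of_bool (\<delta> u w = \<delta> u' w)))"
    by (subst sum.swap, rule sum.cong[OF refl], subst sum.swap) (simp add: sum_distrib_left)
  also have "\<dots> \<le> (\<Sum>u\<in>X. \<Sum>u'\<in>X. \<phi> u * \<phi> u' * (card X / q) + of_bool (u = u') * (card X * (\<phi> u * \<phi> u')))"
  proof (intro sum_mono)
    fix u u' assume u: "u \<in> X" "u' \<in> X"
    have "(\<Sum>w\<in>X. of_bool (\<delta> u w = \<delta> u' w)) = real (card {w\<in>X. \<delta> u w = \<delta> u' w})"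
      using X by (simp add: of_bool_def sum.If_cases Int_def)
    then show "\<phi> u * \<phi> u' * (\<Sum>w\<in>X. of_bool (\<delta> u w = \<delta> u' w))
      \<le> \<phi> u * \<phi> u' * (card X / q) + of_bool (u = u') * (card X * (\<phi> u * \<phi> u'))"
      using bal[OF u] q by (cases "u = u'") (auto simp: q_def)
  qed
  also have "\<dots> = s\<^sup>2 * (card X / q) + card X * (\<Sum>u\<in>X. (\<phi> u)\<^sup>2)"
  proof -
    have "(\<Sum>u\<in>X. \<Sum>u'\<in>X. \<phi> u * \<phi> u' * (card X / q)) = s\<^sup>2 * (card X / q)"
      unfolding s_def power2_eq_square sum_product by (simp add: sum_distrib_right sum_divide_distrib)
    moreover have "(\<Sum>u\<in>X. \<Sum>u'\<in>X. of_bool (u = u') * (card X * (\<phi> u * \<phi> u'))) = card X * (\<Sum>u\<in>X. (\<phi> u)\<^sup>2)"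
      by (simp add: sum_of_bool_eq[OF X] power2_eq_square sum_distrib_left)
    ultimately show ?thesis by (simp add: sum.distrib)
  qed
  finally show ?thesis by (simp add: F_def s_def q_def mult.commute)
qed

lemma power_add_le_two_power:
  fixes a b :: real
  assumes "a \<ge> 0" "b \<ge> 0"
  shows "(a + b) ^ n \<le> 2 ^ n * (a ^ n + b ^ n)"
proof -
  have "(a + b) ^ n \<le> (2 * max a b) ^ n" using assms by (intro power_mono) auto
  also have "\<dots> = 2 ^ n * max a b ^ n" by (simp add: power_mult_distrib)
  also have "max a b ^ n \<le> a ^ n + b ^ n" using assms by (simp add: max_def)
  finally show ?thesis by simp
qed

text \<open>Two of the n + 2 factors of the deviation are saved for a variance bound; the others are
  replaced by the trivial bound \<open>b\<close>.\<close>

lemma power_le_centered: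
  fixes x m b :: real
  assumes "x \<ge> 0" "m \<ge> 0" "\<bar>x - m\<bar> \<le> b"
  shows "x ^ (n + 2) \<le> 2 ^ (n + 2) * (m ^ (n + 2) + b ^ n * (x - m)\<^sup>2)"
proof -
  have "x ^ (n + 2) \<le> (m + \<bar>x - m\<bar>) ^ (n + 2)" using assms by (intro power_mono) auto
  also have "\<dots> \<le> 2 ^ (n + 2) * (m ^ (n + 2) + \<bar>x - m\<bar> ^ (n + 2))"
    using assms by (intro power_add_le_two_power) auto
  also have "\<bar>x - m\<bar> ^ (n + 2) = \<bar>x - m\<bar> ^ n * (x - m)\<^sup>2" by (simp only: power_add power2_abs)
  also have "\<dots> \<le> b ^ n * (x - m)\<^sup>2" using assms by (intro mult_right_mono power_mono) auto
  finally show ?thesis by simp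
qed

text \<open>Counts ordered tuples in which each later entry lies in the neighbourhood of every
  earlier one. The index is one less than the length of the tuple, so index 0 counts single
  points.\<close>

fun clique_count :: "('z \<Rightarrow> 'z set) \<Rightarrow> nat \<Rightarrow> 'z set \<Rightarrow> real" where
  "clique_count N 0 Y = real (card Y)"
| "clique_count N (Suc a) Y = (\<Sum>z\<in>Y. clique_count N a (Y \<inter> N z))"

text \<open>Hypothesis \<open>reg\<close> covers every subset, so the recursion can be applied to
  the neighbourhoods \<open>Y \<inter> N z\<close>. The term p = a is the count expected at edge
  density 1/q; in the terms with smaller p factors L replace expected degrees, down to L^a |Y| at p
  = 0. An induction step sends the term of index p + 1 to those of index p and p + 2.\<close>

lemma clique_count_le:
  fixes N :: "'z \<Rightarrow> 'z set" and L q :: real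
  assumes X: "finite X" and L: "L > 0" and q: "q \<ge> 1"
    and reg: "\<And>Y. Y \<subseteq> X \<Longrightarrow> (\<Sum>z\<in>Y. (card (Y \<inter> N z) - card Y / q)\<^sup>2) \<le> L\<^sup>2 * card Y"
    and "Y \<subseteq> X"
  shows "clique_count N a Y
    \<le> 2 ^ (a * (a + 2)) * (\<Sum>p\<le>a. L ^ (a - p) * real (card Y) ^ (p + 1) / q ^ (p * (p + 1) div 2))"
  using \<open>Y \<subseteq> X\<close>
proof (induction a arbitrary: Y)
  case 0
  then show ?case by simp
next
  case (Suc a)
  define y where "y = real (card Y)"
  define e where "e p = p * (p + 1) div 2" for p :: nat
  have eS: "e (Suc p) = e p + (p + 1)" for p by (simp add: e_def)
  define B where "B p = L ^ (Suc a - p) * y ^ (p + 1) / q ^ e p" for p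
  have fY: "finite Y" using Suc.prems X finite_subset by blast
  have B0: "B p \<ge> 0" for p using L q by (simp add: B_def y_def)
  define c where "c z = real (card (Y \<inter> N z))" for z
  have c: "c z \<ge> 0" "c z \<le> y" for z using fY by (auto simp: c_def y_def intro!: card_mono)
  have y0: "y \<ge> 0" by (simp add: y_def)
  have yq: "y / q \<le> y" "y / q \<ge> 0" using q mult_right_mono[OF q y0] by (auto simp: y0 field_simps)
  have var: "(\<Sum>z\<in>Y. (c z - y / q)\<^sup>2) \<le> L\<^sup>2 * y" using reg[OF Suc.prems] by (simp add: c_def y_def)
  \<comment> \<open>Exponent one leaves no square to spare, so the deviation is linearised by x
    \<le> (x^2/L + L)/2, which is balanced for the variance bound L^2.\<close>
  have term0: "(\<Sum>z\<in>Y. L ^ a * c z) \<le> B 0 + B 1"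
  proof -
    have "c z \<le> y / q + ((c z - y / q)\<^sup>2 / L + L) / 2" for z
    proof -
      have "x \<le> (x\<^sup>2 / L + L) / 2" for x :: real
        using L zero_le_power2[of "x - L"] by (simp add: field_simps power2_eq_square)
      from this[of "c z - y / q"] show ?thesis by linarith
    qed
    then have "(\<Sum>z\<in>Y. c z) \<le> (\<Sum>z\<in>Y. y / q + ((c z - y / q)\<^sup>2 / L + L) / 2)" by (rule sum_mono)
    also have "\<dots> = y * y / q + ((\<Sum>z\<in>Y. (c z - y / q)\<^sup>2) / L + L * y) / 2"
      by (simp add: sum.distrib y_def sum_divide_distrib[symmetric] algebra_simps)
    also have "\<dots> \<le> y * y / q + (L\<^sup>2 * y / L + L * y) / 2"
      using var L by (intro add_left_mono divide_right_mono add_right_mono) auto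
    also have "\<dots> = y * y / q + L * y" using L by (simp add: field_simps power2_eq_square)
    finally have "L ^ a * (\<Sum>z\<in>Y. c z) \<le> L ^ a * (y * y / q + L * y)"
      using L by (intro mult_left_mono) auto
    also have "\<dots> = B 0 + B 1" by (simp add: B_def e_def algebra_simps power2_eq_square)
    finally show ?thesis by (simp add: sum_distrib_left)
  qed
  have termS: "(\<Sum>z\<in>Y. L ^ (a - Suc p) * c z ^ (Suc p + 1) / q ^ e (Suc p))
      \<le> 2 ^ (a + 1) * (B (p + 2) + B p)" if p: "Suc p \<le> a" for p
  proof -
    have "(\<Sum>z\<in>Y. c z ^ (p + 2)) \<le> (\<Sum>z\<in>Y. 2 ^ (p + 2) * ((y / q) ^ (p + 2) + y ^ p * (c z - y / q)\<^sup>2))"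
    proof (intro sum_mono power_le_centered)
      fix z show "\<bar>c z - y / q\<bar> \<le> y" using c[of z] yq by linarith
    qed (use c yq in auto)
    also have "\<dots> = 2 ^ (p + 2) * (y * (y / q) ^ (p + 2) + y ^ p * (\<Sum>z\<in>Y. (c z - y / q)\<^sup>2))"
      by (simp add: sum.distrib sum_distrib_left[symmetric] y_def algebra_simps)
    also have "\<dots> \<le> 2 ^ (p + 2) * (y * (y / q) ^ (p + 2) + y ^ p * (L\<^sup>2 * y))"
      using var y0 by (intro mult_left_mono add_left_mono) auto
    also have "\<dots> \<le> 2 ^ (a + 1) * (y * (y / q) ^ (p + 2) + y ^ p * (L\<^sup>2 * y))"
      using p y0 yq by (intro mult_right_mono power_increasing add_nonneg_nonneg) auto
    finally have *: "(\<Sum>z\<in>Y. c z ^ (p + 2)) \<le> 2 ^ (a + 1) * (y * (y / q) ^ (p + 2) + y ^ p * (L\<^sup>2 * y))" .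
    define k where "k = L ^ (a - Suc p) / q ^ e (Suc p)"
    have k: "k \<ge> 0" using L q by (simp add: k_def)
    have "(\<Sum>z\<in>Y. L ^ (a - Suc p) * c z ^ (Suc p + 1) / q ^ e (Suc p)) = k * (\<Sum>z\<in>Y. c z ^ (p + 2))"
      by (simp add: k_def sum_distrib_left)
    also have "\<dots> \<le> k * (2 ^ (a + 1) * (y * (y / q) ^ (p + 2) + y ^ p * (L\<^sup>2 * y)))"
      using * k by (rule mult_left_mono)
    also have "\<dots> = 2 ^ (a + 1) * (k * (y * (y / q) ^ (p + 2)) + k * (y ^ p * (L\<^sup>2 * y)))"
      by (simp add: algebra_simps)
    also have "\<dots> \<le> 2 ^ (a + 1) * (B (p + 2) + B p)"
    proof (intro mult_left_mono add_mono)
      have "Suc a - (p + 2) = a - Suc p" by simp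
      moreover have "e (p + 2) = e (Suc p) + (p + 2)" using eS[of "Suc p"] by simp
      ultimately show "k * (y * (y / q) ^ (p + 2)) \<le> B (p + 2)"
        by (simp add: B_def k_def power_divide power_add mult_ac)
      have "L ^ (Suc a - p) = L ^ (a - Suc p) * L\<^sup>2"
        using p by (metis Suc_diff_Suc Suc_diff_le Suc_leD add_2_eq_Suc' less_eq_Suc_le power_add)
      then have "k * (y ^ p * (L\<^sup>2 * y)) = L ^ (Suc a - p) * y ^ (p + 1) / q ^ e (Suc p)"
        by (simp add: k_def)
      also have "\<dots> \<le> B p" unfolding B_def
        using L q y0 eS[of p] by (intro divide_left_mono power_increasing mult_nonneg_nonneg) auto
      finally show "k * (y ^ p * (L\<^sup>2 * y)) \<le> B p" .
    qed simp
    finally show ?thesis .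
  qed
  have "clique_count N (Suc a) Y
      \<le> (\<Sum>z\<in>Y. 2 ^ (a * (a + 2)) * (\<Sum>p\<le>a. L ^ (a - p) * c z ^ (p + 1) / q ^ e p))"
    unfolding clique_count.simps c_def e_def using Suc.prems by (intro sum_mono Suc.IH) auto
  also have "\<dots> = 2 ^ (a * (a + 2)) * (\<Sum>p\<le>a. \<Sum>z\<in>Y. L ^ (a - p) * c z ^ (p + 1) / q ^ e p)"
    by (subst sum.swap) (simp add: sum_distrib_left)
  also have "(\<Sum>p\<le>a. \<Sum>z\<in>Y. L ^ (a - p) * c z ^ (p + 1) / q ^ e p)
      = (\<Sum>z\<in>Y. L ^ a * c z) + (\<Sum>p<a. \<Sum>z\<in>Y. L ^ (a - Suc p) * c z ^ (Suc p + 1) / q ^ e (Suc p))"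
    by (subst sum.atMost_shift) (simp add: e_def)
  also have "\<dots> \<le> (B 0 + B 1) + (\<Sum>p<a. 2 ^ (a + 1) * (B (p + 2) + B p))"
    using term0 termS by (intro add_mono sum_mono) auto
  also have "\<dots> \<le> 2 ^ (a + 1) * ((B 0 + B 1) + (\<Sum>p<a. B (p + 2)) + (\<Sum>p<a. B p))"
  proof -
    have "1 * (B 0 + B 1) \<le> 2 ^ (a + 1) * (B 0 + B 1)"
      by (intro mult_right_mono one_le_power add_nonneg_nonneg B0) auto
    moreover have "(\<Sum>p<a. 2 ^ (a + 1) * (B (p + 2) + B p))
        = 2 ^ (a + 1) * ((\<Sum>p<a. B (p + 2)) + (\<Sum>p<a. B p))"
      by (simp only: sum_distrib_left[symmetric] sum.distrib)
    ultimately show ?thesis by (simp only: distrib_left mult_1)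
  qed
  \<comment> \<open>Each new term is hit at most twice, once by each of the two shifts. The whole
    step costs 2^(a+2), and a(a+2) + (a+2) \<le> (a+1)(a+3) accounts for the exponent in the
    constant.\<close>
  also have "(B 0 + B 1) + (\<Sum>p<a. B (p + 2)) + (\<Sum>p<a. B p) \<le> (\<Sum>p\<le>Suc a. B p) + (\<Sum>p\<le>Suc a. B p)"
  proof (intro add_mono)
    have "(\<Sum>p\<le>Suc a. B p) = B 0 + (B 1 + (\<Sum>p<a. B (p + 2)))"
      by (subst sum.atMost_shift, subst sum.lessThan_Suc_shift) simp
    then show "B 0 + B 1 + (\<Sum>p<a. B (p + 2)) \<le> (\<Sum>p\<le>Suc a. B p)" by simp
    show "(\<Sum>p<a. B p) \<le> (\<Sum>p\<le>Suc a. B p)" by (intro sum_mono2 B0) auto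
  qed
  finally have "clique_count N (Suc a) Y \<le> 2 ^ (a * (a + 2)) * (2 ^ (a + 1) * (2 * (\<Sum>p\<le>Suc a. B p)))"
    by simp
  also have "\<dots> = 2 ^ (a * (a + 2) + (a + 2)) * (\<Sum>p\<le>Suc a. B p)"
    by (simp add: power_add)
  also have "\<dots> \<le> 2 ^ (Suc a * (Suc a + 2)) * (\<Sum>p\<le>Suc a. B p)"
    by (intro mult_right_mono power_increasing sum_nonneg B0) auto
  finally show ?case by (simp add: B_def e_def y_def)
qed

section \<open>Quadratic spaces over finite fields\<close>

text \<open>
  The scalars form a field inside a commutative ring with a possibly different unit.
\<close>

locale quadratic_space =
  fixes K :: "'a::comm_ring_1 set" and e :: 'a
    and V :: "'v::ab_group_add set" and sc :: "'a \<Rightarrow> 'v \<Rightarrow> 'v" and dt :: "'v \<Rightarrow> 'v \<Rightarrow> 'a"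
    and q d :: nat
  assumes finK: "finite K" and cardK: "card K = q" and q5: "q \<ge> 5"
    and K0 [simp]: "0 \<in> K" and Ke [simp]: "e \<in> K"
    and K_diff [simp]: "\<And>a b. a \<in> K \<Longrightarrow> b \<in> K \<Longrightarrow> a - b \<in> K"
    and K_mult [simp]: "\<And>a b. a \<in> K \<Longrightarrow> b \<in> K \<Longrightarrow> a * b \<in> K"
    and e_mult [simp]: "\<And>a. a \<in> K \<Longrightarrow> e * a = a"
    and inverse_ex: "\<And>a. a \<in> K \<Longrightarrow> a \<noteq> 0 \<Longrightarrow> \<exists>b\<in>K. a * b = e"
    and two_nonzero: "e + e \<noteq> 0"
    and finV: "finite V" and cardV: "card V = q ^ d" and d2: "d \<ge> 2"
    and V0 [simp]: "0 \<in> V"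
    and V_diff [simp]: "\<And>u v. u \<in> V \<Longrightarrow> v \<in> V \<Longrightarrow> u - v \<in> V"
    and sc_V [simp]: "\<And>a v. a \<in> K \<Longrightarrow> v \<in> V \<Longrightarrow> sc a v \<in> V"
    and sc_cancel: "\<And>a b v. a * b = e \<Longrightarrow> a \<in> K \<Longrightarrow> b \<in> K \<Longrightarrow> v \<in> V \<Longrightarrow> sc a (sc b v) = v"
    and sc_add_left: "\<And>a b v. a \<in> K \<Longrightarrow> b \<in> K \<Longrightarrow> v \<in> V \<Longrightarrow> sc (a + b) v = sc a v + sc b v"
    and dt_K [simp]: "\<And>u v. u \<in> V \<Longrightarrow> v \<in> V \<Longrightarrow> dt u v \<in> K"
    and dt_commute: "\<And>u v. dt u v = dt v u"
    and dt_diff_left: "\<And>u v w. dt (u - v) w = dt u w - dt v w"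
    and dt_sc_left: "\<And>a u v. dt (sc a u) v = a * dt u v"
    and nondeg: "\<And>v. v \<in> V \<Longrightarrow> (\<And>w. w \<in> V \<Longrightarrow> dt v w = 0) \<Longrightarrow> v = 0"
begin

section \<open>Scalars and polarization\<close>

lemma K_minus [simp]: "a \<in> K \<Longrightarrow> - a \<in> K"
  using K_diff[of 0 a] by simp

lemma K_add [simp]: "a \<in> K \<Longrightarrow> b \<in> K \<Longrightarrow> a + b \<in> K"
  using K_diff[of a "- b"] by simp

lemma V_minus [simp]: "v \<in> V \<Longrightarrow> - v \<in> V"
  using V_diff[of 0 v] by simp

lemma V_add [simp]: "u \<in> V \<Longrightarrow> v \<in> V \<Longrightarrow> u + v \<in> V"
  using V_diff[of u "- v"] by simp

lemma dt_zero [simp]: "dt 0 v = 0" "dt v 0 = 0"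
  using dt_diff_left[of 0 0 v] dt_commute by auto

lemma dt_minus_left: "dt (- u) v = - dt u v"
  using dt_diff_left[of 0 u v] by simp

lemma dt_add_left: "dt (u + v) w = dt u w + dt v w"
  using dt_diff_left[of u "- v" w] by (simp add: dt_minus_left)

lemma dt_diff_right: "dt w (u - v) = dt w u - dt w v"
  and dt_minus_right: "dt w (- u) = - dt w u"
  and dt_add_right: "dt w (u + v) = dt w u + dt w v"
  and dt_sc_right: "dt w (sc a u) = a * dt w u"
  by (metis dt_commute dt_diff_left, metis dt_commute dt_minus_left,
      metis dt_commute dt_add_left, metis dt_commute dt_sc_left)

lemmas dt_linear = dt_diff_left dt_diff_right dt_minus_left dt_minus_right
  dt_add_left dt_add_right dt_sc_left dt_sc_right

definition Q :: "'v \<Rightarrow> 'a" where "Q v = dt v v"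

lemma Q_K [simp]: "v \<in> V \<Longrightarrow> Q v \<in> K" by (simp add: Q_def)

lemma Q_zero [simp]: "Q 0 = 0" by (simp add: Q_def)

lemma Q_minus [simp]: "Q (- v) = Q v" by (simp add: Q_def dt_linear)

lemma Q_diff_commute: "Q (u - v) = Q (v - u)"
  using Q_minus[of "u - v"] by simp

lemma Q_add: "Q (u + v) = Q u + 2 * dt u v + Q v"
  using dt_commute[of u v] by (simp add: Q_def dt_linear algebra_simps)

lemma Q_diff: "Q (u - v) = Q u - 2 * dt u v + Q v"
  using dt_commute[of u v] by (simp add: Q_def dt_linear algebra_simps)

lemma Q_sc: "Q (sc a v) = a * a * Q v"
  by (simp add: Q_def dt_linear algebra_simps)

lemma K_cancel:
  assumes "a \<in> K" "b \<in> K" "a * b = 0" shows "a = 0 \<or> b = 0"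
proof (rule ccontr)
  assume ne: "\<not> (a = 0 \<or> b = 0)"
  then obtain c where "c \<in> K" "a * c = e" using inverse_ex assms by blast
  then have "b = (a * b) * c" using assms by (metis e_mult mult.assoc mult.commute)
  then show False using assms ne by simp
qed

lemma double_zero:
  assumes "a \<in> K" "2 * a = 0" shows "a = 0"
proof -
  have "(e + e) * a = 2 * a" using assms(1) by (simp only: distrib_right e_mult mult_2)
  then show ?thesis using K_cancel assms two_nonzero K_add Ke by metis
qed

lemma double_eq:
  assumes "a \<in> K" "b \<in> K" "2 * a = 2 * b" shows "a = b"
  using double_zero[of "a - b"] assms by (simp add: algebra_simps)

lemma q_pos: "real q > 0" "q > 0" using q5 by auto

section \<open>Subspaces, level sets of functionals and quadrics\<close>

definition subspace :: "'v set \<Rightarrow> bool" where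
  "subspace W \<longleftrightarrow> W \<subseteq> V \<and> 0 \<in> W \<and> (\<forall>u\<in>W. \<forall>v\<in>W. u + v \<in> W) \<and> (\<forall>a\<in>K. \<forall>u\<in>W. sc a u \<in> W)"

text \<open>The locale lists few axioms for \<open>sc\<close>; identities between vectors are
  recovered by pairing their difference with every vector and using \<open>nondeg\<close>.\<close>

lemma sc_minus_e:
  assumes "v \<in> V" shows "sc (- e) v = - v"
proof -
  have "sc (- e) v + v = 0"
  proof (rule nondeg)
    fix w assume "w \<in> V"
    then show "dt (sc (- e) v + v) w = 0" using assms by (simp add: dt_linear)
  qed (use assms in simp)
  then show ?thesis by (simp add: eq_neg_iff_add_eq_0)
qed

lemma subspaceD:
  assumes "subspace W"
  shows "W \<subseteq> V" "0 \<in> W" "u \<in> W \<Longrightarrow> v \<in> W \<Longrightarrow> u + v \<in> W" "a \<in> K \<Longrightarrow> u \<in> W \<Longrightarrow> sc a u \<in> W"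
    "u \<in> W \<Longrightarrow> - u \<in> W" "u \<in> W \<Longrightarrow> v \<in> W \<Longrightarrow> u - v \<in> W"
proof -
  show neg: "- u \<in> W" if "u \<in> W" for u
    using assms that sc_minus_e[of u] unfolding subspace_def by (metis K_minus Ke in_mono)
  then show "u \<in> W \<Longrightarrow> v \<in> W \<Longrightarrow> u - v \<in> W"
    using assms unfolding subspace_def by (metis add_uminus_conv_diff)
qed (use assms in \<open>auto simp: subspace_def\<close>)

lemma subspace_V: "subspace V" by (simp add: subspace_def)

lemma finite_subspace: "subspace W \<Longrightarrow> finite W"
  using subspaceD(1) finV finite_subset by blast

definition perp :: "'v set \<Rightarrow> 'v set" where
  "perp A = {w\<in>V. \<forall>u\<in>A. dt u w = 0}"

lemma subspace_perp: "subspace (perp A)"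
  by (auto simp: subspace_def perp_def dt_linear)

text \<open>The level sets of a functional that is nonzero on \<open>W\<close> are translates of one
  another by multiples of \<open>w1\<close>, hence \<open>q\<close> sets of equal size.\<close>

lemma card_level_set:
  assumes W: "subspace W" and u: "u \<in> V" and w1: "w1 \<in> W" "dt u w1 \<noteq> 0" and c: "c \<in> K"
  shows "q * card {w\<in>W. dt u w = c} = card W"
proof -
  have WV: "w \<in> V" if "w \<in> W" for w using that subspaceD(1)[OF W] by blast
  obtain b where b: "b \<in> K" "dt u w1 * b = e" using inverse_ex w1 u WV by force
  have eq: "card {w\<in>W. dt u w = c} = card {w\<in>W. dt u w = 0}" if "c \<in> K" for c
  proof -
    have "c * b * dt u w1 = c" using b that by (metis e_mult mult.assoc mult.commute)
    then have s: "dt u (sc (c * b) w1) = c" by (simp add: dt_sc_right)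
    have sW: "sc (c * b) w1 \<in> W" using subspaceD(4)[OF W] b that w1 by simp
    show ?thesis
    proof (rule bij_betw_same_card[OF bij_betw_byWitness[where f = "\<lambda>w. w - sc (c * b) w1" and f' = "\<lambda>w. w + sc (c * b) w1"]])
    qed (use s sW subspaceD[OF W] in \<open>auto simp: dt_linear\<close>)
  qed
  have "card W = (\<Sum>c\<in>K. card {w\<in>W. dt u w = c})"
  proof -
    have "card W = card (\<Union>c\<in>K. {w\<in>W. dt u w = c})"
      by (rule arg_cong[of _ _ card]) (use u WV in auto)
    also have "\<dots> = (\<Sum>c\<in>K. card {w\<in>W. dt u w = c})"
    proof (rule card_UN_disjoint[OF finK])
      show "\<forall>c\<in>K. finite {w\<in>W. dt u w = c}" using finite_subspace[OF W] by simp
      show "\<forall>c\<in>K. \<forall>c'\<in>K. c \<noteq> c' \<longrightarrow> {w\<in>W. dt u w = c} \<inter> {w\<in>W. dt u w = c'} = {}" by blast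
    qed
    finally show ?thesis .
  qed
  also have "\<dots> = (\<Sum>c'\<in>K. card {w\<in>W. dt u w = c})"
    by (intro sum.cong refl trans[OF eq eq[OF c, symmetric]])
  finally show ?thesis by (simp add: cardK)
qed

text \<open>Subtracting the equations of two roots s and t leaves t - s times a linear expression,
  whose only zero is found with the inverse of \<open>a\<close>.\<close>

lemma card_quadratic_roots:
  assumes "a \<in> K" "b \<in> K" "c \<in> K" "a \<noteq> 0"
  shows "card {s\<in>K. a * s * s + 2 * b * s = c} \<le> 2"
proof (cases "{s\<in>K. a * s * s + 2 * b * s = c} = {}")
  case True then show ?thesis by (metis card.empty zero_le)
next
  case False
  then obtain s where s: "s \<in> K" "a * s * s + 2 * b * s = c" by blast
  obtain a' where a': "a' \<in> K" "a * a' = e" using inverse_ex assms by blast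
  have "{s\<in>K. a * s * s + 2 * b * s = c} \<subseteq> {s, - (2 * b * a') - s}"
  proof
    fix t assume "t \<in> {s\<in>K. a * s * s + 2 * b * s = c}"
    then have t: "t \<in> K" "a * t * t + 2 * b * t = c" by auto
    have "(t - s) * (a * (t + s) + (b + b)) = 0" using s(2) t(2) by (simp add: algebra_simps)
    then consider "t = s" | "a * (t + s) + (b + b) = 0"
      using K_cancel[of "t - s" "a * (t + s) + (b + b)"] s(1) t(1) assms(1,2)
      by (metis K_add K_diff K_mult eq_iff_diff_eq_0)
    then show "t \<in> {s, - (2 * b * a') - s}"
    proof cases
      case 2
      then have "a' * (a * (t + s)) + a' * (2 * b) = 0" by (simp add: distrib_left[symmetric])
      moreover have "a' * (a * (t + s)) = t + s"
        using a' s t by (metis K_add e_mult mult.assoc mult.commute)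
      ultimately have "(t + s) + a' * (2 * b) = 0" by (simp only:)
      then have "t = - (2 * b * a') - s" by (simp add: algebra_simps eq_neg_iff_add_eq_0)
      then show ?thesis by simp
    qed simp
  qed
  then have "card {s\<in>K. a * s * s + 2 * b * s = c} \<le> card {s, - (2 * b * a') - s}"
    by (intro card_mono) auto
  also have "\<dots> \<le> 2" by (simp add: card_insert_if)
  finally show ?thesis .
qed

text \<open>Slice \<open>W\<close> by the lines in an anisotropic direction.\<close>

lemma card_quadric_le:
  assumes W: "subspace W" and c0: "c0 \<in> W" "Q c0 \<noteq> 0" and u: "u \<in> V" and t: "t \<in> K"
  shows "q * card {w\<in>W. Q (u + w) = t} \<le> 2 * card W"
proof -
  have WV: "w \<in> V" if "w \<in> W" for w using that subspaceD(1)[OF W] by blast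
  have fW: "finite W" using finite_subspace[OF W] .
  have shift: "card {w\<in>W. Q (u + w + sc s c0) = t} = card {w\<in>W. Q (u + w) = t}" if "s \<in> K" for s
  proof (rule bij_betw_same_card[OF bij_betw_byWitness[where f = "\<lambda>w. w + sc s c0" and f' = "\<lambda>w. w - sc s c0"]])
  qed (use that c0 subspaceD[OF W] in \<open>auto simp: add.assoc\<close>)
  have "q * card {w\<in>W. Q (u + w) = t} = (\<Sum>s\<in>K. card {w\<in>W. Q (u + w + sc s c0) = t})"
    by (simp add: shift cardK)
  also have "\<dots> = (\<Sum>s\<in>K. \<Sum>w\<in>W. of_bool (Q (u + w + sc s c0) = t))"
    using fW by (simp add: of_bool_def sum.If_cases Int_def)
  also have "\<dots> = (\<Sum>w\<in>W. \<Sum>s\<in>K. of_bool (Q (u + w + sc s c0) = t))" by (rule sum.swap)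
  also have "\<dots> = (\<Sum>w\<in>W. card {s\<in>K. Q (u + w + sc s c0) = t})"
    using finK by (simp add: of_bool_def sum.If_cases Int_def)
  also have "\<dots> \<le> (\<Sum>w\<in>W. 2)"
  proof (rule sum_mono)
    fix w assume w: "w \<in> W"
    have "{s\<in>K. Q (u + w + sc s c0) = t}
        = {s\<in>K. Q c0 * s * s + 2 * dt (u + w) c0 * s = t - Q (u + w)}"
      unfolding Q_add[of "u + w"] Q_sc dt_sc_right by (auto simp: algebra_simps)
    moreover have "card \<dots> \<le> 2"
      using c0 u t w WV by (intro card_quadratic_roots) auto
    ultimately show "card {s\<in>K. Q (u + w + sc s c0) = t} \<le> 2" by simp
  qed
  finally show ?thesis by simp
qed

lemma isotropic_imp_orthogonal:
  assumes W: "subspace W" and iso: "\<And>w. w \<in> W \<Longrightarrow> Q w = 0" and "u \<in> W" "w \<in> W"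
  shows "dt u w = 0"
proof -
  have V: "u \<in> V" "w \<in> V" using assms subspaceD(1)[OF W] by auto
  have "Q (u + w) = 0" "Q u = 0" "Q w = 0" using assms subspaceD(3)[OF W] by auto
  then show ?thesis using double_zero[of "dt u w"] V by (simp add: Q_add)
qed

text \<open>The double complement plays the role of the linear span. An element of the larger one
  differs from an element of the smaller one by a multiple of \<open>u\<close>, namely the multiple
  that kills the pairing with \<open>w1\<close>.\<close>

lemma card_perp_perp_insert:
  assumes "A \<subseteq> V" "u \<in> V" "u \<notin> perp (perp A)"
  shows "card (perp (perp (insert u A))) \<le> q * card (perp (perp A))"
proof -
  have AV: "perp A \<subseteq> V" by (auto simp: perp_def)
  obtain w1 where w1: "w1 \<in> perp A" "dt u w1 \<noteq> 0"
    using assms by (auto simp: perp_def dt_commute)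
  then have w1V: "w1 \<in> V" using AV by blast
  obtain b where b: "b \<in> K" "dt u w1 * b = e" using inverse_ex w1 assms w1V by force
  have "perp (perp (insert u A)) \<subseteq> (\<lambda>(v, s). v + sc s u) ` (perp (perp A) \<times> K)"
  proof
    fix v assume v: "v \<in> perp (perp (insert u A))"
    then have vV: "v \<in> V" by (simp add: perp_def)
    define s where "s = dt v w1 * b"
    have sK: "s \<in> K" using b vV w1V by (simp add: s_def)
    have "v - sc s u \<in> perp (perp A)"
      unfolding perp_def[of "perp A"]
    proof (intro CollectI conjI ballI)
      show "v - sc s u \<in> V" using vV sK assms by simp
      fix w assume w: "w \<in> perp A"
      then have wV: "w \<in> V" using AV by blast
      \<comment> \<open>Correcting \<open>w\<close> by a multiple of \<open>w1\<close> makes it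
        orthogonal to \<open>u\<close> as well, and therefore to \<open>v\<close>.\<close>
      define r where "r = dt u w * b"
      have rK: "r \<in> K" using b wV assms by (simp add: r_def)
      have "r * dt u w1 = (dt u w1 * b) * dt u w" by (simp add: r_def mult_ac)
      also have "\<dots> = dt u w" using b wV assms(2) by simp
      finally have "dt u (w - sc r w1) = 0" by (simp add: dt_linear)
      moreover have "w - sc r w1 \<in> perp A"
        by (intro subspaceD(6)[OF subspace_perp] subspaceD(4)[OF subspace_perp] w w1(1) rK)
      ultimately have "w - sc r w1 \<in> perp (insert u A)" by (simp add: perp_def)
      then have "dt (w - sc r w1) v = 0" using v by (simp add: perp_def[of "perp (insert u A)"])
      then have "dt w v = r * dt w1 v" by (simp add: dt_linear)
      also have "\<dots> = s * dt u w" by (simp add: r_def s_def dt_commute mult_ac)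
      finally show "dt w (v - sc s u) = 0" by (simp add: dt_linear dt_commute)
    qed
    then show "v \<in> (\<lambda>(v, s). v + sc s u) ` (perp (perp A) \<times> K)"
      using sK by (intro image_eqI[of _ _ "(v - sc s u, s)"]) auto
  qed
  then have "card (perp (perp (insert u A))) \<le> card ((\<lambda>(v, s). v + sc s u) ` (perp (perp A) \<times> K))"
    using finK finite_subspace[OF subspace_perp] by (intro card_mono) auto
  also have "\<dots> \<le> card (perp (perp A) \<times> K)"
    using finK finite_subspace[OF subspace_perp] by (intro card_image_le) auto
  finally show ?thesis by (simp add: card_cartesian_product cardK mult.commute)
qed

lemma perp_empty: "perp {} = V" by (simp add: perp_def)

lemma perp_V: "perp V = {0}"
  using nondeg dt_commute by (auto simp: perp_def)

text \<open>The list grows at its head. Lying outside the double complement of the tail expresses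
  linear independence. The anisotropic vector in the complement of the tail provides reflections
  that fix the earlier points; no such demand is made on the complement of the full list.\<close>

fun generic :: "'v list \<Rightarrow> bool" where
  "generic [] \<longleftrightarrow> True"
| "generic (b # bs) \<longleftrightarrow> generic bs \<and> b \<notin> perp (perp (set bs)) \<and> (\<exists>w\<in>perp (set bs). Q w \<noteq> 0)"

lemma perp_perpD:
  assumes "b \<in> V" "b \<notin> perp (perp A)"
  shows "\<exists>w\<in>perp A. dt b w \<noteq> 0"
  using assms by (auto simp: perp_def dt_commute)

text \<open>Each new vector divides the size of the complement by exactly \<open>q\<close> and
  multiplies that of the double complement by at most \<open>q\<close>. These cardinalities stand in
  for dimension theory.\<close>

lemma card_perp_generic:
  assumes "generic bs" "set bs \<subseteq> V"
  shows "card (perp (set bs)) * q ^ length bs = q ^ d \<and> card (perp (perp (set bs))) \<le> q ^ length bs"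
  using assms
proof (induction bs)
  case Nil
  then show ?case by (simp add: perp_empty perp_V cardV)
next
  case (Cons b bs)
  have b: "b \<in> V" "b \<notin> perp (perp (set bs))" using Cons.prems by auto
  obtain w1 where w1: "w1 \<in> perp (set bs)" "dt b w1 \<noteq> 0" using perp_perpD[OF b] by blast
  have "perp (set (b # bs)) = {w\<in>perp (set bs). dt b w = 0}"
    by (auto simp: perp_def)
  then have "q * card (perp (set (b # bs))) = card (perp (set bs))"
    using card_level_set[OF subspace_perp b(1) w1, of 0] by simp
  moreover have "card (perp (perp (set (b # bs)))) \<le> q * card (perp (perp (set bs)))"
    using card_perp_perp_insert[of "set bs" b] b Cons.prems by simp
  moreover have IH: "card (perp (set bs)) * q ^ length bs = q ^ d"
      "card (perp (perp (set bs))) \<le> q ^ length bs"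
    using Cons.IH Cons.prems by auto
  ultimately have "(q * card (perp (set (b # bs)))) * q ^ length bs = q ^ d"
    and "card (perp (perp (set (b # bs)))) \<le> q * q ^ length bs"
    by (simp_all only:) (meson le_trans mult_le_mono2)
  then show ?case by (simp add: mult_ac)
qed

lemma generic_length_le:
  assumes "generic bs" "set bs \<subseteq> V"
  shows "length bs \<le> d"
proof -
  have "q ^ length bs dvd q ^ d" using card_perp_generic[OF assms] by (metis dvd_triv_right)
  then show ?thesis using q5 by (intro power_dvd_imp_le[of q]) auto
qed

lemma generic_card_perp:
  assumes "generic bs" "set bs \<subseteq> V"
  shows "card (perp (set bs)) = q ^ (d - length bs)"
proof -
  have "card (perp (set bs)) * q ^ length bs = q ^ (d - length bs) * q ^ length bs"
    using card_perp_generic[OF assms] generic_length_le[OF assms] by (simp add: power_add[symmetric])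
  then show ?thesis using q5 by simp
qed

text \<open>A totally isotropic complement would lie in its own complement, which has at most
  q^(length bs) elements; comparing sizes forces d \<le> 2 \<open>length bs\<close>.\<close>

lemma anisotropic_ex:
  assumes "generic bs" "set bs \<subseteq> V" "2 * length bs < d"
  shows "\<exists>w\<in>perp (set bs). Q w \<noteq> 0"
proof (rule ccontr)
  assume "\<not> ?thesis"
  then have "perp (set bs) \<subseteq> perp (perp (set bs))"
    using isotropic_imp_orthogonal[OF subspace_perp] by (auto simp: perp_def[of "perp (set bs)"]) (auto simp: perp_def)
  then have "card (perp (set bs)) \<le> card (perp (perp (set bs)))"
    using finite_subspace[OF subspace_perp] by (intro card_mono) auto
  then have "q ^ (d - length bs) \<le> q ^ length bs"
    using card_perp_generic[OF assms(1,2)] generic_card_perp[OF assms(1,2)] by simp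
  then have "d - length bs \<le> length bs" using q5 by (simp add: power_increasing_iff)
  then show False using assms(3) by simp
qed

end

section \<open>The isometry group\<close>

context quadratic_space
begin

lemma sc_e:
  assumes "v \<in> V" shows "sc e v = v"
proof -
  have "sc e v - v = 0"
  proof (rule nondeg)
    fix w assume "w \<in> V"
    then show "dt (sc e v - v) w = 0" using assms by (simp add: dt_linear)
  qed (use assms in simp)
  then show ?thesis by simp
qed

lemma sc_diff_left:
  assumes "a \<in> K" "b \<in> K" "v \<in> V" shows "sc (a - b) v = sc a v - sc b v"
  using sc_add_left[of "a - b" b v] assms by (simp add: algebra_simps)

text \<open>Only distances are preserved, with no linearity built in; inner products are recovered
  in \<open>isoms_dt\<close>. Extensionality makes the set finite, so that isometries can be
  counted.\<close>

definition isoms :: "('v \<Rightarrow> 'v) set" where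
  "isoms = {g \<in> V \<rightarrow>\<^sub>E V. bij_betw g V V \<and> (\<forall>x\<in>V. \<forall>y\<in>V. Q (g x - g y) = Q (x - y))}"

lemma finite_isoms: "finite isoms"
  unfolding isoms_def using finV by (auto intro: finite_subset[OF _ finite_PiE[OF finV, of "\<lambda>_. V"]])

lemma isomsD:
  assumes "g \<in> isoms"
  shows "x \<in> V \<Longrightarrow> g x \<in> V" "x \<in> V \<Longrightarrow> y \<in> V \<Longrightarrow> Q (g x - g y) = Q (x - y)" "bij_betw g V V"
    "g \<in> extensional V"
  using assms by (auto simp: isoms_def PiE_def)

lemma isoms_inj:
  assumes "g \<in> isoms" "x \<in> V" "y \<in> V" "g x = g y" shows "x = y"
  using isomsD(3)[OF assms(1)] assms by (auto simp: bij_betw_def inj_on_def)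

text \<open>Polarization: the inner product of two differences is determined by three squared
  distances, since doubling is injective.\<close>

lemma isoms_dt:
  assumes "g \<in> isoms" "x \<in> V" "u \<in> V" "v \<in> V"
  shows "dt (g u - g x) (g v - g x) = dt (u - x) (v - x)"
proof -
  have *: "2 * dt (a - x) (b - x) = Q (a - x) + Q (b - x) - Q (a - b)" for a b x
    using Q_diff[of "a - x" "b - x"] by (simp add: algebra_simps)
  have "2 * dt (g u - g x) (g v - g x) = 2 * dt (u - x) (v - x)"
    unfolding * using isomsD(2)[OF assms(1)] assms by simp
  then show ?thesis by (rule double_eq[rotated 2]) (use assms isomsD(1)[OF assms(1)] in auto)
qed

section \<open>Group operations, transporters and stabilizers\<close>

lemma isoms_compose:
  assumes "g \<in> isoms" "h \<in> isoms" shows "compose V g h \<in> isoms"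
proof -
  have 1: "bij_betw (compose V g h) V V"
    by (rule bij_betw_compose[OF isomsD(3)[OF assms(2)] isomsD(3)[OF assms(1)]])
  have 2: "compose V g h x = g (h x)" "h x \<in> V" "g (h x) \<in> V" if "x \<in> V" for x
    using that isomsD(1)[OF assms(2) that] isomsD(1)[OF assms(1)] by (simp_all add: compose_def)
  have "Q (compose V g h x - compose V g h y) = Q (x - y)" if "x \<in> V" "y \<in> V" for x y
    unfolding 2(1)[OF that(1)] 2(1)[OF that(2)]
    by (simp only: isomsD(2)[OF assms(1) 2(2) 2(2)] isomsD(2)[OF assms(2)] that)
  moreover have "compose V g h \<in> V \<rightarrow>\<^sub>E V"
    using 2 by (intro PiE_I) (auto simp: compose_def)
  ultimately show ?thesis using 1 by (simp add: isoms_def)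
qed

lemma isoms_inverse:
  assumes "g \<in> isoms"
  shows "restrict (inv_into V g) V \<in> isoms"
    and "x \<in> V \<Longrightarrow> g (inv_into V g x) = x" and "x \<in> V \<Longrightarrow> inv_into V g (g x) = x"
    and "x \<in> V \<Longrightarrow> inv_into V g x \<in> V"
proof -
  have b: "bij_betw g V V" using isomsD(3)[OF assms] .
  show 1: "g (inv_into V g x) = x" if "x \<in> V" for x using b that by (simp add: bij_betw_inv_into_right)
  show "inv_into V g (g x) = x" if "x \<in> V" for x using b that by (simp add: bij_betw_inv_into_left)
  have b': "bij_betw (inv_into V g) V V" using b by (rule bij_betw_inv_into)
  show 2: "inv_into V g x \<in> V" if "x \<in> V" for x using b' that by (auto simp: bij_betw_def)
  have "bij_betw (restrict (inv_into V g) V) V V"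
    using b' by (simp cong: bij_betw_cong)
  moreover have "Q (inv_into V g x - inv_into V g y) = Q (x - y)" if "x \<in> V" "y \<in> V" for x y
    using isomsD(2)[OF assms, of "inv_into V g x" "inv_into V g y"] 1 2 that by simp
  ultimately show "restrict (inv_into V g) V \<in> isoms" using 2 by (auto simp: isoms_def)
qed

text \<open>For \<open>ps' = ps\<close> this is a pointwise stabilizer; otherwise a transporter,
  which is empty or a coset of a stabilizer.\<close>

definition fixers :: "'v list \<Rightarrow> 'v list \<Rightarrow> ('v \<Rightarrow> 'v) set" where
  "fixers ps ps' = {g \<in> isoms. map g ps = ps'}"

lemma finite_fixers [simp]: "finite (fixers ps ps')"
  using finite_isoms by (simp add: fixers_def)

lemma compose_fixers:
  assumes "g \<in> fixers ps' ps''" "h \<in> fixers ps ps'" "set ps \<subseteq> V"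
  shows "compose V g h \<in> fixers ps ps''"
  using assms isoms_compose unfolding fixers_def by (auto simp: compose_def)

lemma inverse_fixers:
  assumes "g \<in> fixers ps ps'" "set ps \<subseteq> V"
  shows "restrict (inv_into V g) V \<in> fixers ps' ps"
proof -
  have g: "g \<in> isoms" "ps' = map g ps" using assms by (auto simp: fixers_def)
  have "map (restrict (inv_into V g) V) (map g ps) = ps"
    unfolding map_map by (rule map_idI) (use assms(2) isoms_inverse(3)[OF g(1)] isomsD(1)[OF g(1)] in auto)
  then show ?thesis using g isoms_inverse(1)[OF g(1)] by (simp add: fixers_def)
qed

text \<open>Composition with the inverse of \<open>g0\<close> maps the transporter bijectively onto
  the stabilizer.\<close>

lemma card_fixers_eq:
  assumes "g0 \<in> fixers ps ps'" "set ps \<subseteq> V"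
  shows "card (fixers ps ps') = card (fixers ps ps)"
proof -
  let ?i = "restrict (inv_into V g0) V"
  have g0: "g0 \<in> isoms" using assms by (simp add: fixers_def)
  have i: "?i \<in> fixers ps' ps" using inverse_fixers assms by blast
  have V': "set ps' \<subseteq> V" using assms isomsD(1)[OF g0] by (auto simp: fixers_def subset_iff)
  have ext: "compose V g0 (compose V ?i h) = h" "compose V ?i (compose V g0 h) = h" if "h \<in> isoms" for h
    using isomsD(1,4)[OF that] isoms_inverse[OF g0] isomsD(1)[OF g0]
    by (auto simp: fun_eq_iff compose_def extensional_def)
  show ?thesis
  proof (rule bij_betw_same_card[OF bij_betw_byWitness[where f = "compose V ?i" and f' = "compose V g0"]])
    show "compose V ?i ` fixers ps ps' \<subseteq> fixers ps ps"
      using compose_fixers[OF i] assms(2) by blast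
    show "compose V g0 ` fixers ps ps \<subseteq> fixers ps ps'"
      using compose_fixers[OF assms(1)] assms(2) by blast
  qed (use ext in \<open>auto simp: fixers_def\<close>)
qed

lemma orbit_stabilizer:
  assumes "set ps \<subseteq> V" "u \<in> V"
  shows "card (fixers ps ps) = card ((\<lambda>g. g u) ` fixers ps ps) * card (fixers (u # ps) (u # ps))"
proof -
  let ?O = "(\<lambda>g. g u) ` fixers ps ps"
  have "card (fixers ps ps) = card (\<Union>v\<in>?O. fixers (u # ps) (v # ps))"
    by (rule arg_cong[of _ _ card]) (auto simp: fixers_def)
  also have "\<dots> = (\<Sum>v\<in>?O. card (fixers (u # ps) (v # ps)))"
  proof (rule card_UN_disjoint)
    show "\<forall>i\<in>?O. \<forall>j\<in>?O. i \<noteq> j \<longrightarrow> fixers (u # ps) (i # ps) \<inter> fixers (u # ps) (j # ps) = {}"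
      by (auto simp: fixers_def)
  qed auto
  also have "\<dots> = (\<Sum>v\<in>?O. card (fixers (u # ps) (u # ps)))"
  proof (rule sum.cong[OF refl])
    fix v assume "v \<in> ?O"
    then obtain g where "g \<in> fixers (u # ps) (v # ps)" by (auto simp: fixers_def)
    then show "card (fixers (u # ps) (v # ps)) = card (fixers (u # ps) (u # ps))"
      using card_fixers_eq assms by simp
  qed
  finally show ?thesis by simp
qed

section \<open>Translations and reflections\<close>

definition trans_by :: "'v \<Rightarrow> 'v \<Rightarrow> 'v" where
  "trans_by a = restrict (\<lambda>x. x + a) V"

lemma trans_by_isoms: "a \<in> V \<Longrightarrow> trans_by a \<in> isoms"
proof -
  assume a: "a \<in> V"
  have "bij_betw (\<lambda>x. x + a) V V"
    by (rule bij_betw_byWitness[where f' = "\<lambda>x. x - a"]) (use a V_add V_diff in \<open>simp_all add: image_subset_iff\<close>)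
  then have "bij_betw (trans_by a) V V" unfolding trans_by_def by (simp only: bij_betw_restrict_eq)
  moreover have "trans_by a \<in> V \<rightarrow>\<^sub>E V" unfolding trans_by_def by (simp add: a)
  ultimately show ?thesis by (simp add: isoms_def trans_by_def)
qed

text \<open>The reflection in the hyperplane through \<open>x0\<close> orthogonal to
  \<open>w\<close>. The scalar c is the inverse of \<open>Q w\<close>, so the formula is the usual x
  - 2 B(x - x0, w) / Q(w) times w.\<close>

definition refl_at :: "'v \<Rightarrow> 'v \<Rightarrow> 'v \<Rightarrow> 'v" where
  "refl_at x0 w = (SOME g. \<exists>c\<in>K. Q w * c = e \<and> g = restrict (\<lambda>x. x - sc (2 * dt (x - x0) w * c) w) V)"

lemma refl_atE:
  assumes "x0 \<in> V" "w \<in> V" "Q w \<noteq> 0"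
  obtains c where "c \<in> K" "c \<noteq> 0" "Q w * c = e"
    "\<And>x. x \<in> V \<Longrightarrow> refl_at x0 w x = x - sc (2 * dt (x - x0) w * c) w" "refl_at x0 w \<in> isoms"
proof -
  have "\<exists>g. \<exists>c\<in>K. Q w * c = e \<and> g = restrict (\<lambda>x. x - sc (2 * dt (x - x0) w * c) w) V"
    using inverse_ex[of "Q w"] assms by auto
  then have "\<exists>c\<in>K. Q w * c = e \<and> refl_at x0 w = restrict (\<lambda>x. x - sc (2 * dt (x - x0) w * c) w) V"
    unfolding refl_at_def by (rule someI_ex)
  then obtain c where c1: "c \<in> K" and
    c2: "Q w * c = e \<and> refl_at x0 w = restrict (\<lambda>x. x - sc (2 * dt (x - x0) w * c) w) V"
    by (rule bexE)
  note c = c1 conjunct1[OF c2] and g = conjunct2[OF c2]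
  let ?f = "\<lambda>x. x - sc (2 * dt (x - x0) w * c) w"
  have K2: "2 * a \<in> K" if "a \<in> K" for a using K_add[OF that that] by (simp only: mult_2)
  have fV: "?f x \<in> V" if "x \<in> V" for x using that assms c K2 by simp
  have f: "Q (?f x - ?f y) = Q (x - y)" if "x \<in> V" "y \<in> V" for x y
  proof -
    define t where "t = dt (x - y) w"
    have tK: "t \<in> K" using that assms by (simp add: t_def)
    have "?f x - ?f y = (x - y) - (sc (2 * dt (x - x0) w * c) w - sc (2 * dt (y - x0) w * c) w)" by simp
    also have "sc (2 * dt (x - x0) w * c) w - sc (2 * dt (y - x0) w * c) w = sc (2 * t * c) w"
    proof (subst sc_diff_left[symmetric])
      show "2 * dt (x - x0) w * c \<in> K" "2 * dt (y - x0) w * c \<in> K" "w \<in> V"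
        using that assms c by (auto intro!: K_mult K2)
      show "sc (2 * dt (x - x0) w * c - 2 * dt (y - x0) w * c) w = sc (2 * t * c) w"
        by (simp add: t_def dt_linear algebra_simps)
    qed
    finally have "Q (?f x - ?f y) = Q ((x - y) - sc (2 * t * c) w)" by (rule arg_cong)
    also have "\<dots> = Q (x - y) - 2 * ((2 * t * c) * t) + (2 * t * c) * (2 * t * c) * Q w"
      by (subst Q_diff[of "x - y"]) (simp only: Q_sc dt_sc_right t_def mult.assoc)
    also have "(2 * t * c) * (2 * t * c) * Q w = 4 * t * t * c * (Q w * c)"
      by (simp add: mult_ac)
    also have "\<dots> = 4 * t * t * (e * c)" using c(2) by (simp add: mult_ac)
    also have "\<dots> = 4 * t * t * c" using c(1) by simp
    finally show ?thesis by (simp add: mult_ac)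
  qed
  have inv: "?f (?f x) = x" if "x \<in> V" for x
  proof -
    define s where "s = 2 * dt (x - x0) w * c"
    have sK: "s \<in> K" using that assms c K2 by (simp add: s_def)
    have "2 * dt (x - sc s w - x0) w * c = s - 2 * s * (Q w * c)"
      by (simp add: dt_linear Q_def s_def algebra_simps)
    also have "\<dots> = s - 2 * (e * s)" unfolding c(2) by (simp only: mult_ac)
    also have "\<dots> = - s" using sK by simp
    finally have "?f (?f x) = x - sc s w - sc (- s) w" by (simp add: s_def)
    also have "sc (- s) w = - sc s w"
      using sc_diff_left[of 0 s w] sc_diff_left[of s s w] sK assms by simp
    finally show ?thesis by simp
  qed
  have "bij_betw ?f V V"
    by (rule bij_betw_byWitness[where f' = "?f"]) (use inv fV in auto)
  then have "refl_at x0 w \<in> isoms" unfolding g isoms_def using f fV by (auto cong: bij_betw_cong)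
  moreover have "c \<noteq> 0" using c two_nonzero by auto
  ultimately show ?thesis using that[OF c(1) _ c(2)] g by simp
qed

lemma refl_at_fixes:
  assumes "x0 \<in> V" "w \<in> V" "Q w \<noteq> 0" "u \<in> V" "dt (u - x0) w = 0"
  shows "refl_at x0 w u = u"
proof -
  obtain c where "c \<in> K" "refl_at x0 w u = u - sc (2 * dt (u - x0) w * c) w"
    using refl_atE[OF assms(1-3)] assms(4) by metis
  moreover have "sc 0 w = 0" using sc_diff_left[of 0 0 w] assms by simp
  ultimately show ?thesis using assms(5) by simp
qed

abbreviation diffs :: "'v \<Rightarrow> 'v list \<Rightarrow> 'v list" where
  "diffs x us \<equiv> map (\<lambda>u. u - x) us"

text \<open>The base point sits at the end of the list, so that further points are added by
  consing.\<close>

abbreviation stab_card :: "'v \<Rightarrow> 'v list \<Rightarrow> nat" where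
  "stab_card x us \<equiv> card (fixers (us @ [x]) (us @ [x]))"

lemma refl_at_fixers:
  assumes "x \<in> V" "set us \<subseteq> V" "w \<in> perp (set (diffs x us))" "Q w \<noteq> 0"
  shows "refl_at x w \<in> fixers (us @ [x]) (us @ [x])"
proof -
  have w: "w \<in> V" using assms by (simp add: perp_def)
  have "refl_at x w u = u" if "u \<in> set (us @ [x])" for u
  proof (rule refl_at_fixes[OF assms(1) w assms(4)])
    show "u \<in> V" using that assms(1,2) by auto
    show "dt (u - x) w = 0" using that assms(3) by (auto simp: perp_def)
  qed
  then have "map (refl_at x w) (us @ [x]) = us @ [x]" by (rule map_idI)
  moreover have "refl_at x w \<in> isoms" using refl_atE[OF assms(1) w assms(4)] by blast
  ultimately show ?thesis by (simp only: fixers_def mem_Collect_eq simp_thms)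
qed

lemma card_fixers_inverse:
  assumes "set ps \<subseteq> V" "set ps' \<subseteq> V"
  shows "card (fixers ps ps') = card (fixers ps' ps)"
proof (rule bij_betw_same_card[OF bij_betw_byWitness[where f = "\<lambda>g. restrict (inv_into V g) V"
        and f' = "\<lambda>g. restrict (inv_into V g) V"]])
  have ii: "restrict (inv_into V (restrict (inv_into V g) V)) V = g" if g: "g \<in> isoms" for g
  proof
    fix a show "restrict (inv_into V (restrict (inv_into V g) V)) V a = g a"
    proof (cases "a \<in> V")
      case True
      have "restrict (inv_into V g) V (g a) = a"
        using True isoms_inverse(3)[OF g] isomsD(1)[OF g] by simp
      then show ?thesis
        using isoms_inverse(3)[OF isoms_inverse(1)[OF g], of "g a"] True isomsD(1)[OF g] by simp
    next
      case False
      then show ?thesis using isomsD(4)[OF g] by (simp add: extensional_def)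
    qed
  qed
  show "\<forall>a\<in>fixers ps ps'. restrict (inv_into V (restrict (inv_into V a) V)) V = a"
    and "\<forall>a\<in>fixers ps' ps. restrict (inv_into V (restrict (inv_into V a) V)) V = a"
    using ii by (auto simp: fixers_def)
  show "(\<lambda>g. restrict (inv_into V g) V) ` fixers ps ps' \<subseteq> fixers ps' ps"
    using inverse_fixers assms(1) by auto
  show "(\<lambda>g. restrict (inv_into V g) V) ` fixers ps' ps \<subseteq> fixers ps ps'"
    using inverse_fixers assms(2) by auto
qed

text \<open>Stabilizers of tuples in one orbit are conjugate; their orders are compared through the
  transporters in both directions, which inversion exchanges.\<close>

lemma card_fixers_conj:
  assumes "g0 \<in> fixers ps ps'" "set ps \<subseteq> V" "set ps' \<subseteq> V"
  shows "card (fixers ps' ps') = card (fixers ps ps)"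
proof -
  have "card (fixers ps' ps') = card (fixers ps' ps)"
    by (rule card_fixers_eq[OF inverse_fixers[OF assms(1,2)] assms(3), symmetric])
  also have "\<dots> = card (fixers ps ps')" by (rule card_fixers_inverse[OF assms(3,2)])
  also have "\<dots> = card (fixers ps ps)" by (rule card_fixers_eq[OF assms(1,2)])
  finally show ?thesis .
qed

text \<open>Translations act transitively, so every transporter between single points has the order
  of the stabilizer of the origin.\<close>

lemma card_fixers_single:
  assumes "x \<in> V" "y \<in> V"
  shows "card (fixers [x] [y]) = stab_card 0 []"
proof -
  have tr: "trans_by (y - x) \<in> fixers [x] [y]" if "x \<in> V" "y \<in> V" for x y
    using that trans_by_isoms[of "y - x"] by (simp add: fixers_def trans_by_def)
  have "card (fixers [x] [y]) = card (fixers [x] [x])"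
    by (rule card_fixers_eq[OF tr[OF assms]]) (simp add: assms)
  also have "\<dots> = card (fixers [0] [0])"
    by (rule card_fixers_conj[OF tr[OF V0 assms(1)]]) (simp_all add: assms)
  finally show ?thesis by simp
qed

text \<open>The order of the orthogonal group of the form. It is the unit in which all counts of
  isometries are expressed, and it cancels in the final comparison.\<close>

definition stab0 :: real where "stab0 = real (stab_card 0 [])"

lemma stab0_pos: "stab0 > 0"
proof -
  have "trans_by 0 \<in> fixers [0] [0]"
    using trans_by_isoms[of 0] by (simp add: fixers_def trans_by_def)
  then have "fixers [0] [0] \<noteq> {}" by blast
  then show ?thesis unfolding stab0_def by (simp add: card_gt_0_iff)
qed

lemma card_isoms: "real (card isoms) = real q ^ d * stab0"
proof -
  have "card isoms = card (\<Union>y\<in>V. fixers [0] [y])"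
    by (rule arg_cong[of _ _ card]) (use isomsD(1) in \<open>auto simp: fixers_def\<close>)
  also have "\<dots> = (\<Sum>y\<in>V. card (fixers [0] [y]))"
  proof (rule card_UN_disjoint[OF finV])
    show "\<forall>i\<in>V. \<forall>j\<in>V. i \<noteq> j \<longrightarrow> fixers [0] [i] \<inter> fixers [0] [j] = {}" by (auto simp: fixers_def)
  qed simp
  also have "\<dots> = (\<Sum>y\<in>V. stab_card 0 [])" by (intro sum.cong refl card_fixers_single) auto
  finally show ?thesis by (simp add: stab0_def cardV)
qed

section \<open>Orders of stabilizers of generic tuples\<close>

lemma diffs_V: "x \<in> V \<Longrightarrow> set us \<subseteq> V \<Longrightarrow> set (diffs x us) \<subseteq> V"
  by auto

lemma fixersD:
  assumes "g \<in> fixers ps ps" "a \<in> set ps" shows "g a = a"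
proof -
  have "map g ps = map id ps" using assms(1) by (simp add: fixers_def)
  then show ?thesis using assms(2) by (simp only: map_eq_conv id_apply)
qed

text \<open>An isometry fixing \<open>x\<close> and \<open>us\<close> moves \<open>u\<close> by a
  vector orthogonal to all fixed differences and keeps its distance to \<open>x\<close>. The orbit
  thus lies on a quadric inside a translate of the complement, which costs one power of
  \<open>q\<close>.\<close>

lemma generic_perp_orbit_le:
  assumes x: "x \<in> V" and us: "set (u # us) \<subseteq> V" and gen: "generic (diffs x (u # us))"
  shows "card ((\<lambda>g. g u) ` fixers (us @ [x]) (us @ [x])) \<le> 2 * q ^ (d - 1 - length us)"
proof -
  let ?W = "perp (set (diffs x us))"
  have V: "set (diffs x us) \<subseteq> V" using x us by auto
  obtain c0 where c0: "c0 \<in> ?W" "Q c0 \<noteq> 0" and g: "generic (diffs x us)" using gen by auto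
  have len: "length us < d"
    using generic_length_le[OF gen diffs_V[OF x us]] by simp
  let ?S = "{w\<in>?W. Q ((u - x) + w) = Q (u - x)}"
  have fW: "finite ?W" by (rule finite_subspace[OF subspace_perp])
  have "(\<lambda>g. g u) ` fixers (us @ [x]) (us @ [x]) \<subseteq> (\<lambda>w. u + w) ` ?S"
  proof
    fix v assume "v \<in> (\<lambda>g. g u) ` fixers (us @ [x]) (us @ [x])"
    then obtain g where gf: "g \<in> fixers (us @ [x]) (us @ [x])" and "v = g u" by blast
    then have g: "g \<in> isoms" "v = g u" and fx: "\<And>a. a \<in> set (us @ [x]) \<Longrightarrow> g a = a"
      using fixersD[OF gf] by (simp_all add: fixers_def)
    have uV: "u \<in> V" "v \<in> V" using us isomsD(1)[OF g(1)] g(2) by auto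
    have gx: "g x = x" using fx by simp
    have "v - u \<in> ?W"
      unfolding perp_def
    proof (intro CollectI conjI ballI)
      fix b assume "b \<in> set (diffs x us)"
      then obtain a where a: "a \<in> set us" "b = a - x" by auto
      then have "dt (g a - g x) (g u - g x) = dt (a - x) (u - x)"
        using isoms_dt[OF g(1) x, of a u] us by auto
      then have "dt b (v - x) = dt b (u - x)" using a fx gx g(2) by simp
      then show "dt b (v - u) = 0" by (simp add: dt_linear)
    qed (use uV in simp)
    moreover have "Q ((u - x) + (v - u)) = Q (u - x)"
      using isomsD(2)[OF g(1) uV(1) x] g(2) gx by simp
    ultimately show "v \<in> (\<lambda>w. u + w) ` ?S" by (intro image_eqI[of _ _ "v - u"]) auto
  qed
  then have S: "card ((\<lambda>g. g u) ` fixers (us @ [x]) (us @ [x])) \<le> card ?S"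
    using fW by (intro surj_card_le) auto
  have le: "q * card ?S \<le> 2 * card ?W"
    using card_quadric_le[OF subspace_perp c0, of "u - x" "Q (u - x)"] x us by simp
  have eq: "card ?W = q * q ^ (d - 1 - length us)"
    using generic_card_perp[OF g V] len by (simp add: Suc_diff_Suc power_Suc[symmetric] del: power_Suc)
  have "q * card ?S \<le> q * (2 * q ^ (d - 1 - length us))" using le unfolding eq by (simp only: mult.left_commute)
  then have "card ?S \<le> 2 * q ^ (d - 1 - length us)" using q_pos(2) by (simp only: mult_le_cancel1 simp_thms)
  with S show ?thesis by linarith
qed

text \<open>Points are adjoined one at a time by the orbit-stabilizer relation; with i earlier
  points besides \<open>x\<close>, the orbit has at most 2q^(d-1-i) elements.\<close>

lemma card_fixers_lower:
  assumes "x \<in> V" "set us \<subseteq> V" "generic (diffs x us)"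
  shows "stab0 \<le> 2 ^ length us * real q ^ (\<Sum>i<length us. d - 1 - i) * real (stab_card x us)"
  using assms
proof (induction us)
  case Nil
  then show ?case using card_fixers_single[of x x] by (simp add: stab0_def)
next
  case (Cons u us)
  have "stab_card x us = card ((\<lambda>g. g u) ` fixers (us @ [x]) (us @ [x])) * stab_card x (u # us)"
    using orbit_stabilizer[of "us @ [x]" u] Cons.prems by simp
  also have "\<dots> \<le> (2 * q ^ (d - 1 - length us)) * stab_card x (u # us)"
    using generic_perp_orbit_le[OF Cons.prems] by (rule mult_le_mono1)
  finally have "real (stab_card x us) \<le> real ((2 * q ^ (d - 1 - length us)) * stab_card x (u # us))"
    by (rule of_nat_mono)
  then have le: "real (stab_card x us) \<le> 2 * real q ^ (d - 1 - length us) * real (stab_card x (u # us))"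
    by simp
  have "stab0 \<le> 2 ^ length us * real q ^ (\<Sum>i<length us. d - 1 - i) * real (stab_card x us)"
    using Cons by auto
  also have "\<dots> \<le> 2 ^ length us * real q ^ (\<Sum>i<length us. d - 1 - i) *
      (2 * real q ^ (d - 1 - length us) * real (stab_card x (u # us)))"
    using le by (rule mult_left_mono) simp
  finally show ?case by (simp add: power_add mult_ac)
qed

text \<open>Orbit points are produced by reflections. All but a proportion 3/q of \<open>?W\<close>
  consists of vectors w that are anisotropic and not orthogonal to \<open>u - x\<close>; the
  reflection along such a w moves \<open>u\<close>, and the image determines w up to a
  scalar.\<close>

lemma generic_orbit_ge:
  assumes x: "x \<in> V" and us: "set (u # us) \<subseteq> V" and gen: "generic (diffs x (u # us))"
  shows "2 * q ^ (d - 1 - length us) \<le> 5 * card ((\<lambda>g. g u) ` fixers (us @ [x]) (us @ [x]))"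
proof -
  let ?W = "perp (set (diffs x us))" and ?O = "(\<lambda>g. g u) ` fixers (us @ [x]) (us @ [x])"
  have V: "set (diffs x us) \<subseteq> V" "u - x \<in> V" "u \<in> V" using x us by auto
  obtain c0 where c0: "c0 \<in> ?W" "Q c0 \<noteq> 0" and g: "generic (diffs x us)" using gen by auto
  have "u - x \<notin> perp (perp (set (diffs x us)))" using gen by simp
  from perp_perpD[OF V(2) this] obtain w1 where w1: "w1 \<in> ?W" "dt (u - x) w1 \<noteq> 0" by blast
  have len: "length us < d"
    using generic_length_le[OF gen diffs_V[OF x us]] by simp
  have fW: "finite ?W" by (rule finite_subspace[OF subspace_perp])
  define M where "M = {w\<in>?W. Q w \<noteq> 0 \<and> dt (u - x) w \<noteq> 0}"
  have fM: "finite M" using fW by (simp add: M_def)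
  have "?W = M \<union> ({w\<in>?W. Q (0 + w) = 0} \<union> {w\<in>?W. dt (u - x) w = 0})" by (auto simp: M_def)
  then have "card ?W \<le> card M + (card {w\<in>?W. Q (0 + w) = 0} + card {w\<in>?W. dt (u - x) w = 0})"
    by (metis (no_types, lifting) card_Un_le add_left_mono le_trans)
  then have "q * card ?W \<le> q * (card M + (card {w\<in>?W. Q (0 + w) = 0} + card {w\<in>?W. dt (u - x) w = 0}))"
    by (rule mult_le_mono2)
  also have "\<dots> \<le> q * card M + (2 * card ?W + card ?W)"
    using card_quadric_le[OF subspace_perp c0, of 0 0] card_level_set[OF subspace_perp V(2) w1, of 0]
    by (simp add: distrib_left)
  finally have 1: "q * card ?W \<le> q * card M + 3 * card ?W" by simp
  have "card M \<le> card (\<Union>v\<in>?O. {w\<in>M. refl_at x w u = v})"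
  proof (rule card_mono)
    show "M \<subseteq> (\<Union>v\<in>?O. {w\<in>M. refl_at x w u = v})"
      using refl_at_fixers[OF x, of us] us by (auto simp: M_def)
  qed (use fM in auto)
  also have "\<dots> \<le> (\<Sum>v\<in>?O. card {w\<in>M. refl_at x w u = v})"
    by (rule card_UN_le) simp
  also have "\<dots> \<le> (\<Sum>v\<in>?O. q)"
  proof (rule sum_mono)
    fix v assume "v \<in> ?O"
    have "{w\<in>M. refl_at x w u = v} \<subseteq> (\<lambda>s. sc s (u - v)) ` K"
    proof
      fix w assume "w \<in> {w\<in>M. refl_at x w u = v}"
      then have w: "w \<in> V" "Q w \<noteq> 0" "dt (u - x) w \<noteq> 0" and v: "refl_at x w u = v"
        by (auto simp: M_def perp_def)
      obtain c where c: "c \<in> K" "c \<noteq> 0" "refl_at x w u = u - sc (2 * dt (u - x) w * c) w"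
        using refl_atE[OF x w(1,2)] V(3) by metis
      define t where "t = 2 * dt (u - x) w * c"
      have dK: "dt (u - x) w \<in> K" using V w by simp
      have "2 * dt (u - x) w \<in> K" using K_add[OF dK dK] by (simp only: mult_2)
      moreover have "2 * dt (u - x) w \<noteq> 0" using double_zero[OF dK] w(3) by blast
      ultimately have "t \<in> K" "t \<noteq> 0" using c(1,2) K_cancel unfolding t_def by auto
      then obtain s where s: "s \<in> K" "t * s = e" using inverse_ex by blast
      have "u - v = sc t w" using c(3) v by (simp add: t_def)
      then have "sc s (u - v) = w" using sc_cancel[of s t w] s \<open>t \<in> K\<close> w(1) by (simp add: mult.commute)
      then show "w \<in> (\<lambda>s. sc s (u - v)) ` K" using s(1) by (intro image_eqI) auto
    qed
    then show "card {w\<in>M. refl_at x w u = v} \<le> q" using surj_card_le[OF finK] cardK by metis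
  qed
  finally have 2: "card M \<le> card ?O * q" by simp
  define m where "m = q ^ (d - 1 - length us)"
  have W: "card ?W = q * m"
    unfolding m_def
    using generic_card_perp[OF g V(1)] len by (simp add: Suc_diff_Suc power_Suc[symmetric] del: power_Suc)
  have "q * (q * m) \<le> q * (card ?O * q) + 3 * (q * m)"
    using 1 2 unfolding W by (meson add_le_mono1 le_trans mult_le_mono2)
  then have "q * (q * m) \<le> q * (q * card ?O + 3 * m)" by (simp add: algebra_simps)
  then have 3: "q * m \<le> q * card ?O + 3 * m" using q_pos(2) by (metis mult_le_cancel1)
  \<comment> \<open>With \<open>q\<close> at least 5, the loss 3m is at most three fifths of qm; the
    remaining 2/5 gives the constants of the statement.\<close>
  have "15 * m \<le> 3 * (q * m)" using mult_le_mono1[OF q5, of "3 * m"] by simp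
  then have "2 * (q * m) \<le> 5 * (q * card ?O)" using 3 by linarith
  then have "q * (2 * m) \<le> q * (5 * card ?O)" by (simp only: mult.left_commute)
  then show ?thesis using q_pos(2) unfolding m_def by (metis mult_le_cancel1)
qed

lemma card_fixers_upper:
  assumes "x \<in> V" "set us \<subseteq> V" "generic (diffs x us)"
  shows "real q ^ (\<Sum>i<length us. d - 1 - i) * real (stab_card x us) \<le> 3 ^ length us * stab0"
  using assms
proof (induction us)
  case Nil
  then show ?case using card_fixers_single[of x x] by (simp add: stab0_def)
next
  case (Cons u us)
  have "2 * q ^ (d - 1 - length us) * stab_card x (u # us) \<le> 5 * card ((\<lambda>g. g u) ` fixers (us @ [x]) (us @ [x])) * stab_card x (u # us)"
    using generic_orbit_ge[OF Cons.prems] by (rule mult_le_mono1)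
  also have "\<dots> = 5 * stab_card x us"
    using orbit_stabilizer[of "us @ [x]" u] Cons.prems by simp
  finally have "real (2 * q ^ (d - 1 - length us) * stab_card x (u # us)) \<le> real (5 * stab_card x us)"
    by (rule of_nat_mono)
  \<comment> \<open>The factor 3 rounds up 5/2.\<close>
  then have le: "real q ^ (d - 1 - length us) * real (stab_card x (u # us)) \<le> 3 * real (stab_card x us)"
    by simp
  have "real q ^ (\<Sum>i<length (u # us). d - 1 - i) * real (stab_card x (u # us))
    = real q ^ (\<Sum>i<length us. d - 1 - i) * (real q ^ (d - 1 - length us) * real (stab_card x (u # us)))"
    by (simp add: power_add mult_ac)
  also have "\<dots> \<le> real q ^ (\<Sum>i<length us. d - 1 - i) * (3 * real (stab_card x us))"
    using le by (rule mult_left_mono) simp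
  also have "\<dots> = 3 * (real q ^ (\<Sum>i<length us. d - 1 - i) * real (stab_card x us))" by simp
  also have "\<dots> \<le> 3 * (3 ^ length us * stab0)"
    using Cons by (intro mult_left_mono) auto
  finally show ?case by simp
qed

section \<open>Extension of partial isometries\<close>

fun congr :: "'v list \<Rightarrow> 'v list \<Rightarrow> bool" where
  "congr [] [] \<longleftrightarrow> True"
| "congr (u # us) (v # vs) \<longleftrightarrow> congr us vs \<and> list_all2 (\<lambda>a b. Q (u - a) = Q (v - b)) us vs"
| "congr _ _ \<longleftrightarrow> False"

lemma Q_dt: "2 * dt (a - x) (b - x) = Q (a - x) + Q (b - x) - Q (a - b)"
  using Q_diff[of "a - x" "b - x"] by (simp add: algebra_simps)

text \<open>The point \<open>x\<close> is equidistant from \<open>y\<close> and \<open>v\<close>,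
  hence 2 \<open>dt (y - x) (y - v)\<close> equals \<open>Q (y - v)\<close>, and the reflection
  subtracts exactly \<open>y - v\<close> from \<open>y\<close>.\<close>

lemma refl_at_swap:
  assumes "x \<in> V" "y \<in> V" "v \<in> V" "Q (y - x) = Q (v - x)" "Q (y - v) \<noteq> 0"
  shows "refl_at x (y - v) y = v"
proof -
  obtain c where c: "c \<in> K" "Q (y - v) * c = e"
    "refl_at x (y - v) y = y - sc (2 * dt (y - x) (y - v) * c) (y - v)"
    using refl_atE[of x "y - v"] assms by (metis V_diff)
  have "Q (v - x) = Q ((y - x) - (y - v))" by simp
  also have "\<dots> = Q (y - x) - 2 * dt (y - x) (y - v) + Q (y - v)" by (rule Q_diff)
  finally have "2 * dt (y - x) (y - v) = Q (y - v)" using assms(4) by simp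
  then show ?thesis using c assms by (simp add: sc_e)
qed

text \<open>
  Witt's theorem. When the difference of the two candidate points is isotropic, a preliminary
  reflection moves one of them off the isotropic cone around the other.
\<close>

lemma witt:
  assumes "x \<in> V" "x' \<in> V" "set us \<subseteq> V" "set us' \<subseteq> V"
    and "generic (diffs x us)" "generic (diffs x' us')" "congr (us @ [x]) (us' @ [x'])"
  shows "fixers (us @ [x]) (us' @ [x']) \<noteq> {}"
  using assms(3-)
proof (induction us arbitrary: us')
  case Nil
  have "us' = []"
  proof (cases us')
    case (Cons a l)
    then show ?thesis using Nil.prems by (cases l) auto
  qed simp
  moreover have "trans_by (x' - x) \<in> fixers [x] [x']"
    using assms(1,2) trans_by_isoms[of "x' - x"] by (simp add: fixers_def trans_by_def)
  ultimately show ?case by auto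
next
  case (Cons u us)
  obtain v vs where us': "us' = v # vs"
    using Cons.prems by (cases us'; cases us) auto
  have c: "congr (us @ [x]) (vs @ [x'])"
    and all: "list_all2 (\<lambda>a b. Q (u - a) = Q (v - b)) (us @ [x]) (vs @ [x'])"
    using Cons.prems us' by auto
  have "fixers (us @ [x]) (vs @ [x']) \<noteq> {}"
    using Cons.IH[of vs] Cons.prems us' c by auto
  then obtain g where g: "g \<in> fixers (us @ [x]) (vs @ [x'])" by blast
  have gi: "g \<in> isoms" and gm: "map g us = vs" "g x = x'" using g by (auto simp: fixers_def)
  have V: "u \<in> V" "v \<in> V" "set us \<subseteq> V" "set vs \<subseteq> V" using Cons.prems us' by auto
  let ?W = "perp (set (diffs x' vs))"
  have WV: "w \<in> V" if "w \<in> ?W" for w using that by (simp add: perp_def)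
  have Qa: "Q (u - a) = Q (v - g a)" if "a \<in> set (us @ [x])" for a
  proof -
    have "list_all2 (\<lambda>a b. Q (u - a) = Q (v - b)) (us @ [x]) (map g (us @ [x]))"
      using all gm by simp
    then show ?thesis using that unfolding list_all2_map2 list_all2_same by blast
  qed
  text \<open>Any isometry fixing the image tuple may be applied before comparing with the target.\<close>
  have key: "fixers (u # us @ [x]) (v # vs @ [x']) \<noteq> {}"
    if h: "h \<in> fixers (us @ [x]) (vs @ [x'])" and hne: "h u = v \<or> Q (h u - v) \<noteq> 0" for h
  proof (cases "h u = v")
    case True
    then have "h \<in> fixers (u # us @ [x]) (v # vs @ [x'])" using h by (simp add: fixers_def)
    then show ?thesis by blast
  next
    case False
    have hi: "h \<in> isoms" and hm: "map h us = vs" "h x = x'" using h by (auto simp: fixers_def)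
    have hV: "h u \<in> V" using isomsD(1)[OF hi] V by simp
    have Qh: "Q (h u - h a) = Q (v - h a)" if "a \<in> set (us @ [x])" for a
    proof -
      have "map h (us @ [x]) = map g (us @ [x])" using hm gm by simp
      then have "h a = g a" using that by (simp only: map_eq_conv)
      moreover have "a \<in> V" using that V assms(1) by auto
      ultimately show ?thesis using isomsD(2)[OF hi V(1), of a] Qa[OF that] by simp
    qed
    have "h u - v \<in> ?W"
      unfolding perp_def
    proof (intro CollectI conjI ballI)
      fix b assume "b \<in> set (diffs x' vs)"
      then obtain a where a: "a \<in> set us" "b = h a - x'" using hm(1) by auto
      have "2 * dt (h u - x') b = 2 * dt (v - x') b"
        using Qh[of a] Qh[of x] a hm(2) unfolding a(2) Q_dt by simp
      moreover have "b \<in> V" using a V isomsD(1)[OF hi] assms(2) by auto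
      ultimately have "dt (h u - x') b = dt (v - x') b" using hV V assms(2) by (intro double_eq[of "dt (h u - x') b"]) auto
      then show "dt b (h u - v) = 0" by (simp add: dt_commute[of b] dt_linear)
    qed (use hV V in simp)
    then have "refl_at x' (h u - v) \<in> fixers (vs @ [x']) (vs @ [x'])"
      using hne False V assms(2) by (intro refl_at_fixers) auto
    then have "compose V (refl_at x' (h u - v)) h \<in> fixers (us @ [x]) (vs @ [x'])"
      using h V assms(1) by (intro compose_fixers) auto
    moreover have "compose V (refl_at x' (h u - v)) h u = v"
      using refl_at_swap[of x' "h u" v] hV V assms(2) Qh[of x] hm(2) hne False by (simp add: compose_def)
    ultimately have "compose V (refl_at x' (h u - v)) h \<in> fixers (u # us @ [x]) (v # vs @ [x'])"
      by (simp add: fixers_def)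
    then show ?thesis by blast
  qed
  show ?case
  proof (cases "g u = v \<or> Q (g u - v) \<noteq> 0")
    case True
    then show ?thesis using key[OF g] us' by simp
  next
    case False
    then have Q0: "Q (g u - v) = 0" by simp
    have guV: "g u \<in> V" using isomsD(1)[OF gi] V by simp
    have W: "subspace ?W" by (rule subspace_perp)
    have dV: "g u - x' \<in> V" "v - x' \<in> V" using guV V assms(2) by auto
    obtain w0 where w0: "w0 \<in> ?W" "Q w0 \<noteq> 0" using Cons.prems us' by auto
    have "v - x' \<notin> perp (perp (set (diffs x' vs)))" using Cons.prems(4) us' by simp
    from perp_perpD[OF dV(2) this] obtain w1 where w1: "w1 \<in> ?W" "dt (v - x') w1 \<noteq> 0" by blast
    \<comment> \<open>Non-orthogonality holds on the source side and is carried over by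
      \<open>g\<close>: the image of \<open>x + w\<close>, seen from \<open>x'\<close>, serves as
      \<open>w2\<close>.\<close>
    obtain w2 where w2: "w2 \<in> ?W" "dt (g u - x') w2 \<noteq> 0"
    proof -
      have "u - x \<in> V" "u - x \<notin> perp (perp (set (diffs x us)))"
        using Cons.prems V assms(1) by auto
      from perp_perpD[OF this] obtain w where w: "w \<in> perp (set (diffs x us))" "dt (u - x) w \<noteq> 0" by blast
      have wV: "w \<in> V" using w by (simp add: perp_def)
      have xw: "x + w \<in> V" using wV assms(1) by simp
      have "dt (g u - x') (g (x + w) - x') = dt (u - x) w"
        using isoms_dt[OF gi assms(1) V(1) xw] gm(2) by simp
      moreover have "g (x + w) - x' \<in> ?W"
        unfolding perp_def
      proof (intro CollectI conjI ballI)
        fix b assume "b \<in> set (diffs x' vs)"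
        then obtain a where a: "a \<in> set us" "b = g a - x'" using gm(1) by auto
        have "dt b (g (x + w) - x') = dt (a - x) w"
          using isoms_dt[OF gi assms(1) _ xw, of a] gm(2) a V by auto
        then show "dt b (g (x + w) - x') = 0" using w(1) a by (auto simp: perp_def)
      qed (use isomsD(1)[OF gi xw] assms(2) in simp)
      ultimately show ?thesis using that w(2) by metis
    qed
    \<comment> \<open>Isotropic vectors fill at most 2/q of \<open>?W\<close>, and each of the two
      hyperplanes fills 1/q of it; \<open>q \<ge> 5\<close> leaves a vector outside all
      three.\<close>
    have "\<exists>w\<in>?W. Q w \<noteq> 0 \<and> dt (g u - x') w \<noteq> 0 \<and> dt (v - x') w \<noteq> 0"
    proof (rule ccontr)
      assume "\<not> ?thesis"
      then have "?W = {w\<in>?W. Q (0 + w) = 0} \<union> ({w\<in>?W. dt (g u - x') w = 0} \<union> {w\<in>?W. dt (v - x') w = 0})"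
        by auto
      then have "card ?W \<le> card {w\<in>?W. Q (0 + w) = 0} + (card {w\<in>?W. dt (g u - x') w = 0} + card {w\<in>?W. dt (v - x') w = 0})"
        by (metis (no_types, lifting) card_Un_le add_left_mono le_trans)
      then have "q * card ?W \<le> q * (card {w\<in>?W. Q (0 + w) = 0} + (card {w\<in>?W. dt (g u - x') w = 0} + card {w\<in>?W. dt (v - x') w = 0}))"
        by (rule mult_le_mono2)
      also have "\<dots> \<le> 2 * card ?W + (card ?W + card ?W)"
        using card_quadric_le[OF W w0, of 0 0] card_level_set[OF W dV(1) w2, of 0]
          card_level_set[OF W dV(2) w1, of 0] by (simp add: distrib_left)
      finally have "q * card ?W \<le> 4 * card ?W" by simp
      moreover have "card ?W > 0" using finite_subspace[OF W] w0 by (auto simp: card_gt_0_iff)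
      ultimately show False using q5 by simp
    qed
    then obtain w where w: "w \<in> ?W" "Q w \<noteq> 0" "dt (g u - x') w \<noteq> 0" "dt (v - x') w \<noteq> 0" by blast
    have wV: "w \<in> V" using w WV by blast
    let ?h = "compose V (refl_at x' w) g"
    have "refl_at x' w \<in> fixers (vs @ [x']) (vs @ [x'])"
      using w V assms(2) by (intro refl_at_fixers) auto
    then have h: "?h \<in> fixers (us @ [x]) (vs @ [x'])"
      using g V assms(1) by (intro compose_fixers) auto
    obtain c where c: "c \<in> K" "c \<noteq> 0" "Q w * c = e"
      "refl_at x' w (g u) = g u - sc (2 * dt (g u - x') w * c) w"
      using refl_atE[OF assms(2) wV w(2)] guV by metis
    define s where "s = dt (g u - x') w"
    define t where "t = 2 * s * c"
    have sK: "s \<in> K" using dV wV by (simp add: s_def)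
    have tQ: "t * Q w = 2 * s"
    proof -
      have "t * Q w = 2 * (s * (Q w * c))" by (simp add: t_def mult_ac)
      also have "\<dots> = 2 * s" using c(3) sK by (simp add: mult.commute)
      finally show ?thesis .
    qed
    have K2s: "2 * s \<in> K" using K_add[OF sK sK] by (simp only: mult_2)
    have tK: "t \<in> K" using K2s c(1) by (simp add: t_def)
    have "2 * s \<noteq> 0" using double_zero[OF sK] w(3) unfolding s_def by blast
    then have t0: "t \<noteq> 0" using K_cancel[OF K2s c(1)] c(2) by (auto simp: t_def)
    have hu: "?h u - v = (g u - v) - sc t w" using c(4) V by (simp add: compose_def t_def s_def)
    \<comment> \<open>The first term vanishes because \<open>g u - v\<close> is isotropic; what
      remains is 2t \<open>dt (v - x') w\<close>, nonzero by the choice of \<open>w\<close>.\<close>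
    have "Q (?h u - v) = Q (g u - v) - 2 * (t * dt (g u - v) w) + t * (t * Q w)"
      unfolding hu by (subst Q_diff[of "g u - v"]) (simp only: Q_sc dt_sc_right mult.assoc)
    also have "\<dots> = 2 * (t * (s - dt (g u - v) w))" unfolding Q0 tQ by (simp add: algebra_simps)
    also have "s - dt (g u - v) w = dt (v - x') w" by (simp add: s_def dt_linear)
    finally have "Q (?h u - v) = 2 * (t * dt (v - x') w)" .
    moreover have "t * dt (v - x') w \<in> K" "t * dt (v - x') w \<noteq> 0"
      using K_cancel[OF tK, of "dt (v - x') w"] t0 w(4) tK dV wV by auto
    ultimately have "Q (?h u - v) \<noteq> 0" using double_zero by metis
    then show ?thesis using key[OF h] us' by simp
  qed
qed

text \<open>Once d independent differences are matched, their complement is trivial, and the image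
  of any further point is forced by its distances to the matched ones.\<close>

lemma fixers_far:
  assumes "x \<in> V" "x' \<in> V" "set us \<subseteq> V" "set us' \<subseteq> V" "u \<in> V" "v \<in> V"
    and "generic (diffs x' us')" "length us' = d" "g \<in> fixers (us @ [x]) (us' @ [x'])"
    and "list_all2 (\<lambda>a b. Q (u - a) = Q (v - b)) (us @ [x]) (us' @ [x'])"
  shows "g u = v"
proof -
  have gi: "g \<in> isoms" and gm: "map g us = us'" "g x = x'" using assms(9) by (auto simp: fixers_def)
  have guV: "g u \<in> V" using isomsD(1)[OF gi] assms by simp
  have Qa: "Q (g u - g a) = Q (v - g a)" if "a \<in> set (us @ [x])" for a
  proof -
    have "list_all2 (\<lambda>a b. Q (u - a) = Q (v - b)) (us @ [x]) (map g (us @ [x]))"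
      using assms(10) gm by simp
    then have "Q (u - a) = Q (v - g a)" using that unfolding list_all2_map2 list_all2_same by blast
    moreover have "a \<in> V" using that assms by auto
    ultimately show ?thesis using isomsD(2)[OF gi assms(5), of a] by simp
  qed
  have "g u - v \<in> perp (set (diffs x' us'))"
    unfolding perp_def
  proof (intro CollectI conjI ballI)
    fix b assume "b \<in> set (diffs x' us')"
    then obtain a where a: "a \<in> set us" "b = g a - x'" using gm(1) by auto
    have "2 * dt (g u - x') b = 2 * dt (v - x') b"
      using Qa[of a] Qa[of x] a gm(2) unfolding a(2) Q_dt by simp
    moreover have "b \<in> V" using a assms isomsD(1)[OF gi] by auto
    ultimately have "dt (g u - x') b = dt (v - x') b"
      using guV assms by (intro double_eq[of "dt (g u - x') b"]) auto
    then show "dt b (g u - v) = 0" by (simp add: dt_commute[of b] dt_linear)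
  qed (use guV assms in simp)
  moreover have "card (perp (set (diffs x' us'))) = 1"
    using generic_card_perp[OF assms(7) diffs_V[OF assms(2,4)]] assms(8) by simp
  moreover have "0 \<in> perp (set (diffs x' us'))" using subspaceD(2)[OF subspace_perp] .
  ultimately show "g u = v" by (metis card_1_singletonE eq_iff_diff_eq_0 singletonD)
qed

end

section \<open>Pruning and pinned cliques\<close>

context quadratic_space
begin

section \<open>Bisectors, spheres and the graph on pairs\<close>

lemma half_ex:
  assumes "a \<in> K" shows "\<exists>h\<in>K. 2 * h = a"
proof -
  obtain c where c: "c \<in> K" "(e + e) * c = e" using inverse_ex[OF K_add[OF Ke Ke] two_nonzero] by blast
  have "2 * (c * a) = ((e + e) * c) * a"
    using c(1) assms by (simp only: distrib_right e_mult mult_2 mult.assoc)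
  also have "\<dots> = a" using c(2) assms by simp
  finally show ?thesis using c(1) assms by (intro bexI[of _ "c * a"]) auto
qed

text \<open>The quadratic terms in w cancel. What is left is an affine hyperplane with nonzero
  normal \<open>u - u'\<close>.\<close>

lemma card_bisector:
  assumes "u \<in> V" "u' \<in> V" "u \<noteq> u'" "c \<in> K"
  shows "q * card {w\<in>V. Q (u - w) - Q (u' - w) = c} = q ^ d"
proof -
  obtain h where h: "h \<in> K" "2 * h = Q u - Q u' - c" using half_ex[of "Q u - Q u' - c"] assms by auto
  obtain w1 where w1: "w1 \<in> V" "dt (u - u') w1 \<noteq> 0" using nondeg[of "u - u'"] assms by auto
  have "Q (u - w) - Q (u' - w) = c \<longleftrightarrow> dt (u - u') w = h" if "w \<in> V" for w
  proof -
    have "Q (u - w) - Q (u' - w) = (c + 2 * h) - 2 * dt (u - u') w"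
      unfolding Q_diff h(2) by (simp add: dt_linear algebra_simps)
    then have "Q (u - w) - Q (u' - w) = c \<longleftrightarrow> 2 * dt (u - u') w = 2 * h"
      by (simp only: add_diff_eq[symmetric] add_cancel_left_right right_minus_eq) (rule eq_commute)
    then show ?thesis using double_eq[of "dt (u - u') w" h] that assms h(1) by auto
  qed
  then have "{w\<in>V. Q (u - w) - Q (u' - w) = c} = {w\<in>V. dt (u - u') w = h}" by blast
  then show ?thesis
    using card_level_set[OF subspace_V _ w1 h(1)] assms by (simp add: cardV)
qed

lemma sphere_second_moment:
  fixes \<phi> :: "'v \<Rightarrow> real"
  shows "(\<Sum>w\<in>V. \<Sum>c\<in>K. ((\<Sum>u\<in>V. \<phi> u * of_bool (Q (u - w) = c)) - (\<Sum>u\<in>V. \<phi> u) / q)\<^sup>2)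
    \<le> real q ^ d * (\<Sum>u\<in>V. (\<phi> u)\<^sup>2)"
proof -
  have "(\<Sum>w\<in>V. \<Sum>c\<in>K. ((\<Sum>u\<in>V. \<phi> u * of_bool (Q (u - w) = c)) - (\<Sum>u\<in>V. \<phi> u) / card K)\<^sup>2)
    \<le> real (card V) * (\<Sum>u\<in>V. (\<phi> u)\<^sup>2)"
  proof (rule second_moment_identity[OF finV finK])
    show "K \<noteq> {}" using K0 by blast
    show "Q (u - w) \<in> K" if "u \<in> V" "w \<in> V" for u w using that by simp
    fix u u' assume u: "u \<in> V" "u' \<in> V" "u \<noteq> u'"
    have "real q * real (card {w\<in>V. Q (u - w) = Q (u' - w)}) = real q ^ d"
      using arg_cong[OF card_bisector[OF u K0], of real] by simp
    then show "real (card {w\<in>V. Q (u - w) = Q (u' - w)}) = real (card V) / real (card K)"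
      using q_pos(1) by (simp add: cardK cardV field_simps)
  qed
  then show ?thesis by (simp add: cardK cardV)
qed

text \<open>Congruent tuples, read as tuples of pairs, are cliques, and the graph of an isometry is
  one large clique. Loops are present, so a clique list may repeat an entry.\<close>

definition adj :: "'v \<times> 'v \<Rightarrow> ('v \<times> 'v) set" where
  "adj z = {w\<in>V \<times> V. Q (fst z - fst w) = Q (snd z - snd w)}"

text \<open>If the first coordinates of z and z' differ, fix the second coordinate of w and count a
  bisector for the first; otherwise the second coordinates differ and the roles are
  exchanged.\<close>

lemma pair_bisector:
  assumes z: "z \<in> V \<times> V" "z' \<in> V \<times> V" "z \<noteq> z'"
  shows "q * card {w\<in>V \<times> V. Q (fst z - fst w) - Q (snd z - snd w) = Q (fst z' - fst w) - Q (snd z' - snd w)}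
     = q ^ d * q ^ d"
proof -
  obtain u v u' v' where uv: "z = (u, v)" "z' = (u', v')" by (cases z; cases z')
  have V: "u \<in> V" "v \<in> V" "u' \<in> V" "v' \<in> V" using z uv by auto
  let ?S = "{w\<in>V \<times> V. Q (u - fst w) - Q (v - snd w) = Q (u' - fst w) - Q (v' - snd w)}"
  have "q * card ?S = q ^ d * q ^ d"
  proof (cases "u = u'")
    case False
    have "card ?S = card (SIGMA w':V. {w\<in>V. Q (u - w) - Q (u' - w) = Q (v - w') - Q (v' - w')})"
      by (rule bij_betw_same_card[OF bij_betw_byWitness[where f = "\<lambda>(a,b). (b,a)" and f' = "\<lambda>(a,b). (b,a)"]])
        (auto simp: algebra_simps)
    also have "\<dots> = (\<Sum>w'\<in>V. card {w\<in>V. Q (u - w) - Q (u' - w) = Q (v - w') - Q (v' - w')})"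
      using finV by (intro card_SigmaI) auto
    finally have "q * card ?S = (\<Sum>w'\<in>V. q * card {w\<in>V. Q (u - w) - Q (u' - w) = Q (v - w') - Q (v' - w')})"
      by (simp only: sum_distrib_left)
    also have "\<dots> = (\<Sum>w'\<in>V. q ^ d)"
      using V False by (intro sum.cong refl card_bisector) auto
    finally show ?thesis by (simp add: cardV)
  next
    case True
    then have ne: "v \<noteq> v'" using z uv by auto
    have "card ?S = card (SIGMA w:V. {w'\<in>V. Q (v - w') - Q (v' - w') = Q (u - w) - Q (u' - w)})"
      by (rule bij_betw_same_card[OF bij_betw_byWitness[where f = "\<lambda>a. a" and f' = "\<lambda>a. a"]])
        (auto simp: algebra_simps)
    also have "\<dots> = (\<Sum>w\<in>V. card {w'\<in>V. Q (v - w') - Q (v' - w') = Q (u - w) - Q (u' - w)})"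
      using finV by (intro card_SigmaI) auto
    finally have "q * card ?S = (\<Sum>w\<in>V. q * card {w'\<in>V. Q (v - w') - Q (v' - w') = Q (u - w) - Q (u' - w)})"
      by (simp only: sum_distrib_left)
    also have "\<dots> = (\<Sum>w'\<in>V. q ^ d)"
      using V ne by (intro sum.cong refl card_bisector) auto
    finally show ?thesis by (simp add: cardV)
  qed
  then show ?thesis by (simp add: uv)
qed

text \<open>From the moment identity only the value c = 0 and the centres in \<open>Y\<close> are
  kept. The space of pairs has q^(2d) points, which is why q^d becomes the deviation parameter L of
  the clique bound.\<close>

lemma adj_moment:
  assumes "Y \<subseteq> V \<times> V"
  shows "(\<Sum>z\<in>Y. (card (Y \<inter> adj z) - card Y / real q)\<^sup>2) \<le> (real q ^ d)\<^sup>2 * card Y"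
proof -
  let ?X = "V \<times> V"
  define \<delta> where "\<delta> z w = Q (fst z - fst w) - Q (snd z - snd w)" for z w :: "'v \<times> 'v"
  define \<phi> where "\<phi> z = (of_bool (z \<in> Y) :: real)" for z
  have fX: "finite ?X" using finV by simp
  have fY: "finite Y" using assms fX finite_subset by blast
  have s1: "(\<Sum>u\<in>?X. \<phi> u * of_bool (P u)) = card (Y \<inter> {u. P u})" for P
  proof -
    have "(\<Sum>u\<in>?X. \<phi> u * of_bool (P u)) = (\<Sum>u\<in>?X. of_bool (u \<in> Y \<inter> {u. P u}))"
      by (intro sum.cong) (auto simp: \<phi>_def)
    also have "\<dots> = card (?X \<inter> (Y \<inter> {u. P u}))"
      using fX by (simp only: of_bool_def sum.If_cases) (simp add: Int_def)
    also have "?X \<inter> (Y \<inter> {u. P u}) = Y \<inter> {u. P u}" using assms by blast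
    finally show ?thesis .
  qed
  have s2: "(\<Sum>u\<in>?X. \<phi> u) = card Y" using s1[of "\<lambda>_. True"] by simp
  have s3: "(\<Sum>u\<in>?X. (\<phi> u)\<^sup>2) = card Y"
    using s2 by (simp add: \<phi>_def power2_eq_square flip: of_bool_conj)
  have main: "(\<Sum>w\<in>?X. \<Sum>c\<in>K. ((\<Sum>u\<in>?X. \<phi> u * of_bool (\<delta> u w = c)) - (\<Sum>u\<in>?X. \<phi> u) / card K)\<^sup>2)
    \<le> real (card ?X) * (\<Sum>u\<in>?X. (\<phi> u)\<^sup>2)"
  proof (rule second_moment_identity[OF fX finK])
    show "K \<noteq> {}" using K0 by blast
    show "\<delta> u w \<in> K" if "u \<in> ?X" "w \<in> ?X" for u w using that by (auto simp: \<delta>_def)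
    fix z z' assume z: "z \<in> ?X" "z' \<in> ?X" "z \<noteq> z'"
    have "real q * real (card {w\<in>?X. \<delta> z w = \<delta> z' w}) = real q ^ d * real q ^ d"
      using arg_cong[OF pair_bisector[OF z], of real] by (simp add: \<delta>_def)
    then show "real (card {w\<in>?X. \<delta> z w = \<delta> z' w}) = real (card ?X) / real (card K)"
      using q_pos(1) by (simp add: cardK cardV card_cartesian_product field_simps)
  qed
  have "(\<Sum>z\<in>Y. (card (Y \<inter> adj z) - card Y / real q)\<^sup>2)
      \<le> (\<Sum>z\<in>Y. \<Sum>c\<in>K. ((\<Sum>u\<in>?X. \<phi> u * of_bool (\<delta> u z = c)) - (\<Sum>u\<in>?X. \<phi> u) / card K)\<^sup>2)"
  proof (rule sum_mono)
    fix z assume "z \<in> Y"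
    have "Y \<inter> adj z = Y \<inter> {u. \<delta> u z = 0}"
      using assms by (auto simp: adj_def \<delta>_def Q_diff_commute)
    then have "(card (Y \<inter> adj z) - card Y / real q)\<^sup>2
        = ((\<Sum>u\<in>?X. \<phi> u * of_bool (\<delta> u z = 0)) - (\<Sum>u\<in>?X. \<phi> u) / card K)\<^sup>2"
      by (simp add: s1 s2 cardK)
    also have "\<dots> \<le> (\<Sum>c\<in>K. ((\<Sum>u\<in>?X. \<phi> u * of_bool (\<delta> u z = c)) - (\<Sum>u\<in>?X. \<phi> u) / card K)\<^sup>2)"
      using finK by (intro member_le_sum[of 0 K "\<lambda>c. ((\<Sum>u\<in>?X. \<phi> u * of_bool (\<delta> u z = c)) - (\<Sum>u\<in>?X. \<phi> u) / card K)\<^sup>2"]) auto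
    finally show "(card (Y \<inter> adj z) - card Y / real q)\<^sup>2
      \<le> (\<Sum>c\<in>K. ((\<Sum>u\<in>?X. \<phi> u * of_bool (\<delta> u z = c)) - (\<Sum>u\<in>?X. \<phi> u) / card K)\<^sup>2)" .
  qed
  also have "\<dots> \<le> (\<Sum>w\<in>?X. \<Sum>c\<in>K. ((\<Sum>u\<in>?X. \<phi> u * of_bool (\<delta> u w = c)) - (\<Sum>u\<in>?X. \<phi> u) / card K)\<^sup>2)"
    using fX assms by (intro sum_mono2 sum_nonneg) auto
  also have "\<dots> \<le> real (card ?X) * (\<Sum>u\<in>?X. (\<phi> u)\<^sup>2)" by (rule main)
  also have "\<dots> = (real q ^ d)\<^sup>2 * card Y"
    unfolding s3 by (simp add: card_cartesian_product cardV power2_eq_square)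
  finally show ?thesis .
qed

lemma indicator_sums:
  assumes "E \<subseteq> V"
  shows "(\<Sum>u\<in>V. of_bool (u \<in> E) * of_bool (P u)) = real (card {u\<in>E. P u})"
    and "(\<Sum>u\<in>V. of_bool (u \<in> E)) = real (card E)"
proof -
  show 1: "(\<Sum>u\<in>V. of_bool (u \<in> E) * of_bool (P u)) = real (card {u\<in>E. P u})" for P
  proof -
    have "(\<Sum>u\<in>V. of_bool (u \<in> E) * of_bool (P u)) = (\<Sum>u\<in>V. of_bool (u \<in> E \<and> P u) :: real)"
      by (intro sum.cong) auto
    also have "\<dots> = card (V \<inter> {u. u \<in> E \<and> P u})"
      using finV by (simp only: of_bool_def sum.If_cases) simp
    also have "V \<inter> {u. u \<in> E \<and> P u} = {u\<in>E. P u}" using assms by blast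
    finally show ?thesis .
  qed
  show "(\<Sum>u\<in>V. of_bool (u \<in> E)) = real (card E)" using 1[of "\<lambda>_. True"] by simp
qed

text \<open>\<open>B x\<close> adds the squared sizes of the spheres around x within E. Its average
  over E is at most 2n^2/q by the sphere moment, so at most half of E exceeds twice that. For
  retained x and y, the degree of (x, y) is at most an inner product of two vectors of sphere
  sizes.\<close>

lemma pruning:
  assumes E: "E \<subseteq> V" and big: "real q ^ (d + 1) \<le> (real (card E))\<^sup>2"
  shows "\<exists>E'\<subseteq>E. card E \<le> 2 * card E' \<and>
    (\<forall>z\<in>E' \<times> E'. real (card ((E' \<times> E') \<inter> adj z)) \<le> 4 * (real (card E))\<^sup>2 / q)"
proof -
  define f where "f x c = real (card {u\<in>E. Q (u - x) = c})" for x c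
  define B where "B x = (\<Sum>c\<in>K. (f x c)\<^sup>2)" for x
  define n where "n = real (card E)"
  have fE: "finite E" using E finV finite_subset by blast
  have n: "n > 0"
  proof -
    have "real q ^ (d + 1) > 0" using q_pos by simp
    then have "n\<^sup>2 > 0" using big unfolding n_def by linarith
    then show ?thesis by (simp add: n_def)
  qed
  have "(\<Sum>w\<in>V. \<Sum>c\<in>K. (f w c - n / q)\<^sup>2) \<le> real q ^ d * n"
    using sphere_second_moment[of "\<lambda>u. of_bool (u \<in> E)"] indicator_sums[OF E]
    by (simp add: f_def n_def power2_eq_square)
  moreover have "(\<Sum>w\<in>E. \<Sum>c\<in>K. (f w c - n / q)\<^sup>2) \<le> (\<Sum>w\<in>V. \<Sum>c\<in>K. (f w c - n / q)\<^sup>2)"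
    using finV E by (intro sum_mono2 sum_nonneg) auto
  moreover have "(\<Sum>c\<in>K. (f w c - n / q)\<^sup>2) = B w - n\<^sup>2 / q" if "w \<in> E" for w
  proof -
    have "n = real (card (\<Union>c\<in>K. {u\<in>E. Q (u - w) = c}))"
      unfolding n_def by (rule arg_cong[of _ _ "\<lambda>A. real (card A)"]) (use E that in \<open>auto intro!: Q_K V_diff dest: subsetD\<close>)
    also have "\<dots> = real (\<Sum>c\<in>K. card {u\<in>E. Q (u - w) = c})"
    proof (intro arg_cong[of _ _ real] card_UN_disjoint[OF finK])
      show "\<forall>c\<in>K. \<forall>c'\<in>K. c \<noteq> c' \<longrightarrow> {u\<in>E. Q (u - w) = c} \<inter> {u\<in>E. Q (u - w) = c'} = {}" by blast
    qed (use fE in auto)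
    finally have s: "(\<Sum>c\<in>K. f w c) = n" by (simp add: f_def)
    have "(\<Sum>c\<in>K. (f w c - n / q)\<^sup>2) = (\<Sum>c\<in>K. (f w c)\<^sup>2 - 2 * (n / q) * f w c + (n / q)\<^sup>2)"
      by (intro sum.cong refl) (simp add: power2_diff algebra_simps)
    also have "\<dots> = B w - 2 * (n / q) * (\<Sum>c\<in>K. f w c) + q * (n / q)\<^sup>2"
      by (simp add: sum.distrib sum_subtractf sum_distrib_left B_def cardK)
    also have "\<dots> = B w - n\<^sup>2 / q"
      using q_pos(1) by (simp add: s field_simps power2_eq_square)
    finally show ?thesis .
  qed
  ultimately have "(\<Sum>w\<in>E. B w - n\<^sup>2 / q) \<le> real q ^ d * n" by simp
  then have sB: "(\<Sum>w\<in>E. B w) \<le> real q ^ d * n + n * (n\<^sup>2 / q)" by (simp add: sum_subtractf n_def)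
  have "real q ^ d \<le> n\<^sup>2 / q" using big q_pos(1) by (simp add: n_def field_simps)
  then have "real q ^ d * n \<le> n * (n\<^sup>2 / q)" using n by (subst mult.commute) (rule mult_left_mono, auto)
  then have sB: "(\<Sum>w\<in>E. B w) \<le> 2 * (n * (n\<^sup>2 / q))"
    unfolding mult_2 by (rule order.trans[OF sB add_right_mono])
  define T where "T = {x\<in>E. B x \<le> 4 * n\<^sup>2 / q}"
  have T: "T \<subseteq> E" by (auto simp: T_def)
  have B0: "B x \<ge> 0" for x by (simp add: B_def sum_nonneg)
  have "real (card (E - T)) * (4 * n\<^sup>2 / q) = (\<Sum>w\<in>E - T. 4 * n\<^sup>2 / q)" by simp
  also have "\<dots> \<le> (\<Sum>w\<in>E - T. B w)" by (intro sum_mono) (auto simp: T_def)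
  also have "\<dots> \<le> (\<Sum>w\<in>E. B w)" using fE B0 by (intro sum_mono2) auto
  also have "\<dots> \<le> 2 * (n * (n\<^sup>2 / q))" by (rule sB)
  finally have "(2 * real (card (E - T))) * (2 * n\<^sup>2 / q) \<le> n * (2 * n\<^sup>2 / q)" by (simp add: field_simps)
  then have "2 * real (card (E - T)) \<le> n"
    using n q_pos(1) by (subst (asm) mult_le_cancel_right) (simp add: not_less divide_le_0_iff zero_less_divide_iff)
  moreover have "real (card (E - T)) = n - real (card T)"
    using T fE by (simp add: card_Diff_subset finite_subset n_def of_nat_diff card_mono)
  ultimately have half: "card E \<le> 2 * card T" by (simp add: n_def)
  have "real (card ((T \<times> T) \<inter> adj (x, y))) \<le> 4 * n\<^sup>2 / q" if xy: "x \<in> T" "y \<in> T" for x y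
  proof -
    have "card ((T \<times> T) \<inter> adj (x, y)) \<le> card (\<Union>c\<in>K. {u\<in>E. Q (u - x) = c} \<times> {v\<in>E. Q (v - y) = c})"
    proof (rule card_mono)
      show "(T \<times> T) \<inter> adj (x, y) \<subseteq> (\<Union>c\<in>K. {u\<in>E. Q (u - x) = c} \<times> {v\<in>E. Q (v - y) = c})"
      proof
        fix z assume z: "z \<in> (T \<times> T) \<inter> adj (x, y)"
        then have "z \<in> {u\<in>E. Q (u - x) = Q (fst z - x)} \<times> {v\<in>E. Q (v - y) = Q (fst z - x)}"
          using T by (cases z) (auto simp: adj_def Q_diff_commute)
        moreover have "Q (fst z - x) \<in> K" using z xy T E by (auto intro!: Q_K V_diff)
        ultimately show "z \<in> (\<Union>c\<in>K. {u\<in>E. Q (u - x) = c} \<times> {v\<in>E. Q (v - y) = c})" by blast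
      qed
    qed (use finK fE in auto)
    also have "\<dots> \<le> (\<Sum>c\<in>K. card ({u\<in>E. Q (u - x) = c} \<times> {v\<in>E. Q (v - y) = c}))"
      by (rule card_UN_le[OF finK])
    finally have "real (card ((T \<times> T) \<inter> adj (x, y))) \<le> real (\<Sum>c\<in>K. card ({u\<in>E. Q (u - x) = c} \<times> {v\<in>E. Q (v - y) = c}))"
      by (rule of_nat_mono)
    also have "\<dots> = (\<Sum>c\<in>K. f x c * f y c)" by (simp add: card_cartesian_product f_def)
    also have "\<dots> \<le> (\<Sum>c\<in>K. ((f x c)\<^sup>2 + (f y c)\<^sup>2) / 2)"
    proof (rule sum_mono)
      fix c show "f x c * f y c \<le> ((f x c)\<^sup>2 + (f y c)\<^sup>2) / 2"
        using sum_squares_bound[of "f x c" "f y c"] by simp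
    qed
    also have "\<dots> = (B x + B y) / 2" by (simp add: B_def sum.distrib sum_divide_distrib[symmetric])
    also have "\<dots> \<le> 4 * n\<^sup>2 / q" using xy by (simp add: T_def)
    finally show ?thesis .
  qed
  then show ?thesis using T half by (intro exI[of _ T]) (auto simp: n_def)
qed

text \<open>The neighbourhood of z has size of order n^2/q, and \<open>big\<close> makes L at most
  n^2/q^(k+1). After both substitutions every term of \<open>clique_count_le\<close> is bounded by
  the expected one.\<close>

lemma pinned_cliques:
  assumes E: "E \<subseteq> V" and z: "z \<in> E \<times> E"
    and A: "A \<ge> 1" "real (card ((E \<times> E) \<inter> adj z)) \<le> A * (real (card E))\<^sup>2 / q"
    and big: "real q ^ (d + Suc k) \<le> (real (card E))\<^sup>2"
  shows "clique_count adj k ((E \<times> E) \<inter> adj z)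
    \<le> 2 ^ (k * (k + 2)) * real (k + 1) * A ^ (k + 1) * ((real (card E))\<^sup>2) ^ (k + 1) / q ^ ((k + 1) * (k + 2) div 2)"
proof -
  define n2 where "n2 = (real (card E))\<^sup>2"
  let ?Y = "(E \<times> E) \<inter> adj z"
  have Y: "?Y \<subseteq> V \<times> V" using E by auto
  define L where "L = real q ^ d"
  have L: "L > 0" using q_pos by (simp add: L_def)
  have Lq: "L * real q ^ (k + 1) \<le> n2" using big by (simp add: L_def n2_def power_add mult_ac)
  have n2: "n2 \<ge> 0" by (simp add: n2_def)
  have "clique_count adj k ?Y \<le> 2 ^ (k * (k + 2)) * (\<Sum>p\<le>k. L ^ (k - p) * real (card ?Y) ^ (p + 1) / real q ^ (p * (p + 1) div 2))"
  proof (rule clique_count_le[of "V \<times> V" L "real q"])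
    show "real q \<ge> 1" using q5 by simp
    show "Y \<subseteq> V \<times> V \<Longrightarrow> (\<Sum>z\<in>Y. (card (Y \<inter> adj z) - card Y / real q)\<^sup>2) \<le> L\<^sup>2 * card Y" for Y
      using adj_moment unfolding L_def .
  qed (use finV L Y in auto)
  also have "\<dots> \<le> 2 ^ (k * (k + 2)) * (\<Sum>p\<le>k. A ^ (k + 1) * n2 ^ (k + 1) / real q ^ ((k + 1) * (k + 2) div 2))"
  proof (intro mult_left_mono sum_mono)
    fix p assume "p \<in> {..k}"
    then have p: "p \<le> k" by simp
    \<comment> \<open>The right side is the power of q in the denominator of the p-th term; its
      least value is attained at p = k, where equality holds.\<close>
    have e: "(k + 1) * (k + 2) div 2 \<le> (k - p) * (k + 1) + (p + 1) + p * (p + 1) div 2"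
    proof -
      obtain j where j: "k = p + j" using p le_Suc_ex by blast
      have "(k + 1) * (k + 2) \<le> 2 * ((k - p) * (k + 1) + (p + 1)) + p * (p + 1)"
        unfolding j by (simp add: algebra_simps)
      then have "(k + 1) * (k + 2) div 2 \<le> (2 * ((k - p) * (k + 1) + (p + 1)) + p * (p + 1)) div 2"
        by (rule div_le_mono)
      then show ?thesis by simp
    qed
    have "L ^ (k - p) * real (card ?Y) ^ (p + 1) / real q ^ (p * (p + 1) div 2)
        \<le> (n2 / real q ^ (k + 1)) ^ (k - p) * (A * n2 / q) ^ (p + 1) / real q ^ (p * (p + 1) div 2)"
      using L Lq A(2) q_pos n2 unfolding n2_def
      by (intro divide_right_mono mult_mono power_mono) (auto simp: field_simps)
    also have "\<dots> = A ^ (p + 1) * n2 ^ ((k - p) + (p + 1)) / (real q ^ ((k + 1) * (k - p)) * real q ^ (p + 1) * real q ^ (p * (p + 1) div 2))"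
      by (simp add: power_divide power_mult_distrib power_add power_mult[symmetric] mult_ac)
    also have "\<dots> = A ^ (p + 1) * n2 ^ (k + 1) / real q ^ ((k - p) * (k + 1) + (p + 1) + p * (p + 1) div 2)"
    proof -
      have e1: "(k - p) + (p + 1) = k + 1" using p by simp
      show ?thesis unfolding e1 by (simp only: power_add mult.commute[of "k + 1" "k - p"])
    qed
    also have "\<dots> \<le> A ^ (k + 1) * n2 ^ (k + 1) / real q ^ ((k + 1) * (k + 2) div 2)"
    proof (rule frac_le)
      show "A ^ (p + 1) * n2 ^ (k + 1) \<le> A ^ (k + 1) * n2 ^ (k + 1)"
        using p A(1) n2 by (intro mult_right_mono power_increasing) auto
      show "real q ^ ((k + 1) * (k + 2) div 2) \<le> real q ^ ((k - p) * (k + 1) + (p + 1) + p * (p + 1) div 2)"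
        using q5 e by (intro power_increasing) auto
    qed (use A(1) n2 q_pos in auto)
    finally show "L ^ (k - p) * real (card ?Y) ^ (p + 1) / real q ^ (p * (p + 1) div 2)
       \<le> A ^ (k + 1) * n2 ^ (k + 1) / real q ^ ((k + 1) * (k + 2) div 2)" .
  qed simp
  also have "\<dots> = 2 ^ (k * (k + 2)) * real (k + 1) * A ^ (k + 1) * n2 ^ (k + 1) / q ^ ((k + 1) * (k + 2) div 2)"
    by simp
  finally show ?thesis unfolding n2_def .
qed

end

section \<open>Isometries and incidences\<close>

lemma card_clique_lists:
  assumes "finite Y"
  shows "real (card {zs. length zs = Suc a \<and> set zs \<subseteq> Y \<and> sorted_wrt (\<lambda>u v. v \<in> N u) zs}) = clique_count N a Y"
  using assms
proof (induction a arbitrary: Y)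
  case 0
  have "{zs. length zs = Suc 0 \<and> set zs \<subseteq> Y \<and> sorted_wrt (\<lambda>u v. v \<in> N u) zs} = (\<lambda>z. [z]) ` Y"
    by (auto simp: length_Suc_conv)
  then show ?case by (simp add: card_image inj_on_def)
next
  case (Suc a)
  let ?L = "\<lambda>a Y. {zs. length zs = Suc a \<and> set zs \<subseteq> Y \<and> sorted_wrt (\<lambda>u v. v \<in> N u) zs}"
  have fin: "finite (?L a Y')" if "finite Y'" for Y'
    by (rule finite_subset[OF _ finite_lists_length_eq[OF that, of "Suc a"]]) auto
  have "card (?L (Suc a) Y) = card (SIGMA z:Y. ?L a (Y \<inter> N z))"
  proof (rule bij_betw_same_card[OF bij_betw_byWitness[where f = "\<lambda>zs. (hd zs, tl zs)" and f' = "\<lambda>(z, zs). z # zs"]])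
    show "\<forall>zs\<in>?L (Suc a) Y. (case (hd zs, tl zs) of (z, zs) \<Rightarrow> z # zs) = zs"
      by (auto simp: length_Suc_conv)
    show "(\<lambda>zs. (hd zs, tl zs)) ` ?L (Suc a) Y \<subseteq> (SIGMA z:Y. ?L a (Y \<inter> N z))"
    proof
      fix p assume "p \<in> (\<lambda>zs. (hd zs, tl zs)) ` ?L (Suc a) Y"
      then obtain zs where zs: "zs \<in> ?L (Suc a) Y" "p = (hd zs, tl zs)" by blast
      then obtain z zs' where "zs = z # zs'" by (cases zs) auto
      then show "p \<in> (SIGMA z:Y. ?L a (Y \<inter> N z))" using zs by auto
    qed
  qed auto
  also have "\<dots> = (\<Sum>z\<in>Y. card (?L a (Y \<inter> N z)))"
  proof (rule card_SigmaI[OF Suc.prems])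
    show "\<forall>z\<in>Y. finite (?L a (Y \<inter> N z))" using Suc.prems by (intro ballI fin) simp
  qed
  finally have "real (card (?L (Suc a) Y)) = (\<Sum>z\<in>Y. real (card (?L a (Y \<inter> N z))))" by simp
  also have "\<dots> = (\<Sum>z\<in>Y. clique_count N a (Y \<inter> N z))"
    using Suc by (intro sum.cong refl Suc.IH) auto
  finally show ?case by simp
qed

context quadratic_space
begin

section \<open>Averages over the isometry group\<close>

lemma generic_single:
  assumes "b \<in> V" "b \<noteq> 0" shows "generic [b]"
  using anisotropic_ex[of "[]"] assms d2 by (simp add: perp_empty perp_V)

lemma sum_isoms_point:
  fixes f :: "'v \<Rightarrow> real"
  assumes "x \<in> V"
  shows "(\<Sum>g\<in>isoms. f (g x)) = stab0 * (\<Sum>y\<in>V. f y)"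
proof -
  have "(\<Sum>g\<in>isoms. f (g x)) = (\<Sum>y\<in>V. \<Sum>g\<in>{g\<in>isoms. g x = y}. f (g x))"
    by (rule sum.group[symmetric]) (use finite_isoms finV isomsD(1) assms in auto)
  also have "\<dots> = (\<Sum>y\<in>V. stab0 * f y)"
  proof (rule sum.cong[OF refl])
    fix y assume y: "y \<in> V"
    have "(\<Sum>g\<in>{g\<in>isoms. g x = y}. f (g x)) = (\<Sum>g\<in>fixers [x] [y]. f y)"
      by (rule sum.cong) (auto simp: fixers_def)
    then show "(\<Sum>g\<in>{g\<in>isoms. g x = y}. f (g x)) = stab0 * f y"
      using card_fixers_single[OF assms y] by (simp add: stab0_def)
  qed
  finally show ?thesis by (simp add: sum_distrib_left)
qed

text \<open>Without the diagonal, the pairs at a given distance form a single orbit, even at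
  distance 0. The diagonal is an orbit of its own and would spoil that case.\<close>

definition spairs :: "'a \<Rightarrow> ('v \<times> 'v) set" where
  "spairs t = {p\<in>V \<times> V. fst p \<noteq> snd p \<and> Q (fst p - snd p) = t}"

lemma finite_spairs: "finite (spairs t)"
  unfolding spairs_def using finV by simp

lemma spairs_witt:
  assumes "p \<in> spairs t" "p' \<in> spairs t"
  shows "fixers [snd p, fst p] [snd p', fst p'] \<noteq> {}"
proof -
  have "fixers ([snd p] @ [fst p]) ([snd p'] @ [fst p']) \<noteq> {}"
    using assms Q_diff_commute
    by (intro witt) (auto simp: spairs_def intro!: generic_single[simplified])
  then show ?thesis by simp
qed

lemma spairs_stab:
  assumes "p \<in> spairs t" "p' \<in> spairs t"
  shows "stab_card (fst p') [snd p'] = stab_card (fst p) [snd p]"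
    and "card (fixers [snd p, fst p] [snd p', fst p']) = stab_card (fst p) [snd p]"
proof -
  have V: "set [snd p, fst p] \<subseteq> V" "set [snd p', fst p'] \<subseteq> V" using assms by (auto simp: spairs_def)
  obtain g where g: "g \<in> fixers [snd p, fst p] [snd p', fst p']" using spairs_witt[OF assms] by blast
  show "stab_card (fst p') [snd p'] = stab_card (fst p) [snd p]"
    using card_fixers_conj[OF g V] by simp
  show "card (fixers [snd p, fst p] [snd p', fst p']) = stab_card (fst p) [snd p]"
    using card_fixers_eq[OF g V(1)] by simp
qed

lemma spairs_stab_le:
  assumes "p \<in> spairs t"
  shows "real (stab_card (fst p) [snd p]) \<le> 3 * stab0 / real q ^ (d - 1)"
proof -
  have "fst p \<in> V" "set [snd p] \<subseteq> V" "generic (diffs (fst p) [snd p])"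
    using assms generic_single by (auto simp: spairs_def simp del: generic.simps)
  from card_fixers_upper[OF this] show ?thesis using q_pos by (simp add: field_simps)
qed

lemma sum_isoms_pair:
  fixes f :: "'v \<Rightarrow> real"
  assumes p: "p \<in> spairs t"
  shows "(\<Sum>g\<in>isoms. f (g (fst p)) * f (g (snd p))) = real (stab_card (fst p) [snd p]) * (\<Sum>p'\<in>spairs t. f (fst p') * f (snd p'))"
proof -
  have pV: "fst p \<in> V" "snd p \<in> V" "fst p \<noteq> snd p" "Q (fst p - snd p) = t"
    using p by (auto simp: spairs_def)
  have "(\<Sum>g\<in>isoms. f (g (fst p)) * f (g (snd p)))
    = (\<Sum>p'\<in>spairs t. \<Sum>g\<in>{g\<in>isoms. (g (fst p), g (snd p)) = p'}. f (g (fst p)) * f (g (snd p)))"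
  proof (rule sum.group[symmetric])
    show "(\<lambda>g. (g (fst p), g (snd p))) ` isoms \<subseteq> spairs t"
      using pV isomsD(1,2) isoms_inj by (auto simp: spairs_def)
  qed (use finite_isoms finite_spairs in auto)
  also have "\<dots> = (\<Sum>p'\<in>spairs t. real (stab_card (fst p) [snd p]) * (f (fst p') * f (snd p')))"
  proof (rule sum.cong[OF refl])
    fix p' assume p': "p' \<in> spairs t"
    have "(\<Sum>g\<in>{g\<in>isoms. (g (fst p), g (snd p)) = p'}. f (g (fst p)) * f (g (snd p)))
      = (\<Sum>g\<in>fixers [snd p, fst p] [snd p', fst p']. f (fst p') * f (snd p'))"
      by (rule sum.cong) (auto simp: fixers_def)
    then show "(\<Sum>g\<in>{g\<in>isoms. (g (fst p), g (snd p)) = p'}. f (g (fst p)) * f (g (snd p)))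
        = real (stab_card (fst p) [snd p]) * (f (fst p') * f (snd p'))"
      using spairs_stab(2)[OF p p'] by simp
  qed
  finally show ?thesis by (simp add: sum_distrib_left)
qed

text \<open>
  The second moment over the isometry group splits along the orbits of pairs of points, and the
  contribution of each distance is controlled by the second moment over spheres.
\<close>

lemma isoms_second_moment:
  fixes \<phi> :: "'v \<Rightarrow> real"
  assumes mean: "(\<Sum>x\<in>V. \<phi> x) = 0"
  shows "(\<Sum>g\<in>isoms. (\<Sum>x\<in>V. \<phi> x * \<phi> (g x))\<^sup>2) \<le> 13 * real q * stab0 * (\<Sum>x\<in>V. (\<phi> x)\<^sup>2)\<^sup>2"
proof -
  define S where "S = (\<Sum>x\<in>V. (\<phi> x)\<^sup>2)"
  have S0: "S \<ge> 0" by (simp add: S_def sum_nonneg)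
  define C where "C t = (\<Sum>p\<in>spairs t. \<phi> (fst p) * \<phi> (snd p))" for t
  define H where "H p = (\<Sum>g\<in>isoms. \<phi> (g (fst p)) * \<phi> (g (snd p)))" for p
  define D where "D = {p\<in>V \<times> V. fst p = snd p}"
  have fVV: "finite (V \<times> V)" using finV by simp
  have "(\<Sum>g\<in>isoms. (\<Sum>x\<in>V. \<phi> x * \<phi> (g x))\<^sup>2)
      = (\<Sum>g\<in>isoms. \<Sum>p\<in>V \<times> V. (\<phi> (fst p) * \<phi> (snd p)) * (\<phi> (g (fst p)) * \<phi> (g (snd p))))"
    unfolding power2_eq_square sum_product sum.cartesian_product
    by (intro sum.cong refl) (auto simp: mult_ac)
  also have "\<dots> = (\<Sum>p\<in>V \<times> V. (\<phi> (fst p) * \<phi> (snd p)) * H p)"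
    unfolding H_def by (subst sum.swap) (simp add: sum_distrib_left)
  also have "\<dots> = (\<Sum>p\<in>D. (\<phi> (fst p) * \<phi> (snd p)) * H p)
      + (\<Sum>p\<in>V \<times> V - D. (\<phi> (fst p) * \<phi> (snd p)) * H p)"
    using fVV by (subst sum.subset_diff[of D "V \<times> V"]) (auto simp: D_def)
  also have "(\<Sum>p\<in>D. (\<phi> (fst p) * \<phi> (snd p)) * H p) = (\<Sum>x\<in>V. (\<phi> x * \<phi> x) * H (x, x))"
    by (rule sum.reindex_bij_witness[where i = "\<lambda>x. (x, x)" and j = fst]) (auto simp: D_def)
  also have "\<dots> = (\<Sum>x\<in>V. (\<phi> x)\<^sup>2 * (stab0 * S))"
  proof (rule sum.cong[OF refl])
    fix x assume "x \<in> V"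
    then have "H (x, x) = stab0 * S"
      unfolding H_def S_def using sum_isoms_point[of x "\<lambda>y. (\<phi> y)\<^sup>2"] by (simp add: power2_eq_square)
    then show "(\<phi> x * \<phi> x) * H (x, x) = (\<phi> x)\<^sup>2 * (stab0 * S)" by (simp add: power2_eq_square)
  qed
  also have "\<dots> = stab0 * S\<^sup>2" by (simp add: sum_distrib_right[symmetric] S_def power2_eq_square)
  \<comment> \<open>Off the diagonal the average over isometries depends on a pair only through its
    distance t: it is a stabilizer order times the correlation \<open>C t\<close>.\<close>
  also have "(\<Sum>p\<in>V \<times> V - D. (\<phi> (fst p) * \<phi> (snd p)) * H p)
      = (\<Sum>t\<in>K. \<Sum>p\<in>{p\<in>V \<times> V - D. Q (fst p - snd p) = t}. (\<phi> (fst p) * \<phi> (snd p)) * H p)"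
    by (rule sum.group[symmetric]) (use fVV finK in auto)
  also have "\<dots> = (\<Sum>t\<in>K. \<Sum>p\<in>spairs t. (\<phi> (fst p) * \<phi> (snd p)) * H p)"
    by (intro sum.cong refl) (auto simp: spairs_def D_def)
  also have "\<dots> \<le> (\<Sum>t\<in>K. 3 * stab0 / real q ^ (d - 1) * (C t)\<^sup>2)"
  proof (rule sum_mono)
    fix t
    show "(\<Sum>p\<in>spairs t. (\<phi> (fst p) * \<phi> (snd p)) * H p) \<le> 3 * stab0 / real q ^ (d - 1) * (C t)\<^sup>2"
    proof (cases "spairs t = {}")
      case True
      then show ?thesis using stab0_pos by simp
    next
      case False
      then obtain p0 where p0: "p0 \<in> spairs t" by blast
      define s where "s = real (stab_card (fst p0) [snd p0])"
      have "H p = s * C t" if "p \<in> spairs t" for p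
        unfolding H_def C_def s_def using sum_isoms_pair[OF that] spairs_stab(1)[OF p0 that] by simp
      then have "(\<Sum>p\<in>spairs t. (\<phi> (fst p) * \<phi> (snd p)) * H p) = (\<Sum>p\<in>spairs t. (\<phi> (fst p) * \<phi> (snd p)) * (s * C t))"
        by (intro sum.cong) auto
      also have "\<dots> = s * (C t)\<^sup>2" by (simp add: sum_distrib_right[symmetric] C_def power2_eq_square)
      also have "\<dots> \<le> 3 * stab0 / real q ^ (d - 1) * (C t)\<^sup>2"
        unfolding s_def using spairs_stab_le[OF p0] by (rule mult_right_mono) simp
      finally show ?thesis .
    qed
  qed
  also have "\<dots> = 3 * stab0 / real q ^ (d - 1) * (\<Sum>t\<in>K. (C t)\<^sup>2)" by (simp add: sum_distrib_left)
  \<comment> \<open>The q^d comes from the moment over spheres, the added 1 from the diagonal, which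
    \<open>C\<close> omits.\<close>
  also have "\<dots> \<le> 3 * stab0 / real q ^ (d - 1) * (2 * (real q ^ d + 1) * S\<^sup>2)"
  proof (rule mult_left_mono)
    define F where "F w t = (\<Sum>u\<in>V. \<phi> u * of_bool (Q (u - w) = t))" for w t
    define c where "c t = (\<Sum>w\<in>V. \<phi> w * F w t)" for t
    have cC: "c t = C t + of_bool (t = 0) * S" for t
    proof -
      have "c t = (\<Sum>p\<in>V \<times> V. of_bool (Q (fst p - snd p) = t) * (\<phi> (fst p) * \<phi> (snd p)))"
        unfolding c_def F_def sum_distrib_left sum.cartesian_product
        by (intro sum.cong refl) (auto simp: mult_ac Q_diff_commute)
      also have "\<dots> = (\<Sum>p\<in>D. of_bool (Q (fst p - snd p) = t) * (\<phi> (fst p) * \<phi> (snd p)))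
         + (\<Sum>p\<in>V \<times> V - D. of_bool (Q (fst p - snd p) = t) * (\<phi> (fst p) * \<phi> (snd p)))"
        using fVV by (subst sum.subset_diff[of D "V \<times> V"]) (auto simp: D_def)
      also have "(\<Sum>p\<in>D. of_bool (Q (fst p - snd p) = t) * (\<phi> (fst p) * \<phi> (snd p))) = (\<Sum>x\<in>V. of_bool (t = 0) * (\<phi> x)\<^sup>2)"
        by (rule sum.reindex_bij_witness[where i = "\<lambda>x. (x, x)" and j = fst]) (auto simp: D_def power2_eq_square)
      also have "\<dots> = of_bool (t = 0) * S" by (simp add: S_def sum_distrib_left)
      also have "(\<Sum>p\<in>V \<times> V - D. of_bool (Q (fst p - snd p) = t) * (\<phi> (fst p) * \<phi> (snd p))) = C t"
        unfolding C_def by (rule sum.mono_neutral_cong_right) (use fVV in \<open>auto simp: spairs_def D_def\<close>)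
      finally show ?thesis by simp
    qed
    have "(C t)\<^sup>2 \<le> 2 * (S * (\<Sum>w\<in>V. (F w t)\<^sup>2)) + of_bool (t = 0) * (2 * S\<^sup>2)" for t
    proof -
      have "(c t)\<^sup>2 \<le> S * (\<Sum>w\<in>V. (F w t)\<^sup>2)"
        unfolding c_def S_def by (rule Cauchy_Schwarz_ineq_sum)
      moreover have "(a - b)\<^sup>2 \<le> 2 * a\<^sup>2 + 2 * b\<^sup>2" for a b :: real
        using zero_le_power2[of "a + b"] by (simp add: power2_eq_square algebra_simps)
      from this[of "c t" "of_bool (t = 0) * S"] have "(C t)\<^sup>2 \<le> 2 * (c t)\<^sup>2 + 2 * (of_bool (t = 0) * S)\<^sup>2"
        by (simp add: cC)
      moreover have "2 * (of_bool (t = 0) * S)\<^sup>2 = of_bool (t = 0) * (2 * S\<^sup>2)" by simp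
      ultimately show ?thesis by linarith
    qed
    then have "(\<Sum>t\<in>K. (C t)\<^sup>2) \<le> (\<Sum>t\<in>K. 2 * (S * (\<Sum>w\<in>V. (F w t)\<^sup>2)) + of_bool (t = 0) * (2 * S\<^sup>2))"
      by (rule sum_mono)
    also have "\<dots> = 2 * (S * (\<Sum>w\<in>V. \<Sum>t\<in>K. (F w t)\<^sup>2)) + 2 * S\<^sup>2"
    proof -
      have "(\<Sum>t\<in>K. of_bool (t = 0) * (2 * S\<^sup>2)) = 2 * S\<^sup>2"
        using sum_of_bool_eq[OF finK K0, of "\<lambda>_. 2 * S\<^sup>2"] by (simp add: eq_commute)
      moreover have "(\<Sum>w\<in>V. \<Sum>t\<in>K. (F w t)\<^sup>2) = (\<Sum>t\<in>K. \<Sum>w\<in>V. (F w t)\<^sup>2)" by (rule sum.swap)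
      ultimately show ?thesis by (simp add: sum.distrib sum_distrib_left)
    qed
    \<comment> \<open>Since \<phi> has mean zero, nothing is subtracted in the sphere moment and it
      bounds the squares of \<open>F\<close> directly.\<close>
    also have "\<dots> \<le> 2 * (S * (real q ^ d * S)) + 2 * S\<^sup>2"
      using sphere_second_moment[of \<phi>] S0 mean
      by (intro add_right_mono mult_left_mono) (auto simp: F_def S_def)
    finally show "(\<Sum>t\<in>K. (C t)\<^sup>2) \<le> 2 * (real q ^ d + 1) * S\<^sup>2"
      by (simp add: power2_eq_square algebra_simps)
  qed (use stab0_pos in simp)
  finally have "(\<Sum>g\<in>isoms. (\<Sum>x\<in>V. \<phi> x * \<phi> (g x))\<^sup>2)
      \<le> stab0 * S\<^sup>2 + 3 * stab0 / real q ^ (d - 1) * (2 * (real q ^ d + 1) * S\<^sup>2)" by simp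
  also have "\<dots> = stab0 * S\<^sup>2 * (1 + 6 * (real q ^ d / real q ^ (d - 1)) + 6 / real q ^ (d - 1))"
    by (simp add: field_simps add_divide_distrib)
  \<comment> \<open>13 = 1 + 6 + 6: the two terms without a factor \<open>q\<close> are absorbed as
    well.\<close>
  also have "\<dots> \<le> stab0 * S\<^sup>2 * (13 * real q)"
  proof (rule mult_left_mono)
    have "real q ^ d = real q * real q ^ (d - 1)" using d2 by (simp add: power_eq_if)
    then have "real q ^ d / real q ^ (d - 1) = real q" using q_pos by simp
    moreover have "6 / real q ^ (d - 1) \<le> 6"
    proof -
      have "1 \<le> real q ^ (d - 1)" using q5 by simp
      then have "6 / real q ^ (d - 1) \<le> 6 / 1" using q_pos by (intro divide_left_mono) auto
      then show ?thesis by simp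
    qed
    ultimately show "1 + 6 * (real q ^ d / real q ^ (d - 1)) + 6 / real q ^ (d - 1) \<le> 13 * real q"
      using q5 by simp
  qed (use stab0_pos in simp)
  finally show ?thesis by (simp add: S_def mult_ac)
qed

section \<open>Moments of the number of matched points\<close>

definition lam :: "'v set \<Rightarrow> ('v \<Rightarrow> 'v) \<Rightarrow> real" where
  "lam E g = real (card {z\<in>E \<times> E. g (fst z) = snd z})"

lemma card_graph: "card {z\<in>E \<times> E. g (fst z) = snd z} = card {u\<in>E. g u \<in> E}"
  by (rule bij_betw_same_card[OF bij_betw_byWitness[where f = fst and f' = "\<lambda>u. (u, g u)"]]) auto

text \<open>The second moment is applied to the balanced indicator of E, whose correlation under g
  is \<open>lam E g - m\<close>. Higher moments lose a factor n^(N-1) through the trivial bound on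
  the deviation.\<close>

lemma lam_moment:
  assumes E: "E \<subseteq> V" and N: "N \<ge> 1" and big: "real q ^ (d * N + 1) \<le> real (card E) ^ (N + 1)"
  shows "(\<Sum>g\<in>isoms. lam E g ^ (N + 1))
    \<le> 14 * 2 ^ (N + 1) * real q ^ d * stab0 * ((real (card E))\<^sup>2 / real q ^ d) ^ (N + 1)"
proof -
  define n where "n = real (card E)"
  define P where "P = real q ^ d"
  define m where "m = n\<^sup>2 / P"
  have P: "P > 0" using q_pos by (simp add: P_def)
  have n0: "n \<ge> 0" by (simp add: n_def)
  have m0: "m \<ge> 0" using P by (simp add: m_def)
  have fE: "finite E" using E finV finite_subset by blast
  have "card E \<le> q ^ d" using card_mono[OF finV E] by (simp add: cardV)
  then have nP: "n \<le> P" unfolding n_def P_def by (metis of_nat_mono of_nat_power)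
  then have mn: "m \<le> n" using mult_right_mono[OF nP n0] P by (simp add: m_def field_simps power2_eq_square)
  define \<phi> where "\<phi> x = of_bool (x \<in> E) - n / P" for x
  have s1: "(\<Sum>x\<in>V. of_bool (x \<in> E)) = n" using indicator_sums(2)[OF E] by (simp add: n_def)
  have sc: "(\<Sum>x\<in>V. c * of_bool (x \<in> E)) = c * n" for c :: real
    using s1 by (simp add: sum_distrib_left[symmetric])
  have mean: "(\<Sum>x\<in>V. \<phi> x) = 0"
    using P by (simp add: \<phi>_def sum_subtractf s1 cardV) (simp add: P_def)
  have "(\<Sum>x\<in>V. (\<phi> x)\<^sup>2) = (\<Sum>x\<in>V. of_bool (x \<in> E) - 2 * (n / P) * of_bool (x \<in> E) + (n / P)\<^sup>2)"
    by (intro sum.cong refl) (simp add: \<phi>_def power2_diff)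
  also have "\<dots> = n - 2 * (n / P) * n + P * (n / P)\<^sup>2"
    by (simp only: sum.distrib sum_subtractf s1 sc sum_constant cardV) (simp add: P_def)
  also have "\<dots> = n - m" using P by (simp add: m_def field_simps power2_eq_square)
  finally have S: "(\<Sum>x\<in>V. (\<phi> x)\<^sup>2) \<le> n" using m0 by simp
  have lam: "lam E g - m = (\<Sum>x\<in>V. \<phi> x * \<phi> (g x))" if g: "g \<in> isoms" for g
  proof -
    have "(\<Sum>x\<in>V. of_bool (g x \<in> E)) = (\<Sum>x\<in>V. of_bool (x \<in> E) :: real)"
      using sum.reindex_bij_betw[OF isomsD(3)[OF g], of "\<lambda>x. of_bool (x \<in> E)"] by simp
    then have s2: "(\<Sum>x\<in>V. of_bool (g x \<in> E)) = n" using s1 by simp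
    have sc2: "(\<Sum>x\<in>V. c * of_bool (g x \<in> E)) = c * n" for c :: real
      using s2 by (simp add: sum_distrib_left[symmetric])
    have "(\<Sum>x\<in>V. \<phi> x * \<phi> (g x)) = (\<Sum>x\<in>V. of_bool (x \<in> E) * of_bool (g x \<in> E)
        - (n / P) * of_bool (x \<in> E) - (n / P) * of_bool (g x \<in> E) + (n / P)\<^sup>2)"
      by (intro sum.cong refl) (simp add: \<phi>_def algebra_simps power2_eq_square)
    also have "\<dots> = lam E g - (n / P) * n - (n / P) * n + P * (n / P)\<^sup>2"
      using indicator_sums(1)[OF E, of "\<lambda>x. g x \<in> E"]
      by (simp only: sum.distrib sum_subtractf sc sc2 sum_constant cardV lam_def card_graph)
        (simp add: P_def)
    also have "\<dots> = lam E g - m" using P by (simp add: m_def field_simps power2_eq_square)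
    finally show ?thesis by simp
  qed
  have var: "(\<Sum>g\<in>isoms. (lam E g - m)\<^sup>2) \<le> 13 * real q * stab0 * n\<^sup>2"
  proof -
    have "(\<Sum>g\<in>isoms. (lam E g - m)\<^sup>2) \<le> 13 * real q * stab0 * (\<Sum>x\<in>V. (\<phi> x)\<^sup>2)\<^sup>2"
      using isoms_second_moment[OF mean] lam by simp
    also have "\<dots> \<le> 13 * real q * stab0 * n\<^sup>2"
      using S stab0_pos by (intro mult_left_mono power_mono sum_nonneg) auto
    finally show ?thesis .
  qed
  obtain j where j: "N = Suc j" using N by (cases N) auto
  have "(\<Sum>g\<in>isoms. lam E g ^ (j + 2)) \<le> (\<Sum>g\<in>isoms. 2 ^ (j + 2) * (m ^ (j + 2) + n ^ j * (lam E g - m)\<^sup>2))"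
  proof (intro sum_mono power_le_centered)
    fix g
    have "card {u\<in>E. g u \<in> E} \<le> card E" using fE by (intro card_mono) auto
    then have "lam E g \<le> n" "lam E g \<ge> 0" by (auto simp: lam_def card_graph n_def)
    then show "\<bar>lam E g - m\<bar> \<le> n" using mn m0 by linarith
  qed (use m0 in \<open>auto simp: lam_def\<close>)
  also have "\<dots> = 2 ^ (j + 2) * (card isoms * m ^ (j + 2) + n ^ j * (\<Sum>g\<in>isoms. (lam E g - m)\<^sup>2))"
    by (simp add: sum.distrib sum_distrib_left[symmetric])
  also have "\<dots> \<le> 2 ^ (j + 2) * (P * stab0 * m ^ (j + 2) + n ^ j * (13 * real q * stab0 * n\<^sup>2))"
    unfolding card_isoms P_def[symmetric] using var n0 by (intro mult_left_mono add_left_mono) auto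
  also have "n ^ j * (13 * real q * stab0 * n\<^sup>2) = 13 * stab0 * (real q * n ^ (j + 2))"
    by (simp add: power_add power2_eq_square)
  \<comment> \<open>This comparison is hypothesis \<open>big\<close> rewritten; adding the main term
    yields 14 = 1 + 13.\<close>
  also have "13 * stab0 * (real q * n ^ (j + 2)) \<le> 13 * stab0 * (P * m ^ (j + 2))"
  proof (rule mult_left_mono)
    have "real q * P ^ (j + 1) \<le> n ^ (j + 2)"
      using big unfolding j n_def P_def by (simp add: power_add power_mult[symmetric] mult_ac)
    then have "n ^ (j + 2) * (real q * P ^ (j + 1)) \<le> n ^ (j + 2) * n ^ (j + 2)"
      using n0 by (intro mult_left_mono) auto
    then have "real q * n ^ (j + 2) \<le> (n ^ (j + 2) * n ^ (j + 2)) / P ^ (j + 1)"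
      using P by (simp add: field_simps)
    also have "\<dots> = P * m ^ (j + 2)"
      using P by (simp add: m_def power_divide power2_eq_square power_mult_distrib)
    finally show "real q * n ^ (j + 2) \<le> P * m ^ (j + 2)" .
  qed (use stab0_pos in simp)
  finally have "(\<Sum>g\<in>isoms. lam E g ^ (j + 2)) \<le> 2 ^ (j + 2) * (P * stab0 * m ^ (j + 2) + 13 * stab0 * (P * m ^ (j + 2)))"
    by simp
  also have "\<dots> = 14 * 2 ^ (j + 2) * P * stab0 * m ^ (j + 2)" by (simp add: algebra_simps)
  finally show ?thesis unfolding j P_def m_def n_def by (simp add: mult_ac)
qed

text \<open>
  If \<open>\<lambda>\<close> is large, most \<open>k\<close>-tuples in the graph of \<open>g\<close> are generic, and these can be counted by
  cliques; if \<open>\<lambda>\<close> is small, the trivial bound suffices.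
\<close>

lemma lam_power_le:
  assumes E: "E \<subseteq> V" and x: "x \<in> V" and kd: "2 * k < d" and big: "lam E g \<ge> 2 * real q ^ k"
    and j: "j \<le> Suc k"
  shows "lam E g ^ j \<le> 2 ^ j *
    real (card {zs. length zs = j \<and> set zs \<subseteq> {z\<in>E \<times> E. g (fst z) = snd z} \<and> generic (diffs x (map fst zs))})"
  using j
proof (induction j)
  case 0
  have "{zs :: ('v \<times> 'v) list. length zs = 0 \<and> set zs \<subseteq> {z\<in>E \<times> E. g (fst z) = snd z} \<and> generic (diffs x (map fst zs))} = {[]}"
    by auto
  then show ?case by simp
next
  case (Suc j)
  let ?Z = "{z\<in>E \<times> E. g (fst z) = snd z}"
  let ?L = "\<lambda>j. {zs. length zs = j \<and> set zs \<subseteq> ?Z \<and> generic (diffs x (map fst zs))}"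
  have fE: "finite E" using E finV finite_subset by blast
  have fZ: "finite ?Z" using fE by simp
  have fL: "finite (?L j)" for j
    by (rule finite_subset[OF _ finite_lists_length_eq[OF fZ, of j]]) auto
  let ?good = "\<lambda>zs. {z\<in>?Z. fst z - x \<notin> perp (perp (set (diffs x (map fst zs))))}"
  have good: "lam E g \<le> 2 * real (card (?good zs))" if zs: "zs \<in> ?L j" for zs
  proof -
    have dV: "set (diffs x (map fst zs)) \<subseteq> V" using zs E x by (intro diffs_V) auto
    let ?P = "perp (perp (set (diffs x (map fst zs))))"
    have fP: "finite ?P" by (rule finite_subspace[OF subspace_perp])
    \<comment> \<open>Dependent choices lie in the double complement of the earlier ones, which has
      at most q^k elements; by \<open>big\<close> this is at most half of
      \<open>lam E g\<close>.\<close>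
    have "card (?Z - ?good zs) \<le> card ?P"
    proof (rule card_inj_on_le[where f = "\<lambda>z. fst z - x"])
      show "inj_on (\<lambda>z. fst z - x) (?Z - ?good zs)" by (rule inj_onI) (auto simp: prod_eq_iff)
    qed (use fP in auto)
    also have "\<dots> \<le> q ^ j" using card_perp_generic[of "diffs x (map fst zs)"] zs dV by auto
    also have "\<dots> \<le> q ^ k" by (rule power_increasing) (use Suc.prems q5 in auto)
    finally have "real (card (?Z - ?good zs)) \<le> real (q ^ k)" by (rule of_nat_mono)
    then have "real (card (?Z - ?good zs)) \<le> real q ^ k" by simp
    moreover have sub: "?good zs \<subseteq> ?Z" by blast
    have "card (?Z - ?good zs) = card ?Z - card (?good zs)"
      by (rule card_Diff_subset[OF finite_subset[OF sub fZ] sub])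
    moreover have "card (?good zs) \<le> card ?Z" by (rule card_mono[OF fZ sub])
    ultimately show ?thesis using big unfolding lam_def by linarith
  qed
  have "lam E g ^ Suc j = lam E g * lam E g ^ j" by simp
  also have "\<dots> \<le> lam E g * (2 ^ j * real (card (?L j)))"
    using Suc by (intro mult_left_mono) (auto simp: lam_def)
  also have "\<dots> = 2 ^ j * (\<Sum>zs\<in>?L j. lam E g)" by simp
  also have "\<dots> \<le> 2 ^ j * (\<Sum>zs\<in>?L j. 2 * real (card (?good zs)))"
    using good by (intro mult_left_mono sum_mono) auto
  also have "\<dots> = 2 ^ Suc j * real (\<Sum>zs\<in>?L j. card (?good zs))"
    by (simp only: of_nat_sum sum_distrib_left[symmetric] power_Suc mult_ac)
  also have "(\<Sum>zs\<in>?L j. card (?good zs)) = card (SIGMA zs:?L j. ?good zs)"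
  proof (rule card_SigmaI[OF fL, symmetric])
    show "\<forall>zs\<in>?L j. finite (?good zs)"
      by (intro ballI finite_subset[OF Collect_subset fZ])
  qed
  also have "\<dots> \<le> card (?L (Suc j))"
  proof (rule card_inj_on_le[where f = "\<lambda>(zs, z). z # zs"])
    show "(\<lambda>(zs, z). z # zs) ` (SIGMA zs:?L j. ?good zs) \<subseteq> ?L (Suc j)"
    proof
      fix l assume "l \<in> (\<lambda>(zs, z). z # zs) ` (SIGMA zs:?L j. ?good zs)"
      then obtain zs z where l: "l = z # zs" "zs \<in> ?L j" "z \<in> ?good zs" by auto
      have "set (diffs x (map fst zs)) \<subseteq> V" using l E x by (intro diffs_V) auto
      \<comment> \<open>The tail has length at most k, so 2k < d already supplies the anisotropic
        vector.\<close>
      then have "\<exists>w\<in>perp (set (diffs x (map fst zs))). Q w \<noteq> 0"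
        using l Suc.prems kd by (intro anisotropic_ex) auto
      then show "l \<in> ?L (Suc j)" using l by auto
    qed
  qed (use fL in \<open>auto simp: inj_on_def\<close>)
  finally show ?case by simp
qed

text \<open>A count of degrees of freedom, d for each of k + 1 vertices: a vertex placed after the
  base and i others has an orbit of dimension d - 1 - i and i + 1 prescribed distances.\<close>

lemma sum_exponents:
  assumes "k < d"
  shows "(\<Sum>i<Suc k. d - 1 - i) + (k + 1) * (k + 2) div 2 = d * (k + 1)"
  using assms
proof (induction k)
  case (Suc k)
  have "(Suc k + 1) * (Suc k + 2) div 2 = (k + 1) * (k + 2) div 2 + (k + 2)" by simp
  then show ?case using Suc by simp
qed simp

text \<open>Generic tuples in the graphs of isometries taking x to y are counted twice. Each tuple
  is a clique in the neighbourhood of z, and the isometries sharing it lie in one coset of the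
  stabilizer of x and the tuple. By \<open>sum_exponents\<close> the two bounds multiply to the
  expected order.\<close>

lemma lam_pinned:
  assumes E: "E \<subseteq> V" and z: "z \<in> E \<times> E" and kd: "2 * k < d"
    and A: "A \<ge> 1" "real (card ((E \<times> E) \<inter> adj z)) \<le> A * (real (card E))\<^sup>2 / q"
    and big: "real q ^ (d + Suc k) \<le> (real (card E))\<^sup>2"
  shows "(\<Sum>g\<in>{g\<in>isoms. g (fst z) = snd z}. lam E g ^ Suc k)
    \<le> (6 ^ Suc k * 2 ^ (k * (k + 2)) * real (k + 1) * A ^ Suc k + 2 ^ Suc k) * stab0
        * ((real (card E))\<^sup>2 / real q ^ d) ^ Suc k"
proof -
  obtain x y where xy: "z = (x, y)" by (cases z)
  have V: "x \<in> V" "y \<in> V" using xy z E by auto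
  have fE: "finite E" using E finV finite_subset by blast
  define G where "G = {g\<in>isoms. g x = y}"
  have fG: "finite G" using finite_isoms by (simp add: G_def)
  have "G = fixers [x] [y]" by (auto simp: G_def fixers_def)
  then have cG: "real (card G) = stab0" using card_fixers_single[OF V] by (simp add: stab0_def)
  define n2 where "n2 = (real (card E))\<^sup>2"
  define P where "P = real q ^ d"
  have P: "P > 0" using q_pos by (simp add: P_def)
  define Z where "Z g = {z\<in>E \<times> E. g (fst z) = snd z}" for g :: "'v \<Rightarrow> 'v"
  define L where "L g = {zs. length zs = Suc k \<and> set zs \<subseteq> Z g \<and> generic (diffs x (map fst zs))}" for g
  define Y where "Y = (E \<times> E) \<inter> adj z"
  have fY: "finite Y" using fE by (simp add: Y_def)
  define CL where "CL = {zs. length zs = Suc k \<and> set zs \<subseteq> Y \<and> sorted_wrt (\<lambda>u v. v \<in> adj u) zs}"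
  have fCL: "finite CL"
    unfolding CL_def by (rule finite_subset[OF _ finite_lists_length_eq[OF fY, of "Suc k"]]) auto
  define ex where "ex = (\<Sum>i<Suc k. d - 1 - i)"
  have LCL: "L g \<subseteq> CL" if "g \<in> G" for g
  proof
    fix zs assume zs: "zs \<in> L g"
    have g: "g \<in> isoms" "g x = y" using that by (auto simp: G_def)
    have *: "w \<in> adj w'" if "w \<in> Z g" "w' \<in> Z g" for w w'
    proof -
      have "fst w \<in> V" "fst w' \<in> V" "snd w \<in> V" "g (fst w) = snd w" "g (fst w') = snd w'"
        using that E by (auto simp: Z_def)
      then show ?thesis using isomsD(2)[OF g(1), of "fst w'" "fst w"]
        by (simp add: adj_def mem_Times_iff)
    qed
    have zsZ: "set zs \<subseteq> Z g" using zs by (simp add: L_def)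
    have "sorted_wrt (\<lambda>u v. v \<in> adj u) zs"
    proof (rule sorted_wrt_mono_rel[of _ "\<lambda>_ _. True"])
      show "sorted_wrt (\<lambda>_ _. True) zs" by (induction zs) auto
      show "v \<in> adj u" if "u \<in> set zs" "v \<in> set zs" for u v
        using * subsetD[OF zsZ that(2)] subsetD[OF zsZ that(1)] by blast
    qed
    moreover have zZ: "z \<in> Z g" using g z xy by (auto simp: Z_def)
    have "set zs \<subseteq> Y"
    proof
      fix w assume "w \<in> set zs"
      then have "w \<in> Z g" using zsZ by blast
      then show "w \<in> Y" using *[OF _ zZ] by (auto simp: Y_def Z_def)
    qed
    ultimately show "zs \<in> CL" using zs by (simp add: CL_def L_def)
  qed
  have main: "(\<Sum>g\<in>G. real (card (L g))) \<le> real (card CL) * (3 ^ Suc k * stab0 / real q ^ ex)"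
  proof -
    have "(\<Sum>g\<in>G. real (card (L g))) = (\<Sum>g\<in>G. \<Sum>zs\<in>CL. of_bool (zs \<in> L g))"
    proof (rule sum.cong[OF refl])
      fix g assume "g \<in> G"
      then have "CL \<inter> {zs. zs \<in> L g} = L g" using LCL by blast
      then show "real (card (L g)) = (\<Sum>zs\<in>CL. of_bool (zs \<in> L g))"
        using fCL by (simp only: of_bool_def sum.If_cases) simp
    qed
    also have "\<dots> = (\<Sum>zs\<in>CL. \<Sum>g\<in>G. of_bool (zs \<in> L g))" by (rule sum.swap)
    also have "\<dots> = (\<Sum>zs\<in>CL. real (card {g\<in>G. zs \<in> L g}))"
      using fG by (simp add: of_bool_def sum.If_cases Int_def)
    also have "\<dots> \<le> (\<Sum>zs\<in>CL. 3 ^ Suc k * stab0 / real q ^ ex)"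
    proof (rule sum_mono)
      fix zs assume "zs \<in> CL"
      show "real (card {g\<in>G. zs \<in> L g}) \<le> 3 ^ Suc k * stab0 / real q ^ ex"
      proof (cases "{g\<in>G. zs \<in> L g} = {}")
        case True
        then show ?thesis using stab0_pos by (metis card.empty divide_nonneg_nonneg less_imp_le mult_nonneg_nonneg of_nat_0 of_nat_0_le_iff zero_le_numeral zero_le_power)
      next
        case False
        then obtain g0 where g0: "g0 \<in> G" "zs \<in> L g0" by blast
        let ?us = "map fst zs" and ?vs = "map snd zs"
        have us: "set ?us \<subseteq> V" "length ?us = Suc k" "generic (diffs x ?us)"
          using g0 E by (auto simp: L_def Z_def)
        have sub: "{g\<in>G. zs \<in> L g} \<subseteq> fixers (?us @ [x]) (?vs @ [y])"
          by (auto simp: G_def L_def Z_def fixers_def)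
        then have g0': "g0 \<in> fixers (?us @ [x]) (?vs @ [y])" using g0 by blast
        have "card {g\<in>G. zs \<in> L g} \<le> card (fixers (?us @ [x]) (?vs @ [y]))"
          using sub by (intro card_mono) auto
        also have "\<dots> = stab_card x ?us"
          using us V by (intro card_fixers_eq[OF g0']) auto
        finally have "real (card {g\<in>G. zs \<in> L g}) \<le> real (stab_card x ?us)" by (rule of_nat_mono)
        also have "real (stab_card x ?us) \<le> 3 ^ Suc k * stab0 / real q ^ ex"
        proof -
          have "real q ^ ex * real (stab_card x ?us) \<le> 3 ^ Suc k * stab0"
            using card_fixers_upper[OF V(1) us(1,3)] us(2) by (simp add: ex_def)
          then show ?thesis using q_pos by (simp add: pos_le_divide_eq mult.commute)
        qed
        finally show ?thesis .
      qed
    qed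
    finally show ?thesis by simp
  qed
  define cc where "cc = 2 ^ (k * (k + 2)) * real (k + 1) * A ^ Suc k"
  have cl: "real (card CL) \<le> cc * n2 ^ Suc k / real q ^ ((k + 1) * (k + 2) div 2)"
    using pinned_cliques[OF E z A big] card_clique_lists[OF fY, of k adj]
    by (simp add: CL_def Y_def cc_def n2_def)
  have "real (card CL) * (3 ^ Suc k * stab0 / real q ^ ex)
      \<le> cc * n2 ^ Suc k / real q ^ ((k + 1) * (k + 2) div 2) * (3 ^ Suc k * stab0 / real q ^ ex)"
    using cl stab0_pos by (intro mult_right_mono) auto
  also have "\<dots> = cc * 3 ^ Suc k * stab0 * (n2 ^ Suc k / real q ^ (ex + (k + 1) * (k + 2) div 2))"
    by (simp add: power_add mult_ac)
  also have "ex + (k + 1) * (k + 2) div 2 = d * Suc k"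
    unfolding ex_def using sum_exponents[of k] kd by simp
  also have "n2 ^ Suc k / real q ^ (d * Suc k) = (n2 / P) ^ Suc k"
    by (simp only: P_def power_divide power_mult)
  finally have sumL: "(\<Sum>g\<in>G. real (card (L g))) \<le> cc * 3 ^ Suc k * stab0 * (n2 / P) ^ Suc k"
    using main by linarith
  have n2P: "real q ^ k \<le> n2 / P"
  proof -
    have "real q ^ k \<le> real q ^ Suc k" using q5 by (intro power_increasing) auto
    also have "real q ^ Suc k * P \<le> n2" using big by (simp add: n2_def P_def power_add mult_ac)
    then have "real q ^ Suc k \<le> n2 / P" using P by (simp only: pos_le_divide_eq)
    finally show ?thesis .
  qed
  \<comment> \<open>If \<open>lam E g\<close> is below 2q^k, it is also below twice its mean by
    \<open>n2P\<close>; the second summand covers this case.\<close>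
  have "(\<Sum>g\<in>G. lam E g ^ Suc k) \<le> (\<Sum>g\<in>G. 2 ^ Suc k * real (card (L g)) + (2 * (n2 / P)) ^ Suc k)"
  proof (rule sum_mono)
    fix g
    have n2P0: "0 \<le> n2 / P" using P by (simp add: n2_def)
    show "lam E g ^ Suc k \<le> 2 ^ Suc k * real (card (L g)) + (2 * (n2 / P)) ^ Suc k"
    proof (cases "lam E g \<ge> 2 * real q ^ k")
      case True
      have "lam E g ^ Suc k \<le> 2 ^ Suc k * real (card (L g))"
        using lam_power_le[OF E V(1) kd True, of "Suc k"] by (simp only: L_def Z_def)
      moreover have "0 \<le> (2 * (n2 / P)) ^ Suc k" by (intro zero_le_power mult_nonneg_nonneg n2P0) simp
      ultimately show ?thesis by linarith
    next
      case False
      then have "lam E g \<le> 2 * (n2 / P)" using n2P by linarith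
      then have "lam E g ^ Suc k \<le> (2 * (n2 / P)) ^ Suc k" by (intro power_mono) (auto simp: lam_def)
      then show ?thesis by (rule order.trans[OF _ add_increasing[OF _ order.refl]]) simp
    qed
  qed
  also have "\<dots> = 2 ^ Suc k * (\<Sum>g\<in>G. real (card (L g))) + stab0 * (2 * (n2 / P)) ^ Suc k"
    by (simp only: sum.distrib sum_distrib_left[symmetric] sum_constant cG)
  also have "\<dots> \<le> 2 ^ Suc k * (cc * 3 ^ Suc k * stab0 * (n2 / P) ^ Suc k) + stab0 * (2 * (n2 / P)) ^ Suc k"
    using sumL by (intro add_right_mono mult_left_mono) auto
  also have "\<dots> = ((2 * 3) ^ Suc k * cc + 2 ^ Suc k) * stab0 * (n2 / P) ^ Suc k"
    by (simp only: power_mult_distrib) (simp add: algebra_simps)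
  finally show ?thesis by (simp add: G_def xy n2_def P_def cc_def mult_ac)
qed

text \<open>Scale b so that \<open>dt b w0 = e\<close>. Every w in \<open>?W\<close> can be moved
  along \<open>w0\<close> into the kernel of b; vanishing of Q there is a quadratic equation for
  \<open>dt b w\<close> whose coefficients depend only on w. This confines b to two cosets of the
  double complement, and undoing the scaling costs a factor \<open>q\<close>.\<close>

lemma card_isotropic_next:
  assumes gen: "generic bs" and bs: "set bs \<subseteq> V" and w0: "w0 \<in> perp (set bs)" "Q w0 \<noteq> 0"
  shows "card {b\<in>V. b \<notin> perp (perp (set bs)) \<and> (\<forall>w\<in>perp (set (b # bs)). Q w = 0)} \<le> 2 * q ^ Suc (length bs)"
proof -
  let ?W = "perp (set bs)"
  let ?P = "perp ?W"
  define U where "U = {b\<in>V. b \<notin> ?P \<and> (\<forall>w\<in>perp (set (b # bs)). Q w = 0)}"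
  define M where "M = {b\<in>U. dt b w0 = e}"
  have W: "subspace ?W" by (rule subspace_perp)
  have P: "subspace ?P" by (rule subspace_perp)
  have fP: "finite ?P" by (rule finite_subspace[OF P])
  have WV: "w \<in> V" if "w \<in> ?W" for w using that by (simp add: perp_def)
  have w0V: "w0 \<in> V" using WV w0 by blast
  have perp_Cons: "perp (set (b # bs)) = {w\<in>?W. dt b w = 0}" for b
    by (auto simp: perp_def)
  have root: "dt b w * dt b w * Q w0 - 2 * (dt b w * dt w w0) + Q w = 0"
    if b: "b \<in> M" and w: "w \<in> ?W" for b w
  proof -
    have bV: "b \<in> V" using b by (simp add: M_def U_def)
    have sK: "dt b w \<in> K" using bV WV[OF w] by simp
    have "w - sc (dt b w) w0 \<in> ?W" using subspaceD(4,6)[OF W] w w0 sK by blast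
    moreover have "dt b (w - sc (dt b w) w0) = 0" using b sK by (simp add: M_def dt_linear mult.commute)
    ultimately have "Q (w - sc (dt b w) w0) = 0" using b unfolding M_def U_def perp_Cons by blast
    then show ?thesis by (simp add: Q_diff Q_sc dt_sc_right algebra_simps)
  qed
  have three: "dt b w = dt b1 w \<or> dt b w = dt b2 w \<or> dt b1 w = dt b2 w"
    if b: "b \<in> M" "b1 \<in> M" "b2 \<in> M" and w: "w \<in> ?W" for b b1 b2 w
  proof -
    have K: "dt b w \<in> K" "dt b1 w \<in> K" "dt b2 w \<in> K"
      using b WV[OF w] by (auto simp: M_def U_def)
    have "card {s\<in>K. Q w0 * s * s + 2 * (- dt w w0) * s = - Q w} \<le> 2"
      using w0 w0V WV[OF w] by (intro card_quadratic_roots) auto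
    moreover have "dt b w \<in> {s\<in>K. Q w0 * s * s + 2 * (- dt w w0) * s = - Q w}" if b: "b \<in> M" for b
    proof -
      have "Q w0 * dt b w * dt b w + 2 * (- dt w w0) * dt b w + Q w
          = dt b w * dt b w * Q w0 - 2 * (dt b w * dt w w0) + Q w" by (simp add: mult_ac)
      also have "\<dots> = 0" by (rule root[OF b w])
      finally have "Q w0 * dt b w * dt b w + 2 * (- dt w w0) * dt b w = - Q w"
        by (simp only: eq_neg_iff_add_eq_0)
      moreover have "dt b w \<in> K" using b WV[OF w] by (auto simp: M_def U_def)
      ultimately show ?thesis by (intro CollectI conjI)
    qed
    from this[OF b(1)] this[OF b(2)] this[OF b(3)]
    have "{dt b w, dt b1 w, dt b2 w} \<subseteq> {s\<in>K. Q w0 * s * s + 2 * (- dt w w0) * s = - Q w}"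
      by (simp only: insert_subset empty_subsetI simp_thms)
    then have "card {dt b w, dt b1 w, dt b2 w} \<le> card {s\<in>K. Q w0 * s * s + 2 * (- dt w w0) * s = - Q w}"
      by (rule card_mono[OF finite_subset[OF Collect_subset finK]])
    ultimately have le: "card {dt b w, dt b1 w, dt b2 w} \<le> 2" by linarith
    show ?thesis
    proof (rule ccontr)
      assume "\<not> (dt b w = dt b1 w \<or> dt b w = dt b2 w \<or> dt b1 w = dt b2 w)"
      then have "card {dt b w, dt b1 w, dt b2 w} = 3" by simp
      then show False using le by simp
    qed
  qed
  have cardW: "card ?W > 0" using finite_subspace[OF W] w0 by (auto simp: card_gt_0_iff)
  have level: "q * card {w\<in>?W. dt b w = dt b' w} = card ?W" if "b \<in> M" "b' \<in> M" "b - b' \<notin> ?P" for b b'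
  proof -
    have "b - b' \<in> V" using that by (auto simp: M_def U_def)
    from perp_perpD[OF this that(3)] obtain w1 where w1: "w1 \<in> ?W" "dt (b - b') w1 \<noteq> 0" by blast
    have "q * card {w\<in>?W. dt (b - b') w = 0} = card ?W"
      by (rule card_level_set[OF W \<open>b - b' \<in> V\<close> w1 K0])
    then show ?thesis by (simp add: dt_linear)
  qed
  have cM: "card M \<le> 2 * card ?P"
  proof (cases "\<exists>b1\<in>M. \<exists>b2\<in>M. b1 - b2 \<notin> ?P")
    case True
    then obtain b1 b2 where b: "b1 \<in> M" "b2 \<in> M" "b1 - b2 \<notin> ?P" by blast
    \<comment> \<open>A point outside both cosets would give three functionals on \<open>?W\<close>,
      two of which agree at each point; but the three sets of agreement have only
      \<open>card ?W\<close> / q elements each.\<close>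
    have "M \<subseteq> (\<lambda>p. p + b1) ` ?P \<union> (\<lambda>p. p + b2) ` ?P"
    proof (rule ccontr)
      assume "\<not> ?thesis"
      then obtain b0 where b0: "b0 \<in> M" "b0 \<notin> (\<lambda>p. p + b1) ` ?P" "b0 \<notin> (\<lambda>p. p + b2) ` ?P" by blast
      have n: "b0 - b1 \<notin> ?P" "b0 - b2 \<notin> ?P"
        using b0 by (metis diff_add_cancel image_eqI)+
      have "card ?W \<le> card ({w\<in>?W. dt b0 w = dt b1 w} \<union> ({w\<in>?W. dt b0 w = dt b2 w} \<union> {w\<in>?W. dt b1 w = dt b2 w}))"
        using three[OF b0(1) b(1,2)] finite_subspace[OF W] by (intro card_mono) auto
      also have "\<dots> \<le> card {w\<in>?W. dt b0 w = dt b1 w} + (card {w\<in>?W. dt b0 w = dt b2 w} + card {w\<in>?W. dt b1 w = dt b2 w})"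
        by (meson card_Un_le add_left_mono order.trans)
      finally have "q * card ?W \<le> q * (card {w\<in>?W. dt b0 w = dt b1 w} + (card {w\<in>?W. dt b0 w = dt b2 w} + card {w\<in>?W. dt b1 w = dt b2 w}))"
        by (rule mult_le_mono2)
      also have "\<dots> = 3 * card ?W"
        unfolding distrib_left level[OF b0(1) b(1) n(1)] level[OF b0(1) b(2) n(2)] level[OF b] by simp
      finally show False using cardW q5 by simp
    qed
    then have "card M \<le> card ((\<lambda>p. p + b1) ` ?P \<union> (\<lambda>p. p + b2) ` ?P)"
      using fP by (intro card_mono) auto
    also have "\<dots> \<le> card ((\<lambda>p. p + b1) ` ?P) + card ((\<lambda>p. p + b2) ` ?P)" by (rule card_Un_le)
    also have "\<dots> \<le> 2 * card ?P"
      using card_image_le[OF fP, of "\<lambda>p. p + b1"] card_image_le[OF fP, of "\<lambda>p. p + b2"] by simp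
    finally show ?thesis .
  next
    case False
    show ?thesis
    proof (cases "M = {}")
      case True
      then show ?thesis by simp
    next
      case ne: False
      then obtain b1 where b1: "b1 \<in> M" by blast
      have "M \<subseteq> (\<lambda>p. p + b1) ` ?P"
      proof
        fix b assume "b \<in> M"
        then have "b - b1 \<in> ?P" using False b1 by blast
        then show "b \<in> (\<lambda>p. p + b1) ` ?P" by (metis diff_add_cancel image_eqI)
      qed
      then have "card M \<le> card ?P" using fP by (meson surj_card_le)
      then show ?thesis by simp
    qed
  qed
  have "U \<subseteq> (\<lambda>(s, b). sc s b) ` (K \<times> M)"
  proof
    fix b assume b: "b \<in> U"
    have bV: "b \<in> V" using b by (simp add: U_def)
    have "dt b w0 \<noteq> 0"
    proof
      assume "dt b w0 = 0"
      then have "w0 \<in> perp (set (b # bs))" using w0(1) unfolding perp_Cons by blast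
      then show False using b w0(2) unfolding U_def by blast
    qed
    then obtain r where r: "r \<in> K" "dt b w0 * r = e" using inverse_ex[of "dt b w0"] bV w0V by auto
    have sK: "dt b w0 \<in> K" using bV w0V by simp
    have bb: "sc (dt b w0) (sc r b) = b" by (rule sc_cancel[OF r(2) sK r(1) bV])
    have "r \<noteq> 0" using r two_nonzero by auto
    have "sc r b \<in> V" using r bV by simp
    moreover have "sc r b \<notin> ?P"
    proof
      assume "sc r b \<in> ?P"
      then have "b \<in> ?P" using subspaceD(4)[OF P sK, of "sc r b"] bb by simp
      then show False using b by (simp add: U_def)
    qed
    moreover have "\<forall>w\<in>perp (set (sc r b # bs)). Q w = 0"
    proof
      fix w assume "w \<in> perp (set (sc r b # bs))"
      then have w: "w \<in> ?W" "r * dt b w = 0" unfolding perp_Cons dt_sc_left by auto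
      then have "dt b w = 0" using K_cancel[of r "dt b w"] r bV WV \<open>r \<noteq> 0\<close> by auto
      then show "Q w = 0" using b w(1) unfolding U_def perp_Cons by blast
    qed
    ultimately have "sc r b \<in> M" using r by (simp add: M_def U_def dt_linear mult.commute)
    then show "b \<in> (\<lambda>(s, b). sc s b) ` (K \<times> M)"
      using sK bb by (intro image_eqI[of _ _ "(dt b w0, sc r b)"]) auto
  qed
  moreover have fM: "finite M" using finV by (auto simp: M_def U_def)
  ultimately have "card U \<le> card (K \<times> M)" using finK by (intro surj_card_le) auto
  also have "\<dots> \<le> q * (2 * card ?P)" using cM by (simp add: card_cartesian_product cardK)
  also have "\<dots> \<le> q * (2 * q ^ length bs)" using card_perp_generic[OF gen bs] by simp
  finally show ?thesis unfolding U_def by simp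
qed

end

section \<open>Summation over simplex trees\<close>

text \<open>Cauchy-Schwarz over the fibres of f. An upper bound on collisions thus becomes a lower
  bound on the number of values.\<close>

lemma card_power2_le_collisions:
  assumes "finite A"
  shows "(real (card A))\<^sup>2 \<le> real (card (f ` A)) * real (card {(a, b). a \<in> A \<and> b \<in> A \<and> f a = f b})"
proof -
  define n where "n y = real (card {a\<in>A. f a = y})" for y
  have 1: "real (card A) = (\<Sum>y\<in>f ` A. 1 * n y)"
  proof -
    have "card A = (\<Sum>y\<in>f ` A. card {a\<in>A. f a = y})"
      using assms sum.group[of A "f ` A" f "\<lambda>_. 1::nat"] by simp
    then show ?thesis by (simp add: n_def)
  qed
  have "card {(a, b). a \<in> A \<and> b \<in> A \<and> f a = f b} = card (\<Union>y\<in>f ` A. {a\<in>A. f a = y} \<times> {a\<in>A. f a = y})"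
    by (rule arg_cong[of _ _ card]) auto
  also have "\<dots> = (\<Sum>y\<in>f ` A. card ({a\<in>A. f a = y} \<times> {a\<in>A. f a = y}))"
    using assms by (intro card_UN_disjoint) auto
  finally have 2: "real (card {(a, b). a \<in> A \<and> b \<in> A \<and> f a = f b}) = (\<Sum>y\<in>f ` A. (n y)\<^sup>2)"
    by (simp add: card_cartesian_product n_def power2_eq_square)
  show ?thesis
    unfolding 2 unfolding 1 using Cauchy_Schwarz_ineq_sum[of "\<lambda>_. 1" n "f ` A"] by simp
qed

lemma card_fibrewise_le:
  assumes U: "finite U" "v \<in> U" and E: "finite E" and P: "P \<subseteq> U \<rightarrow>\<^sub>E E"
    and fib: "\<And>y. y \<in> (U - {v}) \<rightarrow>\<^sub>E E \<Longrightarrow> card {a\<in>E. y(v := a) \<in> P} \<le> B"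
  shows "card P \<le> B * card E ^ (card U - 1)"
proof -
  have fP: "finite ((U - {v}) \<rightarrow>\<^sub>E E)" using U E by (intro finite_PiE) auto
  have "P \<subseteq> (\<lambda>(y, a). y(v := a)) ` (SIGMA y:(U - {v}) \<rightarrow>\<^sub>E E. {a\<in>E. y(v := a) \<in> P})"
  proof
    fix p assume p: "p \<in> P"
    define y where "y = restrict p (U - {v})"
    have pU: "p \<in> U \<rightarrow>\<^sub>E E" using p P by blast
    have "y(v := p v) = p"
    proof
      fix x show "(y(v := p v)) x = p x" using PiE_arb[OF pU, of x] by (auto simp: y_def)
    qed
    moreover have "y \<in> (U - {v}) \<rightarrow>\<^sub>E E" using pU by (auto simp: y_def intro: PiE_mem)
    moreover have "p v \<in> E" using pU U by (auto intro: PiE_mem)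
    ultimately show "p \<in> (\<lambda>(y, a). y(v := a)) ` (SIGMA y:(U - {v}) \<rightarrow>\<^sub>E E. {a\<in>E. y(v := a) \<in> P})"
      using p by (intro image_eqI[of _ _ "(y, p v)"]) auto
  qed
  then have "card P \<le> card (SIGMA y:(U - {v}) \<rightarrow>\<^sub>E E. {a\<in>E. y(v := a) \<in> P})"
    using fP E by (intro surj_card_le) auto
  also have "\<dots> = (\<Sum>y\<in>(U - {v}) \<rightarrow>\<^sub>E E. card {a\<in>E. y(v := a) \<in> P})"
    using fP E by (intro card_SigmaI) auto
  also have "\<dots> \<le> (\<Sum>y\<in>(U - {v}) \<rightarrow>\<^sub>E E. B)" by (intro sum_mono fib)
  also have "\<dots> = B * card E ^ (card U - 1)" using U by (simp add: card_PiE)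
  finally show ?thesis .
qed

lemma sum_pinned_incidence:
  assumes S: "finite S" "v \<in> S" and Z: "finite Z" and a: "a \<in> Z"
  shows "(\<Sum>z | z \<in> S \<rightarrow>\<^sub>E Z \<and> z v = a. of_bool (\<forall>u\<in>S. inc (z u)))
    = of_bool (inc a) * real (card {b\<in>Z. inc b}) ^ (card S - 1)"
proof -
  have f: "finite {z. z \<in> S \<rightarrow>\<^sub>E Z \<and> z v = a}"
    by (rule finite_subset[OF _ finite_PiE[OF S(1), of "\<lambda>_. Z"]]) (use Z in auto)
  have "(\<Sum>z | z \<in> S \<rightarrow>\<^sub>E Z \<and> z v = a. of_bool (\<forall>u\<in>S. inc (z u)))
     = real (card {z. (z \<in> S \<rightarrow>\<^sub>E Z \<and> z v = a) \<and> (\<forall>u\<in>S. inc (z u))})"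
    using f by (simp only: of_bool_def sum.If_cases) (simp add: Int_def)
  also have "{z. (z \<in> S \<rightarrow>\<^sub>E Z \<and> z v = a) \<and> (\<forall>u\<in>S. inc (z u))}
      = (\<Pi>\<^sub>E u\<in>S. if u = v then {b\<in>{a}. inc b} else {b\<in>Z. inc b})"
  proof (rule subset_antisym; rule subsetI)
    fix z assume "z \<in> {z. (z \<in> S \<rightarrow>\<^sub>E Z \<and> z v = a) \<and> (\<forall>u\<in>S. inc (z u))}"
    then show "z \<in> (\<Pi>\<^sub>E u\<in>S. if u = v then {b\<in>{a}. inc b} else {b\<in>Z. inc b})"
      using S by (auto simp: PiE_iff)
  next
    fix z assume z: "z \<in> (\<Pi>\<^sub>E u\<in>S. if u = v then {b\<in>{a}. inc b} else {b\<in>Z. inc b})"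
    have "z v = a" using PiE_mem[OF z S(2)] by simp
    moreover have "z u \<in> Z \<and> inc (z u)" if "u \<in> S" for u
      using PiE_mem[OF z that] a by (auto split: if_splits)
    moreover have "z \<in> extensional S" using z by (simp add: PiE_def)
    ultimately show "z \<in> {z. (z \<in> S \<rightarrow>\<^sub>E Z \<and> z v = a) \<and> (\<forall>u\<in>S. inc (z u))}"
      by (auto simp: PiE_iff)
  qed
  also have "card \<dots> = (\<Prod>u\<in>S. card (if u = v then {b\<in>{a}. inc b} else {b\<in>Z. inc b}))"
    by (rule card_PiE[OF S(1)])
  also have "\<dots> = card {b\<in>{a}. inc b} * (\<Prod>u\<in>S - {v}. card {b\<in>Z. inc b})"
    using S by (simp add: prod.remove[of S v])
  also have "(\<Prod>u\<in>S - {v}. card {b\<in>Z. inc b}) = card {b\<in>Z. inc b} ^ (card S - 1)"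
    using S by simp
  also have "card {b\<in>{a}. inc b} = of_bool (inc a)"
  proof (cases "inc a")
    case True
    then have "{b\<in>{a}. inc b} = {a}" by blast
    then show ?thesis using True by simp
  next
    case False
    then have "{b\<in>{a}. inc b} = {}" by blast
    then show ?thesis using False by simp
  qed
  finally show ?thesis by simp
qed

lemma sum_incidence:
  assumes S: "finite S" and Z: "finite Z"
  shows "(\<Sum>z\<in>S \<rightarrow>\<^sub>E Z. of_bool (\<forall>u\<in>S. inc (z u))) = real (card {b\<in>Z. inc b}) ^ card S"
proof -
  have f: "finite (S \<rightarrow>\<^sub>E Z)" using S Z by (intro finite_PiE) auto
  have "(\<Sum>z\<in>S \<rightarrow>\<^sub>E Z. of_bool (\<forall>u\<in>S. inc (z u))) = real (card ((S \<rightarrow>\<^sub>E Z) \<inter> {z. \<forall>u\<in>S. inc (z u)}))"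
    using f by (simp only: of_bool_def sum.If_cases) simp
  also have "(S \<rightarrow>\<^sub>E Z) \<inter> {z. \<forall>u\<in>S. inc (z u)} = S \<rightarrow>\<^sub>E {b\<in>Z. inc b}"
    by (auto simp: PiE_iff)
  finally show ?thesis using S by (simp add: card_PiE)
qed

text \<open>Every factor is at most its value at the member of \<open>X\<close> where
  \<open>l\<close> is largest. Summing over \<open>X\<close> avoids naming that member, which
  depends on \<open>l\<close>.\<close>

lemma prod_powers_le_sum_power:
  fixes l :: "'s \<Rightarrow> real"
  assumes T: "finite T" and X: "X \<subseteq> T" "X \<noteq> {}" and m: "\<And>S. S \<in> T - X \<Longrightarrow> m S = 0"
    and l: "\<And>S. S \<in> T \<Longrightarrow> l S \<ge> 0"
  shows "(\<Prod>S\<in>T. l S ^ m S) \<le> (\<Sum>S\<in>X. l S ^ (\<Sum>S\<in>T. m S))"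
proof -
  have fX: "finite X" using X T finite_subset by blast
  have "Max (l ` X) \<in> l ` X" using fX X by (intro Max_in) auto
  then obtain S0 where S0: "S0 \<in> X" "l S0 = Max (l ` X)" by auto
  have le: "l S \<le> l S0" if "S \<in> X" for S using that fX by (simp add: S0(2))
  have "(\<Prod>S\<in>T. l S ^ m S) \<le> (\<Prod>S\<in>T. l S0 ^ m S)"
  proof (rule prod_mono)
    fix S assume S: "S \<in> T"
    show "0 \<le> l S ^ m S \<and> l S ^ m S \<le> l S0 ^ m S"
      using l[OF S] le[of S] m[of S] S by (cases "S \<in> X") (auto intro: power_mono)
  qed
  also have "\<dots> = l S0 ^ (\<Sum>S\<in>T. m S)" by (simp add: power_sum)
  also have "\<dots> \<le> (\<Sum>S\<in>X. l S ^ (\<Sum>S\<in>T. m S))"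
    using S0 fX l X by (intro member_le_sum) auto
  finally show ?thesis .
qed

text \<open>
  Only \<open>\<kappa> S\<close> of the vertices of a simplex are used to control its sum with one vertex pinned;
  the remaining powers of \<open>\<lambda>\<close> are collected at a single simplex, which then serves as the root.
\<close>

lemma tree_incidence_sum:
  fixes inc :: "'g \<Rightarrow> 'z \<Rightarrow> bool" and T :: "'v set set" and \<kappa> :: "'v set \<Rightarrow> nat"
  assumes tree: "simplex_tree T" and Z: "finite Z" and G: "finite G"
    and X: "X \<subseteq> T" "X \<noteq> {}"
    and \<kappa>: "\<And>S. S \<in> T \<Longrightarrow> \<kappa> S \<le> card S - 1" "\<And>S. S \<in> T - X \<Longrightarrow> \<kappa> S = card S - 1"
    and A: "\<And>S. S \<in> T \<Longrightarrow> A S \<ge> 0"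
    and pin: "\<And>S a. \<lbrakk>S \<in> T; a \<in> Z\<rbrakk> \<Longrightarrow>
      (\<Sum>g\<in>{g\<in>G. inc g a}. real (card {z\<in>Z. inc g z}) ^ \<kappa> S) \<le> A S"
  shows "(\<Sum>z\<in>\<Union>T \<rightarrow>\<^sub>E Z. \<Prod>S\<in>T. real (card {g\<in>G. \<forall>v\<in>S. inc g (z v)}))
    \<le> (\<Sum>R\<in>X. (\<Prod>S\<in>T - {R}. A S) *
        (\<Sum>g\<in>G. real (card {z\<in>Z. inc g z}) ^ (\<kappa> R + 1 + (\<Sum>S\<in>T. card S - 1 - \<kappa> S))))"
proof -
  define l where "l g = real (card {z\<in>Z. inc g z})" for g
  define m where "m S = card S - 1 - \<kappa> S" for S
  define M where "M = (\<Sum>S\<in>T. m S)"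
  have fT: "finite T" and fS: "\<And>S. S \<in> T \<Longrightarrow> finite S" "\<And>S. S \<in> T \<Longrightarrow> S \<noteq> {}"
    using tree by (auto simp: simplex_tree_def)
  have fU: "finite (\<Union>T)" using fT fS by blast
  define on where "on S g z = (of_bool (\<forall>v\<in>S. inc g (z v)) :: real)" for S g and z :: "'v \<Rightarrow> 'z"
  \<comment> \<open>The weight divides the surplus power \<open>l g ^ m S\<close> out of every
    simplex and restores the total surplus \<open>M\<close> at the root \<open>R\<close>.\<close>
  define K where "K R S z = (\<Sum>g\<in>G. on S g z * (inverse (l g ^ m S) * (if S = R then l g ^ M else 1)))" for R S z
  \<comment> \<open>A nonzero summand has an incident point, so dividing by powers of
    \<open>l g\<close> is legitimate.\<close>
  have lpos: "l g > 0" if "on S g z \<noteq> 0" "S \<in> T" "z \<in> \<Union>T \<rightarrow>\<^sub>E Z" for S g z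
  proof -
    obtain v where v: "v \<in> S" using fS(2) \<open>S \<in> T\<close> by blast
    then have "z v \<in> {z\<in>Z. inc g z}" using that by (auto simp: on_def intro: PiE_mem split: if_splits)
    then show ?thesis using Z unfolding l_def by (simp add: card_gt_0_iff) blast
  qed
  have l0: "l g \<ge> 0" for g by (simp add: l_def)
  have on0: "on S g z \<ge> 0" for S g z by (simp add: on_def)
  have "(\<Prod>S\<in>T. real (card {g\<in>G. \<forall>v\<in>S. inc g (z v)})) \<le> (\<Sum>R\<in>X. \<Prod>S\<in>T. K R S z)"
    if z: "z \<in> \<Union>T \<rightarrow>\<^sub>E Z" for z
  proof -
    have "(\<Prod>S\<in>T. real (card {g\<in>G. \<forall>v\<in>S. inc g (z v)})) = (\<Prod>S\<in>T. \<Sum>g\<in>G. on S g z)"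
      using G unfolding on_def by (intro prod.cong refl) (simp add: of_bool_def sum.If_cases Int_def)
    also have "\<dots> = (\<Sum>\<gamma>\<in>T \<rightarrow>\<^sub>E G. \<Prod>S\<in>T. on S (\<gamma> S) z)"
      using fT G by (intro prod_sum_PiE) auto
    also have "\<dots> \<le> (\<Sum>\<gamma>\<in>T \<rightarrow>\<^sub>E G. \<Sum>R\<in>X. (\<Prod>S\<in>T. on S (\<gamma> S) z * inverse (l (\<gamma> S) ^ m S)) * l (\<gamma> R) ^ M)"
    proof (rule sum_mono)
      fix \<gamma>
      have "(\<Prod>S\<in>T. on S (\<gamma> S) z) = (\<Prod>S\<in>T. on S (\<gamma> S) z * inverse (l (\<gamma> S) ^ m S) * l (\<gamma> S) ^ m S)"
      proof (rule prod.cong[OF refl])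
        fix S assume "S \<in> T"
        then show "on S (\<gamma> S) z = on S (\<gamma> S) z * inverse (l (\<gamma> S) ^ m S) * l (\<gamma> S) ^ m S"
          using lpos[of S "\<gamma> S" z] z by (cases "on S (\<gamma> S) z = 0") auto
      qed
      also have "\<dots> = (\<Prod>S\<in>T. on S (\<gamma> S) z * inverse (l (\<gamma> S) ^ m S)) * (\<Prod>S\<in>T. l (\<gamma> S) ^ m S)"
        by (rule prod.distrib)
      also have "\<dots> \<le> (\<Prod>S\<in>T. on S (\<gamma> S) z * inverse (l (\<gamma> S) ^ m S)) * (\<Sum>R\<in>X. l (\<gamma> R) ^ M)"
      proof (rule mult_left_mono)
        show "(\<Prod>S\<in>T. l (\<gamma> S) ^ m S) \<le> (\<Sum>R\<in>X. l (\<gamma> R) ^ M)"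
          unfolding M_def using prod_powers_le_sum_power[OF fT X, of m "\<lambda>S. l (\<gamma> S)"] \<kappa>(2) l0
          by (simp add: m_def)
      qed (intro prod_nonneg ballI mult_nonneg_nonneg on0, simp add: l0)
      finally show "(\<Prod>S\<in>T. on S (\<gamma> S) z)
        \<le> (\<Sum>R\<in>X. (\<Prod>S\<in>T. on S (\<gamma> S) z * inverse (l (\<gamma> S) ^ m S)) * l (\<gamma> R) ^ M)"
        by (simp add: sum_distrib_left)
    qed
    also have "\<dots> = (\<Sum>R\<in>X. \<Sum>\<gamma>\<in>T \<rightarrow>\<^sub>E G. (\<Prod>S\<in>T. on S (\<gamma> S) z * inverse (l (\<gamma> S) ^ m S)) * l (\<gamma> R) ^ M)"
      by (rule sum.swap)
    also have "\<dots> = (\<Sum>R\<in>X. \<Prod>S\<in>T. K R S z)"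
    proof (rule sum.cong[OF refl])
      fix R assume R: "R \<in> X"
      have "(\<Prod>S\<in>T. K R S z) = (\<Sum>\<gamma>\<in>T \<rightarrow>\<^sub>E G. \<Prod>S\<in>T. on S (\<gamma> S) z * (inverse (l (\<gamma> S) ^ m S) * (if S = R then l (\<gamma> S) ^ M else 1)))"
        unfolding K_def using fT G by (intro prod_sum_PiE) auto
      also have "\<dots> = (\<Sum>\<gamma>\<in>T \<rightarrow>\<^sub>E G. (\<Prod>S\<in>T. on S (\<gamma> S) z * inverse (l (\<gamma> S) ^ m S)) * l (\<gamma> R) ^ M)"
      proof (rule sum.cong[OF refl])
        fix \<gamma>
        have "(\<Prod>S\<in>T. if S = R then l (\<gamma> S) ^ M else 1) = l (\<gamma> R) ^ M"
          using fT R X by (subst prod.delta) auto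
        then show "(\<Prod>S\<in>T. on S (\<gamma> S) z * (inverse (l (\<gamma> S) ^ m S) * (if S = R then l (\<gamma> S) ^ M else 1)))
          = (\<Prod>S\<in>T. on S (\<gamma> S) z * inverse (l (\<gamma> S) ^ m S)) * l (\<gamma> R) ^ M"
          by (simp only: prod.distrib mult.assoc)
      qed
      finally show "(\<Sum>\<gamma>\<in>T \<rightarrow>\<^sub>E G. (\<Prod>S\<in>T. on S (\<gamma> S) z * inverse (l (\<gamma> S) ^ m S)) * l (\<gamma> R) ^ M) = (\<Prod>S\<in>T. K R S z)"
        by simp
    qed
    finally show ?thesis .
  qed
  then have "(\<Sum>z\<in>\<Union>T \<rightarrow>\<^sub>E Z. \<Prod>S\<in>T. real (card {g\<in>G. \<forall>v\<in>S. inc g (z v)}))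
     \<le> (\<Sum>z\<in>\<Union>T \<rightarrow>\<^sub>E Z. \<Sum>R\<in>X. \<Prod>S\<in>T. K R S z)" by (rule sum_mono)
  also have "\<dots> = (\<Sum>R\<in>X. \<Sum>z\<in>\<Union>T \<rightarrow>\<^sub>E Z. \<Prod>S\<in>T. K R S z)" by (rule sum.swap)
  also have "\<dots> \<le> (\<Sum>R\<in>X. (\<Prod>S\<in>T - {R}. A S) * (\<Sum>g\<in>G. l g ^ (\<kappa> R + 1 + M)))"
  proof (rule sum_mono)
    fix R assume "R \<in> X"
    then have R: "R \<in> T" using X by blast
    have cS: "card S > 0" if "S \<in> T" for S using fS that by (simp add: card_gt_0_iff)
    have pw: "l g ^ (card S - 1) * inverse (l g ^ m S) = l g ^ \<kappa> S" if "S \<in> T" "l g > 0" for S g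
    proof -
      have "card S - 1 = \<kappa> S + m S"
        unfolding m_def by (rule le_add_diff_inverse[OF \<kappa>(1)[OF that(1)], symmetric])
      then have "l g ^ (card S - 1) = l g ^ \<kappa> S * l g ^ m S" by (simp only: power_add)
      then show ?thesis using that(2) by simp
    qed
    have lp: "l g > 0" if "inc g a" "a \<in> Z" for g a
      using that Z unfolding l_def by (simp add: card_gt_0_iff) blast
    have "(\<Sum>z\<in>\<Union>T \<rightarrow>\<^sub>E Z. \<Prod>S\<in>T. K R S z) \<le> (\<Prod>S\<in>T - {R}. A S) * (\<Sum>z\<in>R \<rightarrow>\<^sub>E Z. K R R z)"
    proof (rule tree_sum_le[OF tree R Z])
      show "K R S z \<ge> 0" for S z unfolding K_def by (intro sum_nonneg mult_nonneg_nonneg on0) (auto simp: l0)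
      show "K R S (restrict z S) = K R S z" for S z by (simp add: K_def on_def)
      show "A S \<ge> 0" if "S \<in> T" for S using A that .
      fix S v a assume S: "S \<in> T" "S \<noteq> R" "v \<in> S" "a \<in> Z"
      have "(\<Sum>z | z \<in> S \<rightarrow>\<^sub>E Z \<and> z v = a. K R S z)
        = (\<Sum>g\<in>G. (\<Sum>z | z \<in> S \<rightarrow>\<^sub>E Z \<and> z v = a. on S g z) * inverse (l g ^ m S))"
        unfolding K_def using S(2) by (subst sum.swap) (simp add: sum_distrib_right)
      also have "\<dots> = (\<Sum>g\<in>G. of_bool (inc g a) * l g ^ \<kappa> S)"
      proof (rule sum.cong[OF refl])
        fix g
        show "(\<Sum>z | z \<in> S \<rightarrow>\<^sub>E Z \<and> z v = a. on S g z) * inverse (l g ^ m S) = of_bool (inc g a) * l g ^ \<kappa> S"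
          unfolding on_def sum_pinned_incidence[OF fS(1)[OF S(1)] S(3) Z S(4)] l_def[symmetric]
          using pw[OF S(1)] lp[OF _ S(4)] by auto
      qed
      also have "\<dots> = (\<Sum>g\<in>{g\<in>G. inc g a}. l g ^ \<kappa> S)"
        using G by (intro sum.mono_neutral_cong_right) auto
      also have "\<dots> \<le> A S" using pin[OF S(1,4)] by (simp add: l_def)
      finally show "(\<Sum>z | z \<in> S \<rightarrow>\<^sub>E Z \<and> z v = a. K R S z) \<le> A S" .
    qed
    \<comment> \<open>The unpinned root gives \<open>l g ^ card R\<close>; removing its own surplus
      and adding the collected one leaves the exponent \<open>\<kappa> R + 1 + M\<close>.\<close>
    also have "(\<Sum>z\<in>R \<rightarrow>\<^sub>E Z. K R R z) = (\<Sum>g\<in>G. l g ^ (\<kappa> R + 1 + M))"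
    proof -
      have "(\<Sum>z\<in>R \<rightarrow>\<^sub>E Z. K R R z) = (\<Sum>g\<in>G. (\<Sum>z\<in>R \<rightarrow>\<^sub>E Z. on R g z) * (inverse (l g ^ m R) * l g ^ M))"
        unfolding K_def by (subst sum.swap) (simp add: sum_distrib_right)
      also have "\<dots> = (\<Sum>g\<in>G. l g ^ (\<kappa> R + 1 + M))"
      proof (rule sum.cong[OF refl])
        fix g
        have "(\<Sum>z\<in>R \<rightarrow>\<^sub>E Z. on R g z) = l g ^ card R"
          unfolding on_def l_def by (rule sum_incidence[OF fS(1)[OF R] Z])
        also have "\<dots> = l g * l g ^ (card R - 1)" using cS[OF R] by (simp add: power_eq_if)
        finally have e: "(\<Sum>z\<in>R \<rightarrow>\<^sub>E Z. on R g z) * (inverse (l g ^ m R) * l g ^ M)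
           = l g * (l g ^ (card R - 1) * inverse (l g ^ m R)) * l g ^ M" by (simp add: mult_ac)
        show "(\<Sum>z\<in>R \<rightarrow>\<^sub>E Z. on R g z) * (inverse (l g ^ m R) * l g ^ M) = l g ^ (\<kappa> R + 1 + M)"
          unfolding e using pw[OF R, of g] l0[of g]
          by (cases "l g = 0") (auto simp: power_add mult_ac)
      qed
      finally show ?thesis .
    qed
    finally show "(\<Sum>z\<in>\<Union>T \<rightarrow>\<^sub>E Z. \<Prod>S\<in>T. K R S z) \<le> (\<Prod>S\<in>T - {R}. A S) * (\<Sum>g\<in>G. l g ^ (\<kappa> R + 1 + M))" .
  qed
  finally show ?thesis by (simp add: l_def m_def M_def)
qed

section \<open>Counting distance profiles\<close>

lemma card_PiE_image_le:
  assumes "finite A" "finite B" "\<And>x. x \<in> X \<Longrightarrow> f x \<in> A \<rightarrow>\<^sub>E B"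
    and "\<And>x y. \<lbrakk>x \<in> X; y \<in> X; f x = f y\<rbrakk> \<Longrightarrow> h x = h y"
  shows "finite (h ` X) \<and> card (h ` X) \<le> card B ^ card A"
proof -
  have fin: "finite (A \<rightarrow>\<^sub>E B)" using assms by (intro finite_PiE) auto
  have fX: "f ` X \<subseteq> A \<rightarrow>\<^sub>E B" using assms(3) by blast
  define r where "r y = h (SOME x. x \<in> X \<and> f x = y)" for y
  have "h x = r (f x)" if "x \<in> X" for x
  proof -
    have "(SOME x'. x' \<in> X \<and> f x' = f x) \<in> X \<and> f (SOME x'. x' \<in> X \<and> f x' = f x) = f x"
      by (rule someI[of _ x]) (simp add: that)
    then show ?thesis unfolding r_def using assms(4) that by metis
  qed
  then have "h ` X \<subseteq> r ` (A \<rightarrow>\<^sub>E B)" using fX by blast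
  then have sub: "h ` X \<subseteq> r ` (A \<rightarrow>\<^sub>E B)" .
  have "card (A \<rightarrow>\<^sub>E B) = card B ^ card A" using assms(1) by (simp add: card_PiE)
  then show ?thesis
    using finite_subset[OF sub finite_imageI[OF fin]] surj_card_le[OF fin sub] by simp
qed

text \<open>These are the independent entries of r rows of a symmetric n by n matrix: a rectangle
  against the remaining indices and a triangle within \<open>I\<close>.\<close>

lemma card_data_pairs:
  assumes "I \<subseteq> {..<n}" "card I = r"
  shows "card {(i, l). i \<in> I \<and> l < n \<and> (l \<in> I \<longrightarrow> i \<le> l)} = r * (n - r) + r * (r + 1) div 2"
proof -
  have fI: "finite I" using assms finite_subset by blast
  have *: "card {(i, l). i \<in> I \<and> l \<in> I \<and> i \<le> l} = card I * (card I + 1) div 2" if "finite I" for I :: "nat set"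
    using that
  proof (induction rule: finite_linorder_max_induct)
    case (insert b A)
    have eq: "{(i, l). i \<in> insert b A \<and> l \<in> insert b A \<and> i \<le> l}
      = {(i, l). i \<in> A \<and> l \<in> A \<and> i \<le> l} \<union> (\<lambda>i. (i, b)) ` insert b A"
      using insert by fastforce
    have "card {(i, l). i \<in> insert b A \<and> l \<in> insert b A \<and> i \<le> l}
      = card {(i, l). i \<in> A \<and> l \<in> A \<and> i \<le> l} + card ((\<lambda>i. (i, b)) ` insert b A)"
      unfolding eq
    proof (rule card_Un_disjoint)
      show "finite {(i, l). i \<in> A \<and> l \<in> A \<and> i \<le> l}"
        by (rule finite_subset[of _ "A \<times> A"]) (use insert in auto)
      show "{(i, l). i \<in> A \<and> l \<in> A \<and> i \<le> l} \<inter> (\<lambda>i. (i, b)) ` insert b A = {}"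
        using insert by fastforce
    qed (use insert in auto)
    also have "card ((\<lambda>i. (i, b)) ` insert b A) = card A + 1"
      using insert by (subst card_image) (auto simp: inj_on_def)
    finally show ?case using insert by (auto simp: insert.IH)
  qed simp
  have eq: "{(i, l). i \<in> I \<and> l < n \<and> (l \<in> I \<longrightarrow> i \<le> l)}
      = I \<times> ({..<n} - I) \<union> {(i, l). i \<in> I \<and> l \<in> I \<and> i \<le> l}"
    using assms by auto
  have "card {(i, l). i \<in> I \<and> l < n \<and> (l \<in> I \<longrightarrow> i \<le> l)}
      = card (I \<times> ({..<n} - I)) + card {(i, l). i \<in> I \<and> l \<in> I \<and> i \<le> l}"
    unfolding eq
  proof (rule card_Un_disjoint)
    show "finite {(i, l). i \<in> I \<and> l \<in> I \<and> i \<le> l}"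
      by (rule finite_subset[of _ "I \<times> I"]) (use fI in auto)
  qed (use fI in auto)
  then show ?thesis using *[OF fI] assms fI
    by (simp add: card_cartesian_product card_Diff_subset)
qed

text \<open>The same balance as in \<open>sum_exponents\<close>, indexed by the number r of
  differences: orbit dimensions and independent Gram entries add up to d per difference.\<close>

lemma sum_dimension_drop:
  fixes r d :: nat
  assumes "r \<le> d"
  shows "(\<Sum>i<r. d - 1 - i) + r * (r + 1) div 2 = d * r"
  using assms
proof (induction r)
  case (Suc r)
  have "Suc r * (Suc r + 1) div 2 = r * (r + 1) div 2 + (r + 1)" by simp
  then show ?case using Suc by simp
qed simp

context quadratic_space
begin

section \<open>Gram matrices of bounded rank\<close>

definition comb :: "nat set \<Rightarrow> (nat \<Rightarrow> 'v) \<Rightarrow> (nat \<Rightarrow> 'a) \<Rightarrow> 'v" where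
  "comb I b c = (\<Sum>i\<in>I. sc (c i) (b i))"

lemma dt_comb: "dt (comb I b c) w = (\<Sum>i\<in>I. c i * dt (b i) w)"
  unfolding comb_def by (induction I rule: infinite_finite_induct) (simp_all add: dt_linear)

lemma comb_V:
  assumes "\<And>i. i \<in> I \<Longrightarrow> b i \<in> V" "\<And>i. i \<in> I \<Longrightarrow> c i \<in> K"
  shows "comb I b c \<in> V"
  using assms unfolding comb_def by (induction I rule: infinite_finite_induct) auto

lemma V_eqI:
  assumes "u \<in> V" "v \<in> V" "\<And>w. w \<in> V \<Longrightarrow> dt u w = dt v w"
  shows "u = v"
  using nondeg[of "u - v"] assms by (simp add: dt_linear)

text \<open>A maximal independent index set spans, because adding an index creates a relation with
  nonzero coefficient there. It has at most d elements, since its combinations are distinct points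
  of \<open>V\<close>.\<close>

lemma small_spanning_set:
  assumes b: "\<And>j. j < n \<Longrightarrow> b j \<in> V"
  shows "\<exists>I\<subseteq>{..<n}. card I = min n d \<and> (\<forall>j<n. \<exists>c. (\<forall>i\<in>I. c i \<in> K) \<and> b j = comb I b c)"
proof -
  define ind where "ind I \<longleftrightarrow> inj_on (comb I b) (I \<rightarrow>\<^sub>E K)" for I
  define F where "F = {I. I \<subseteq> {..<n} \<and> ind I}"
  have "finite F" by (auto simp: F_def)
  moreover have "{} \<in> F" by (simp add: F_def ind_def)
  ultimately obtain I where I: "I \<in> F" and max: "\<And>I'. I' \<in> F \<Longrightarrow> I \<subseteq> I' \<Longrightarrow> I' = I"
    using finite_has_maximal[of F] by blast
  have In: "I \<subseteq> {..<n}" and iI: "ind I" using I by (auto simp: F_def)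
  have fI: "finite I" using In finite_subset by blast
  have "card (I \<rightarrow>\<^sub>E K) \<le> card V"
    using iI In b finV unfolding ind_def
    by (intro card_inj_on_le) (auto intro!: comb_V)
  then have "q ^ card I \<le> q ^ d" using fI by (simp add: card_PiE cardK cardV)
  then have cI: "card I \<le> min n d" using card_mono[OF _ In] q5 by (simp add: power_increasing_iff)
  have span: "\<exists>c. (\<forall>i\<in>I. c i \<in> K) \<and> b j = comb I b c" if j: "j < n" for j
  proof (cases "j \<in> I")
    case True
    have "b j = comb I b (\<lambda>i. if i = j then e else 0)"
    proof (rule V_eqI)
      show "comb I b (\<lambda>i. if i = j then e else 0) \<in> V" using b In by (intro comb_V) auto
      fix w assume "w \<in> V"
      then have "dt (comb I b (\<lambda>i. if i = j then e else 0)) w = (\<Sum>i\<in>I. if i = j then dt (b i) w else 0)"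
        unfolding dt_comb using b In by (intro sum.cong) auto
      then show "dt (b j) w = dt (comb I b (\<lambda>i. if i = j then e else 0)) w"
        using True fI by simp
    qed (use b j in simp)
    then show ?thesis by (intro exI[of _ "\<lambda>i. if i = j then e else 0"]) auto
  next
    case False
    have "insert j I \<notin> F" using max[of "insert j I"] False by blast
    then have "\<not> ind (insert j I)" using In j by (simp add: F_def)
    then obtain c c' where c: "c \<in> insert j I \<rightarrow>\<^sub>E K" "c' \<in> insert j I \<rightarrow>\<^sub>E K" "c \<noteq> c'"
      "comb (insert j I) b c = comb (insert j I) b c'"
      unfolding ind_def inj_on_def by blast
    have cK: "c i \<in> K" "c' i \<in> K" if "i \<in> insert j I" for i using c that by (auto intro: PiE_mem)
    define \<delta> where "\<delta> i = c i - c' i" for i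
    have dK: "\<delta> i \<in> K" if "i \<in> insert j I" for i using cK[OF that] by (simp add: \<delta>_def)
    have rel: "\<delta> j * dt (b j) w + (\<Sum>i\<in>I. \<delta> i * dt (b i) w) = 0" for w
    proof -
      have "(\<Sum>i\<in>insert j I. c i * dt (b i) w) = (\<Sum>i\<in>insert j I. c' i * dt (b i) w)"
        using c(4) by (simp only: dt_comb[symmetric])
      then have "(\<Sum>i\<in>insert j I. \<delta> i * dt (b i) w) = 0"
        by (simp add: \<delta>_def left_diff_distrib sum_subtractf)
      then show ?thesis using False fI by simp
    qed
    have "\<delta> j \<noteq> 0"
    proof
      assume d0: "\<delta> j = 0"
      have "comb I b (restrict c I) = comb I b (restrict c' I)"
      proof (rule V_eqI)
        fix w
        have "(\<Sum>i\<in>I. c i * dt (b i) w) - (\<Sum>i\<in>I. c' i * dt (b i) w) = 0"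
          using rel[of w] d0 by (simp add: \<delta>_def left_diff_distrib sum_subtractf)
        then show "dt (comb I b (restrict c I)) w = dt (comb I b (restrict c' I)) w"
          by (simp add: dt_comb)
      qed (use b In cK in \<open>auto intro!: comb_V\<close>)
      then have "restrict c I = restrict c' I"
        using iI cK unfolding ind_def by (auto dest!: inj_onD)
      then have "c i = c' i" if "i \<in> I" for i using that by (metis restrict_apply')
      moreover have "c j = c' j" using d0 by (simp add: \<delta>_def)
      ultimately have "c = c'" using c(1,2) by (intro PiE_ext) auto
      then show False using c(3) by simp
    qed
    then obtain r where r: "r \<in> K" "\<delta> j * r = e" using inverse_ex dK by blast
    have "b j = comb I b (\<lambda>i. - (r * \<delta> i))"
    proof (rule V_eqI)
      show "comb I b (\<lambda>i. - (r * \<delta> i)) \<in> V" using b In r dK by (intro comb_V) auto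
      fix w assume w: "w \<in> V"
      have "dt (b j) w = (\<delta> j * r) * dt (b j) w" using r b j w by simp
      also have "\<dots> = r * (\<delta> j * dt (b j) w)" by (simp add: mult_ac)
      also have "\<delta> j * dt (b j) w = - (\<Sum>i\<in>I. \<delta> i * dt (b i) w)"
        using rel[of w] by (simp add: eq_neg_iff_add_eq_0)
      also have "r * - (\<Sum>i\<in>I. \<delta> i * dt (b i) w) = dt (comb I b (\<lambda>i. - (r * \<delta> i))) w"
        by (simp add: dt_comb sum_distrib_left sum_negf mult.assoc)
      finally show "dt (b j) w = dt (comb I b (\<lambda>i. - (r * \<delta> i))) w" .
    qed (use b j in simp)
    then show ?thesis using r dK by (intro exI[of _ "\<lambda>i. - (r * \<delta> i)"]) auto
  qed
  \<comment> \<open>Enlarging to exactly \<open>min n d\<close> indices keeps the spanning property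
    and makes the amount of Gram data the same for every configuration.\<close>
  obtain I' where I': "I \<subseteq> I'" "I' \<subseteq> {..<n}" "card I' = min n d"
    using exists_subset_between[of I "min n d" "{..<n}"] cI In by auto
  have fI': "finite I'" using I' finite_subset by blast
  have "\<exists>c. (\<forall>i\<in>I'. c i \<in> K) \<and> b j = comb I' b c" if jn: "j < n" for j
  proof -
    obtain c where c: "\<forall>i\<in>I. c i \<in> K" "b j = comb I b c" using span[OF jn] by blast
    have "b j = comb I' b (\<lambda>i. if i \<in> I then c i else 0)"
    proof (rule V_eqI)
      show "comb I' b (\<lambda>i. if i \<in> I then c i else 0) \<in> V" using b I' c by (intro comb_V) auto
      fix w
      show "dt (b j) w = dt (comb I' b (\<lambda>i. if i \<in> I then c i else 0)) w"
        unfolding c(2) dt_comb using I' fI' by (intro sum.mono_neutral_cong_left) auto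
    qed (use b jn in simp)
    then show ?thesis using c by (intro exI[of _ "\<lambda>i. if i \<in> I then c i else 0"]) auto
  qed
  then show ?thesis using I' by blast
qed

text \<open>
  The Gram matrix is determined by the rows of a spanning subset: both configurations express
  the remaining rows by combinations, and symmetry makes the two expressions agree.
\<close>

lemma gram_determined:
  assumes b: "\<And>j. j < n \<Longrightarrow> \<exists>c. b j = comb I b c" and b': "\<And>j. j < n \<Longrightarrow> \<exists>c. b' j = comb I b' c"
    and I: "I \<subseteq> {..<n}" and eq: "\<And>i l. i \<in> I \<Longrightarrow> l < n \<Longrightarrow> dt (b i) (b l) = dt (b' i) (b' l)"
    and j: "j < n" "l < n"
  shows "dt (b j) (b l) = dt (b' j) (b' l)"
proof -
  obtain c where c: "b j = comb I b c" using b j by blast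
  obtain c' where c': "b' j = comb I b' c'" using b' j by blast
  obtain x where x: "b l = comb I b x" using b j by blast
  have 1: "dt (b j) (b m) = (\<Sum>i\<in>I. c i * dt (b i) (b m))" for m unfolding c dt_comb ..
  have 2: "dt (b' j) (b' m) = (\<Sum>i\<in>I. c' i * dt (b i) (b m))" if "m < n" for m
    unfolding c' dt_comb using eq that by simp
  have 3: "dt (b k) (b l) = (\<Sum>i\<in>I. x i * dt (b k) (b i))" for k
    using arg_cong[OF x, of "\<lambda>u. dt u (b k)"] by (simp add: dt_comb dt_commute[of "b k"])
  \<comment> \<open>In columns from \<open>I\<close> both expansions of row j give the same entries,
    by symmetry; column l is a combination of these with coefficients \<open>x\<close>.\<close>
  have 4: "(\<Sum>i\<in>I. c i * dt (b i) (b m)) = (\<Sum>i\<in>I. c' i * dt (b i) (b m))" if "m \<in> I" for m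
  proof -
    have m: "m < n" using that I by blast
    have "dt (b j) (b m) = dt (b' j) (b' m)" using eq[OF that j(1)] by (simp add: dt_commute)
    then show ?thesis using 1 2[OF m] by simp
  qed
  have "dt (b j) (b l) = (\<Sum>i\<in>I. c i * dt (b i) (b l))" by (rule 1)
  also have "\<dots> = (\<Sum>i\<in>I. c i * (\<Sum>m\<in>I. x m * dt (b i) (b m)))" unfolding 3 ..
  also have "\<dots> = (\<Sum>m\<in>I. x m * (\<Sum>i\<in>I. c i * dt (b i) (b m)))"
    unfolding sum_distrib_left by (subst sum.swap) (simp add: mult_ac)
  also have "\<dots> = (\<Sum>m\<in>I. x m * (\<Sum>i\<in>I. c' i * dt (b i) (b m)))" using 4 by simp
  also have "\<dots> = (\<Sum>i\<in>I. c' i * (\<Sum>m\<in>I. x m * dt (b i) (b m)))"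
    unfolding sum_distrib_left by (subst sum.swap) (simp add: mult_ac)
  also have "\<dots> = (\<Sum>i\<in>I. c' i * dt (b i) (b l))" unfolding 3 ..
  also have "\<dots> = dt (b' j) (b' l)" by (rule 2[OF j(2), symmetric])
  finally show ?thesis .
qed

definition prof :: "'w set \<Rightarrow> ('w \<Rightarrow> 'v) \<Rightarrow> 'w \<times> 'w \<Rightarrow> 'a" where
  "prof S p = restrict (\<lambda>(u, v). Q (p u - p v)) (S \<times> S)"

lemma prof_eq_iff: "prof S p = prof S p' \<longleftrightarrow> (\<forall>u\<in>S. \<forall>v\<in>S. Q (p u - p v) = Q (p' u - p' v))"
  by (auto simp: prof_def fun_eq_iff)

text \<open>Seen from a base vertex, the distances are equivalent to the Gram matrix of n
  differences, and \<open>min n d\<close> of its rows determine it. The 2^n bounds the choices of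
  rows. The power of q on the left is the orbit dimension that reappears in
  \<open>card_transporters\<close>.\<close>

lemma card_profiles_le:
  fixes S :: "'w set"
  assumes S: "finite S" "S \<noteq> {}" and n: "n = card S - 1"
  shows "finite (prof S ` (S \<rightarrow>\<^sub>E V)) \<and>
    card (prof S ` (S \<rightarrow>\<^sub>E V)) * q ^ (\<Sum>i<min n d. d - 1 - i) \<le> 2 ^ n * q ^ (d * n)"
proof -
  obtain x where x: "x \<in> S" using S by blast
  have "card (S - {x}) = n" using S x n by simp
  then obtain f where f: "bij_betw f {..<n} (S - {x})"
    using S by (metis finite_Diff ex_bij_betw_nat_finite atLeast0LessThan)
  define r where "r = min n d"
  define b where "b p j = p (f j) - p x" for p :: "'w \<Rightarrow> 'v" and j
  have fS: "f j \<in> S" if "j < n" for j using f that by (auto simp: bij_betw_def)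
  have bV: "b p j \<in> V" if "p \<in> S \<rightarrow>\<^sub>E V" "j < n" for p j
    using that fS x by (auto simp: b_def intro!: V_diff intro: PiE_mem)
  define sp where "sp I p \<longleftrightarrow> (\<forall>j<n. \<exists>c. (\<forall>i\<in>I. c i \<in> K) \<and> b p j = comb I (b p) c)" for I p
  define Is where "Is = {I. I \<subseteq> {..<n} \<and> card I = r}"
  define D where "D I = {(i, l). i \<in> I \<and> l < n \<and> (l \<in> I \<longrightarrow> i \<le> l)}" for I
  define X where "X I = {p\<in>S \<rightarrow>\<^sub>E V. sp I p}" for I
  have part: "finite (prof S ` X I) \<and> card (prof S ` X I) \<le> q ^ (r * (n - r) + r * (r + 1) div 2)"
    if I: "I \<in> Is" for I
  proof -
    have In: "I \<subseteq> {..<n}" and cI: "card I = r" using I by (auto simp: Is_def)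
    have fD: "finite (D I)" by (rule finite_subset[of _ "{..<n} \<times> {..<n}"]) (use In in \<open>auto simp: D_def\<close>)
    have "finite (prof S ` X I) \<and> card (prof S ` X I) \<le> card K ^ card (D I)"
    proof (rule card_PiE_image_le[OF fD finK, of "X I" "\<lambda>p. restrict (\<lambda>(i, l). dt (b p i) (b p l)) (D I)"])
      fix p assume p: "p \<in> X I"
      show "restrict (\<lambda>(i, l). dt (b p i) (b p l)) (D I) \<in> D I \<rightarrow>\<^sub>E K"
        using p bV In by (auto simp: X_def D_def)
    next
      fix p p' assume p: "p \<in> X I" "p' \<in> X I"
        and eq: "restrict (\<lambda>(i, l). dt (b p i) (b p l)) (D I) = restrict (\<lambda>(i, l). dt (b p' i) (b p' l)) (D I)"
      have e1: "dt (b p i) (b p l) = dt (b p' i) (b p' l)" if "(i, l) \<in> D I" for i l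
        using fun_cong[OF eq, of "(i, l)"] that by simp
      have e2: "dt (b p i) (b p l) = dt (b p' i) (b p' l)" if "i \<in> I" "l < n" for i l
      proof (cases "l \<in> I \<longrightarrow> i \<le> l")
        case True
        then show ?thesis using e1 that by (simp add: D_def)
      next
        case False
        then have "(l, i) \<in> D I" using that In by (auto simp: D_def)
        then show ?thesis using e1 dt_commute by metis
      qed
      have e3: "dt (b p i) (b p l) = dt (b p' i) (b p' l)" if "i < n" "l < n" for i l
        by (rule gram_determined[OF _ _ In e2 that]) (use p in \<open>auto simp: X_def sp_def\<close>)
      have "Q (p u - p v) = Q (p' u - p' v)" if uv: "u \<in> S" "v \<in> S" for u v
      proof -
        have idx: "u = x \<or> (\<exists>i<n. u = f i)" if "u \<in> S" for u
          using f that by (auto simp: bij_betw_def)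
        have Qx: "Q (p u - p x) = Q (p' u - p' x)" if "u \<in> S" for u
          using idx[OF that] e3 by (auto simp: Q_def b_def)
        have D: "dt (p u - p x) (p v - p x) = dt (p' u - p' x) (p' v - p' x)"
          using idx[OF uv(1)] idx[OF uv(2)] e3 by (auto simp: b_def)
        have "Q (p u - p v) = Q (p u - p x) + Q (p v - p x) - 2 * dt (p u - p x) (p v - p x)" for p
          by (simp add: Q_dt)
        then show ?thesis using Qx[OF uv(1)] Qx[OF uv(2)] D by metis
      qed
      then show "prof S p = prof S p'" by (simp add: prof_eq_iff)
    qed
    moreover have "card (D I) = r * (n - r) + r * (r + 1) div 2"
      unfolding D_def by (rule card_data_pairs[OF In cI])
    ultimately show ?thesis by (simp add: cardK)
  qed
  have fIs: "finite Is" by (rule finite_subset[of _ "Pow {..<n}"]) (auto simp: Is_def)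
  have cover: "prof S ` (S \<rightarrow>\<^sub>E V) = (\<Union>I\<in>Is. prof S ` X I)"
  proof -
    have "\<exists>I\<in>Is. p \<in> X I" if p: "p \<in> S \<rightarrow>\<^sub>E V" for p
    proof -
      have "\<exists>I\<subseteq>{..<n}. card I = min n d \<and> (\<forall>j<n. \<exists>c. (\<forall>i\<in>I. c i \<in> K) \<and> b p j = comb I (b p) c)"
        by (rule small_spanning_set) (rule bV[OF p])
      then obtain I where I: "I \<subseteq> {..<n}" "card I = min n d"
          "\<forall>j<n. \<exists>c. (\<forall>i\<in>I. c i \<in> K) \<and> b p j = comb I (b p) c"
        by (elim exE conjE)
      then have "I \<in> Is" "p \<in> X I" using p by (simp_all add: Is_def X_def sp_def r_def)
      then show ?thesis by (rule bexI[rotated])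
    qed
    then have "S \<rightarrow>\<^sub>E V \<subseteq> (\<Union>I\<in>Is. X I)" by (intro subsetI) (simp only: UN_iff)
    moreover have "(\<Union>I\<in>Is. X I) \<subseteq> S \<rightarrow>\<^sub>E V" by (auto simp: X_def)
    ultimately have "S \<rightarrow>\<^sub>E V = (\<Union>I\<in>Is. X I)" by (rule subset_antisym)
    then show ?thesis by (simp only: image_UN)
  qed
  have "card (prof S ` (S \<rightarrow>\<^sub>E V)) \<le> (\<Sum>I\<in>Is. card (prof S ` X I))"
    unfolding cover by (rule card_UN_le[OF fIs])
  also have "\<dots> \<le> (\<Sum>I\<in>Is. q ^ (r * (n - r) + r * (r + 1) div 2))"
    using part by (intro sum_mono) auto
  also have "\<dots> \<le> 2 ^ n * q ^ (r * (n - r) + r * (r + 1) div 2)"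
  proof -
    have "card Is \<le> card (Pow {..<n})" by (rule card_mono) (auto simp: Is_def)
    then show ?thesis by (simp add: card_Pow)
  qed
  finally have "card (prof S ` (S \<rightarrow>\<^sub>E V)) * q ^ (\<Sum>i<r. d - 1 - i)
     \<le> 2 ^ n * q ^ (r * (n - r) + r * (r + 1) div 2) * q ^ (\<Sum>i<r. d - 1 - i)"
    by (rule mult_le_mono1)
  also have "\<dots> = 2 ^ n * q ^ (r * (n - r) + ((\<Sum>i<r. d - 1 - i) + r * (r + 1) div 2))"
    by (simp add: power_add mult_ac)
  also have "(\<Sum>i<r. d - 1 - i) + r * (r + 1) div 2 = d * r"
    by (rule sum_dimension_drop) (simp add: r_def)
  also have "r * (n - r) + d * r = d * n"
  proof (cases "n \<le> d")
    case True then show ?thesis by (simp add: r_def)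
  next
    case False
    then have "d * (n - d) + d * d = d * n" by (simp add: distrib_left[symmetric])
    then show ?thesis using False by (simp add: r_def)
  qed
  finally show ?thesis using cover fIs part by (auto simp: r_def)
qed

lemma congr_map:
  assumes "\<And>u v. u \<in> set l \<Longrightarrow> v \<in> set l \<Longrightarrow> Q (p u - p v) = Q (p' u - p' v)"
  shows "congr (map p l) (map p' l)"
  using assms
proof (induction l)
  case (Cons u l)
  then show ?case by (auto simp: list_all2_map1 list_all2_map2 list_all2_same)
qed simp

text \<open>A missing anisotropic vector is blamed on the earlier entry whose addition destroyed it,
  which has position at least 1 because \<open>generic\<close> puts no condition on the complement
  of the whole list. Recording \<open>i > 0\<close> saves a factor \<open>q\<close> when bad tuples
  are counted.\<close>

lemma not_generic_step:
  assumes "\<not> generic bs"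
  shows "\<exists>i<length bs. generic (drop (Suc i) bs) \<and> (\<exists>w\<in>perp (set (drop (Suc i) bs)). Q w \<noteq> 0) \<and>
    (bs ! i \<in> perp (perp (set (drop (Suc i) bs))) \<or>
     i > 0 \<and> bs ! i \<notin> perp (perp (set (drop (Suc i) bs))) \<and> (\<forall>w\<in>perp (set (bs ! i # drop (Suc i) bs)). Q w = 0))"
  using assms
proof (induction bs)
  case (Cons b bs)
  show ?case
  proof (cases "generic bs")
    case False
    from Cons.IH[OF False] obtain i where "i < length bs" "generic (drop (Suc i) bs)"
      "\<exists>w\<in>perp (set (drop (Suc i) bs)). Q w \<noteq> 0"
      "bs ! i \<in> perp (perp (set (drop (Suc i) bs))) \<or>
       bs ! i \<notin> perp (perp (set (drop (Suc i) bs))) \<and> (\<forall>w\<in>perp (set (bs ! i # drop (Suc i) bs)). Q w = 0)"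
      by blast
    then show ?thesis by (intro exI[of _ "Suc i"]) auto
  next
    case True
    show ?thesis
    proof (cases "\<exists>w\<in>perp (set bs). Q w \<noteq> 0")
      case Qw: True
      then show ?thesis using Cons.prems True by (intro exI[of _ 0]) auto
    next
      case False
      have "bs \<noteq> []" using False anisotropic_ex[of "[]"] d2 by auto
      then obtain b' bs' where bs: "bs = b' # bs'" by (cases bs) auto
      \<comment> \<open>With \<open>b\<close> in front, index 1 is \<open>b'\<close>, the vector
        added last to form \<open>bs\<close>.\<close>
      then show ?thesis using True False by (intro exI[of _ 1]) auto
    qed
  qed
qed simp

end

section \<open>Positive proportion in a quadratic space\<close>

text \<open>The constants of \<open>lam_pinned\<close> with A = 16 for all positive exponents up to
  k, summed; the 1 covers exponent 0. The 16 arises because pruning bounds degrees by 4|E|^2/q and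
  |E| is at most twice the size of the pruned set.\<close>

definition pin_const :: "nat \<Rightarrow> real" where
  "pin_const k = 1 + (\<Sum>j<k. 6 ^ Suc j * 2 ^ (j * (j + 2)) * real (j + 1) * 16 ^ Suc j + 2 ^ Suc j)"

lemma pin_const_ge: "pin_const k \<ge> 1"
  unfolding pin_const_def by (simp add: sum_nonneg)

context quadratic_space
begin

text \<open>All vertices are fixed except the one at which genericity breaks. Its bad positions
  either depend on the points following it in the list, at most q^(length s) of them, or leave a
  totally isotropic complement, at most 2q^(length s + 1). The second kind occurs only for i > 0,
  which keeps it within 2q^(length cs - 1).\<close>

lemma card_not_generic:
  assumes U: "finite U" "v0 \<in> U" "set cs \<subseteq> U" "distinct (v0 # cs)" and E: "E \<subseteq> V"
  shows "card {p\<in>U \<rightarrow>\<^sub>E E. \<not> generic (diffs (p v0) (map p cs))}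
    \<le> length cs * (3 * q ^ (length cs - 1) * card E ^ (card U - 1))"
proof -
  have fE: "finite E" using E finV finite_subset by blast
  define suf where "suf p i = diffs (p v0) (map p (drop (Suc i) cs))" for p i
  define pt where "pt p i = p (cs ! i) - p v0" for p :: "'b \<Rightarrow> 'v" and i
  define bad where "bad i s b \<longleftrightarrow> generic s \<and> (\<exists>w\<in>perp (set s). Q w \<noteq> 0) \<and>
    (b \<in> perp (perp (set s)) \<or> i > (0::nat) \<and> b \<notin> perp (perp (set s)) \<and> (\<forall>w\<in>perp (set (b # s)). Q w = 0))" for i s b
  define P where "P i = {p\<in>U \<rightarrow>\<^sub>E E. bad i (suf p i) (pt p i)}" for i
  have fUE: "finite (U \<rightarrow>\<^sub>E E)" using U fE by (intro finite_PiE) auto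
  have cP: "card (P i) \<le> 3 * q ^ (length cs - 1) * card E ^ (card U - 1)" if i: "i < length cs" for i
  proof (rule card_fibrewise_le[OF U(1) _ fE])
    show vU: "cs ! i \<in> U" using U i by (meson nth_mem subsetD)
    show "P i \<subseteq> U \<rightarrow>\<^sub>E E" by (auto simp: P_def)
    fix y assume y: "y \<in> (U - {cs ! i}) \<rightarrow>\<^sub>E E"
    have v0: "v0 \<noteq> cs ! i" using U(4) i by auto
    have nd: "cs ! i \<notin> set (drop (Suc i) cs)"
      using U(4) i by (auto simp: in_set_conv_nth nth_eq_iff_index_eq)
    define x where "x = y v0"
    define s where "s = diffs x (map y (drop (Suc i) cs))"
    have yE: "y v \<in> E" if "v \<in> U" "v \<noteq> cs ! i" for v using y that by (auto intro: PiE_mem)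
    have xV: "x \<in> V" using yE[OF U(2) v0] E by (auto simp: x_def)
    have sub: "y ` set (drop (Suc i) cs) \<subseteq> V"
      using yE nd U(3) E set_drop_subset[of "Suc i" cs] by fastforce
    have sV: "set s \<subseteq> V" using sub xV by (auto simp: s_def)
    have ls: "length s = length cs - Suc i" by (simp add: s_def)
    have "card {a\<in>E. y(cs ! i := a) \<in> P i} \<le> card {b\<in>V. bad i s b}"
    proof (rule card_inj_on_le[where f = "\<lambda>a. a - x"])
      show "(\<lambda>a. a - x) ` {a\<in>E. y(cs ! i := a) \<in> P i} \<subseteq> {b\<in>V. bad i s b}"
      proof
        fix b assume "b \<in> (\<lambda>a. a - x) ` {a\<in>E. y(cs ! i := a) \<in> P i}"
        then obtain a where a: "a \<in> E" "y(cs ! i := a) \<in> P i" "b = a - x" by blast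
        have "map (y(cs ! i := a)) (drop (Suc i) cs) = map y (drop (Suc i) cs)"
          using nd by (intro map_cong) auto
        then have "suf (y(cs ! i := a)) i = s" using v0 by (simp only: suf_def s_def x_def fun_upd_other[OF v0])
        moreover have "pt (y(cs ! i := a)) i = b" using v0 a by (simp add: pt_def x_def)
        ultimately show "b \<in> {b\<in>V. bad i s b}" using a xV E by (auto simp: P_def)
      qed
    qed (use finV in \<open>auto simp: inj_on_def\<close>)
    also have "\<dots> \<le> 3 * q ^ (length cs - 1)"
    proof (cases "generic s \<and> (\<exists>w\<in>perp (set s). Q w \<noteq> 0)")
      case False
      then have "{b\<in>V. bad i s b} = {}" by (auto simp: bad_def)
      then show ?thesis by (simp only: card.empty zero_le)
    next
      case True
      then obtain w0 where g: "generic s" and w0: "w0 \<in> perp (set s)" "Q w0 \<noteq> 0" by blast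
      have fP: "finite (perp (perp (set s)))" by (rule finite_subspace[OF subspace_perp])
      have c1: "card (perp (perp (set s))) \<le> q ^ (length cs - 1)"
      proof -
        have "card (perp (perp (set s))) \<le> q ^ length s" using card_perp_generic[OF g sV] by simp
        also have "\<dots> \<le> q ^ (length cs - 1)" using ls q5 by (intro power_increasing) auto
        finally show ?thesis .
      qed
      show ?thesis
      proof (cases "i = 0")
        case True
        then have "{b\<in>V. bad i s b} \<subseteq> perp (perp (set s))" by (auto simp: bad_def)
        then have "card {b\<in>V. bad i s b} \<le> card (perp (perp (set s)))" by (rule card_mono[OF fP])
        then show ?thesis using c1 by simp
      next
        case False
        let ?B = "{b\<in>V. b \<notin> perp (perp (set s)) \<and> (\<forall>w\<in>perp (set (b # s)). Q w = 0)}"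
        have "{b\<in>V. bad i s b} \<subseteq> perp (perp (set s)) \<union> ?B" unfolding bad_def by blast
        then have "card {b\<in>V. bad i s b} \<le> card (perp (perp (set s)) \<union> ?B)"
          using fP finV by (intro card_mono) auto
        also have "\<dots> \<le> card (perp (perp (set s))) + card ?B" by (rule card_Un_le)
        also have "card ?B \<le> 2 * q ^ Suc (length s)" by (rule card_isotropic_next[OF g sV w0])
        also have "2 * q ^ Suc (length s) \<le> 2 * q ^ (length cs - 1)"
          using ls i False q5 by (intro mult_le_mono2 power_increasing) auto
        finally show ?thesis using c1 by simp
      qed
    qed
    finally show "card {a\<in>E. y(cs ! i := a) \<in> P i} \<le> 3 * q ^ (length cs - 1)" .
  qed
  have "{p\<in>U \<rightarrow>\<^sub>E E. \<not> generic (diffs (p v0) (map p cs))} \<subseteq> (\<Union>i\<in>{..<length cs}. P i)"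
  proof
    fix p assume p: "p \<in> {p\<in>U \<rightarrow>\<^sub>E E. \<not> generic (diffs (p v0) (map p cs))}"
    then have "\<not> generic (diffs (p v0) (map p cs))" by simp
    from not_generic_step[OF this] have "\<exists>i<length (diffs (p v0) (map p cs)).
        bad i (drop (Suc i) (diffs (p v0) (map p cs))) (diffs (p v0) (map p cs) ! i)"
      unfolding bad_def .
    then obtain i where i0: "i < length (diffs (p v0) (map p cs))"
      and i1: "bad i (drop (Suc i) (diffs (p v0) (map p cs))) (diffs (p v0) (map p cs) ! i)" by blast
    have i: "i < length cs" using i0 by simp
    note i i1
    moreover have "drop (Suc i) (diffs (p v0) (map p cs)) = suf p i"
      by (simp add: suf_def drop_map)
    moreover have "diffs (p v0) (map p cs) ! i = pt p i" using i by (simp add: pt_def)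
    ultimately show "p \<in> (\<Union>i\<in>{..<length cs}. P i)" using p by (auto simp: P_def)
  qed
  then have "card {p\<in>U \<rightarrow>\<^sub>E E. \<not> generic (diffs (p v0) (map p cs))} \<le> card (\<Union>i\<in>{..<length cs}. P i)"
    by (rule card_mono[rotated]) (use fUE in \<open>auto simp: P_def\<close>)
  also have "\<dots> \<le> (\<Sum>i\<in>{..<length cs}. card (P i))" by (rule card_UN_le) simp
  also have "\<dots> \<le> (\<Sum>i\<in>{..<length cs}. 3 * q ^ (length cs - 1) * card E ^ (card U - 1))"
    using cP by (intro sum_mono) auto
  finally show ?thesis by simp
qed

text \<open>Witt's theorem matches the base vertex and the vertices of \<open>cs\<close>; if the
  simplex has dimension above d, the remaining vertices follow by \<open>fixers_far\<close>. What is
  counted contains a coset of a stabilizer whose order is bounded below.\<close>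

lemma card_transporters:
  assumes S: "set (v0 # cs) \<subseteq> S" and r: "length cs = min (card S - 1) d" "card S - 1 \<le> d \<Longrightarrow> S = set (v0 # cs)"
    and p: "\<And>v. v \<in> S \<Longrightarrow> p v \<in> V" "\<And>v. v \<in> S \<Longrightarrow> p' v \<in> V"
    and gen: "generic (diffs (p v0) (map p cs))" "generic (diffs (p' v0) (map p' cs))"
    and eq: "prof S p = prof S p'"
  shows "stab0 \<le> 2 ^ length cs * real q ^ (\<Sum>i<length cs. d - 1 - i) * real (card {g\<in>isoms. \<forall>v\<in>S. g (p v) = p' v})"
proof -
  have eq': "Q (p u - p v) = Q (p' u - p' v)" if "u \<in> S" "v \<in> S" for u v
    using eq that by (simp add: prof_eq_iff)
  have V: "p v0 \<in> V" "p' v0 \<in> V" "set (map p cs) \<subseteq> V" "set (map p' cs) \<subseteq> V"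
    using S p by auto
  let ?F = "fixers (map p cs @ [p v0]) (map p' cs @ [p' v0])"
  have "congr (map p (cs @ [v0])) (map p' (cs @ [v0]))"
    using S by (intro congr_map eq') auto
  then have "?F \<noteq> {}"
    using witt[OF V gen] by simp
  then obtain g0 where g0: "g0 \<in> ?F" by blast
  have "?F \<subseteq> {g\<in>isoms. \<forall>v\<in>S. g (p v) = p' v}"
  proof
    fix g assume g: "g \<in> ?F"
    have gi: "g \<in> isoms" and gm: "\<And>v. v \<in> set (v0 # cs) \<Longrightarrow> g (p v) = p' v"
      using g by (auto simp: fixers_def)
    have "g (p v) = p' v" if v: "v \<in> S" for v
    proof (cases "card S - 1 \<le> d")
      case True
      then show ?thesis using r(2) gm v by blast
    next
      case False
      show ?thesis
      proof (rule fixers_far[OF V p(1)[OF v] p(2)[OF v] gen(2) _ g])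
        show "length (map p' cs) = d" using r(1) False by simp
        have "list_all2 (\<lambda>a b. Q (p v - a) = Q (p' v - b)) (map p (cs @ [v0])) (map p' (cs @ [v0]))"
          unfolding list_all2_map1 list_all2_map2 list_all2_same using S v by (auto intro!: eq')
        then show "list_all2 (\<lambda>a b. Q (p v - a) = Q (p' v - b)) (map p cs @ [p v0]) (map p' cs @ [p' v0])"
          by simp
      qed
    qed
    then show "g \<in> {g\<in>isoms. \<forall>v\<in>S. g (p v) = p' v}" using gi by blast
  qed
  then have "card ?F \<le> card {g\<in>isoms. \<forall>v\<in>S. g (p v) = p' v}"
    using finite_isoms by (intro card_mono) auto
  moreover have "card ?F = stab_card (p v0) (map p cs)"
    using V by (intro card_fixers_eq[OF g0]) auto
  ultimately have "real (stab_card (p v0) (map p cs)) \<le> real (card {g\<in>isoms. \<forall>v\<in>S. g (p v) = p' v})"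
    by simp
  then have "2 ^ length cs * real q ^ (\<Sum>i<length cs. d - 1 - i) * real (stab_card (p v0) (map p cs))
     \<le> 2 ^ length cs * real q ^ (\<Sum>i<length cs. d - 1 - i) * real (card {g\<in>isoms. \<forall>v\<in>S. g (p v) = p' v})"
    by (rule mult_left_mono) simp
  moreover have "stab0 \<le> 2 ^ length cs * real q ^ (\<Sum>i<length cs. d - 1 - i) * real (stab_card (p v0) (map p cs))"
    using card_fixers_lower[OF V(1,3) gen(1)] by simp
  ultimately show ?thesis by linarith
qed

lemma lam_pinned_uniform:
  assumes E: "E \<subseteq> V" and z: "z \<in> E \<times> E" and kd: "2 * k \<le> d" and \<kappa>: "\<kappa> \<le> k"
    and A: "real (card ((E \<times> E) \<inter> adj z)) \<le> 16 * (real (card E))\<^sup>2 / q"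
    and big: "real q ^ (d + k) \<le> (real (card E))\<^sup>2"
  shows "(\<Sum>g\<in>{g\<in>isoms. g (fst z) = snd z}. lam E g ^ \<kappa>)
    \<le> pin_const k * stab0 * ((real (card E))\<^sup>2 / real q ^ d) ^ \<kappa>"
proof (cases \<kappa>)
  case 0
  have V: "fst z \<in> V" "snd z \<in> V" using z E by auto
  have "{g\<in>isoms. g (fst z) = snd z} = fixers [fst z] [snd z]" by (auto simp: fixers_def)
  then have "(\<Sum>g\<in>{g\<in>isoms. g (fst z) = snd z}. lam E g ^ \<kappa>) = stab0"
    using card_fixers_single[OF V] by (simp add: 0 stab0_def)
  then show ?thesis using 0 pin_const_ge stab0_pos by simp
next
  case (Suc j)
  let ?c = "\<lambda>j. 6 ^ Suc j * 2 ^ (j * (j + 2)) * real (j + 1) * 16 ^ Suc j + 2 ^ Suc j"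
  have "real q ^ (d + Suc j) \<le> real q ^ (d + k)" using \<kappa> Suc q5 by (intro power_increasing) auto
  then have big': "real q ^ (d + Suc j) \<le> (real (card E))\<^sup>2" using big by linarith
  have "(\<Sum>g\<in>{g\<in>isoms. g (fst z) = snd z}. lam E g ^ Suc j)
    \<le> ?c j * stab0 * ((real (card E))\<^sup>2 / real q ^ d) ^ Suc j"
    using lam_pinned[OF E z _ _ A big'] kd \<kappa> Suc by simp
  also have "\<dots> \<le> pin_const k * stab0 * ((real (card E))\<^sup>2 / real q ^ d) ^ Suc j"
  proof (intro mult_right_mono)
    have "?c j \<le> (\<Sum>j<k. ?c j)"
      using \<kappa> Suc by (intro member_le_sum) auto
    then show "?c j \<le> pin_const k" by (simp add: pin_const_def)
  qed (use stab0_pos in auto)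
  finally show ?thesis using Suc by simp
qed

text \<open>An instance of \<open>tree_incidence_sum\<close> with incidence
  \<open>g (fst z) = snd z\<close>, so that z encodes a pair of maps of the vertices into E. The
  bound is expressed through the mean of \<open>lam\<close>.\<close>

lemma transporter_sum_le:
  fixes T :: "'w set set"
  assumes tree: "simplex_tree T" and ne: "T \<noteq> {}" and k: "k \<ge> 1" "2 * k \<le> d"
    and N: "N = k + (\<Sum>S | S \<in> T \<and> card S - 1 > k. card S - 1 - k)"
    and E: "E \<subseteq> V"
    and A: "\<And>z. z \<in> E \<times> E \<Longrightarrow> real (card ((E \<times> E) \<inter> adj z)) \<le> 16 * (real (card E))\<^sup>2 / q"
    and big1: "real q ^ (d * N + 1) \<le> real (card E) ^ (N + 1)"
    and big2: "real q ^ (d + k) \<le> (real (card E))\<^sup>2"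
  shows "(\<Sum>z\<in>\<Union>T \<rightarrow>\<^sub>E E \<times> E. \<Prod>S\<in>T. real (card {g\<in>isoms. \<forall>v\<in>S. g (fst (z v)) = snd (z v)}))
    \<le> real (card T) * pin_const k ^ card T * (pin_const k + 14 * 2 ^ (N + 1)) * stab0 ^ card T
       * real q ^ d * ((real (card E))\<^sup>2 / real q ^ d) ^ card (\<Union>T)"
proof -
  define L where "L = {S\<in>T. card S - 1 > k}"
  \<comment> \<open>Roots are the simplices of dimension above k. If there are none, no surplus has
    to be collected and any simplex may serve.\<close>
  define X where "X = (if L = {} then T else L)"
  define \<kappa> where "\<kappa> S = min (card S - 1) k" for S :: "'w set"
  define M where "M = (\<Sum>S\<in>T. card S - 1 - \<kappa> S)"
  define m where "m = (real (card E))\<^sup>2 / real q ^ d"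
  define cA where "cA = pin_const k"
  define cB where "cB = cA + 14 * 2 ^ (N + 1)"
  have cA: "cA \<ge> 1" using pin_const_ge by (simp add: cA_def)
  have m0: "m \<ge> 0" by (simp add: m_def)
  have fT: "finite T" using tree by (simp add: simplex_tree_def)
  have fE: "finite E" using E finV finite_subset by blast
  have qd: "real q ^ d > 0" using q_pos by simp
  have XT: "X \<subseteq> T" "X \<noteq> {}" using ne by (auto simp: X_def L_def)
  have M: "M = (\<Sum>S\<in>L. card S - 1 - k)"
  proof -
    have "M = (\<Sum>S\<in>L. card S - 1 - \<kappa> S)"
      unfolding M_def by (rule sum.mono_neutral_right[OF fT]) (auto simp: L_def \<kappa>_def)
    also have "\<dots> = (\<Sum>S\<in>L. card S - 1 - k)" by (intro sum.cong) (auto simp: L_def \<kappa>_def)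
    finally show ?thesis .
  qed
  have NM: "N = k + M" using N M by (simp add: L_def)
  have pin: "(\<Sum>g\<in>{g\<in>isoms. g (fst a) = snd a}. lam E g ^ \<kappa> S) \<le> cA * stab0 * m ^ \<kappa> S"
    if "a \<in> E \<times> E" for S a
    unfolding cA_def m_def using that k A big2 by (intro lam_pinned_uniform[OF E]) (auto simp: \<kappa>_def)
  have root: "(\<Sum>g\<in>isoms. lam E g ^ (\<kappa> R + 1 + M)) \<le> cB * stab0 * real q ^ d * m ^ (\<kappa> R + 1 + M)"
    if R: "R \<in> X" for R
  proof (cases "L = {}")
    case False
    then have "R \<in> L" using R by (simp only: X_def if_False)
    then have "\<kappa> R = k" by (simp add: \<kappa>_def L_def)
    then have e: "\<kappa> R + 1 + M = N + 1" using NM by simp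
    have "(\<Sum>g\<in>isoms. lam E g ^ (N + 1)) \<le> 14 * 2 ^ (N + 1) * real q ^ d * stab0 * m ^ (N + 1)"
      unfolding m_def using lam_moment[OF E _ big1] k NM by simp
    also have "\<dots> = 14 * 2 ^ (N + 1) * (stab0 * real q ^ d * m ^ (N + 1))" by (simp add: mult_ac)
    also have "\<dots> \<le> cB * (stab0 * real q ^ d * m ^ (N + 1))"
      using cA m0 stab0_pos unfolding cB_def by (intro mult_right_mono) auto
    finally show ?thesis unfolding e by (simp add: mult_ac)
  next
    case True
    then have M0: "M = 0" using M by simp
    \<comment> \<open>Without surplus no moment estimate enters: one factor \<open>lam\<close> is
      expanded into incident pairs, and the pinned bound is summed over
      \<open>E \<times> E\<close>.\<close>
    have "(\<Sum>g\<in>isoms. lam E g ^ (\<kappa> R + 1)) = (\<Sum>g\<in>isoms. \<Sum>z\<in>E \<times> E. of_bool (g (fst z) = snd z) * lam E g ^ \<kappa> R)"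
    proof (rule sum.cong[OF refl])
      fix g
      have "(\<Sum>z\<in>E \<times> E. of_bool (g (fst z) = snd z)) = lam E g"
        using fE unfolding lam_def by (simp add: of_bool_def sum.If_cases Int_def)
      then show "lam E g ^ (\<kappa> R + 1) = (\<Sum>z\<in>E \<times> E. of_bool (g (fst z) = snd z) * lam E g ^ \<kappa> R)"
        by (simp add: sum_distrib_right[symmetric])
    qed
    also have "\<dots> = (\<Sum>z\<in>E \<times> E. \<Sum>g\<in>isoms. of_bool (g (fst z) = snd z) * lam E g ^ \<kappa> R)" by (rule sum.swap)
    also have "\<dots> \<le> (\<Sum>z\<in>E \<times> E. cA * stab0 * m ^ \<kappa> R)"
    proof (rule sum_mono)
      fix z assume z: "z \<in> E \<times> E"
      have "(\<Sum>g\<in>isoms. of_bool (g (fst z) = snd z) * lam E g ^ \<kappa> R)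
          = (\<Sum>g\<in>{g\<in>isoms. g (fst z) = snd z}. lam E g ^ \<kappa> R)"
        using finite_isoms by (intro sum.mono_neutral_cong_right) auto
      then show "(\<Sum>g\<in>isoms. of_bool (g (fst z) = snd z) * lam E g ^ \<kappa> R) \<le> cA * stab0 * m ^ \<kappa> R"
        using pin[OF z] by simp
    qed
    also have "\<dots> = (real (card E))\<^sup>2 * (cA * stab0 * m ^ \<kappa> R)"
      by (simp add: card_cartesian_product power2_eq_square)
    also have "(real (card E))\<^sup>2 = real q ^ d * m" using qd by (simp add: m_def)
    finally have "(\<Sum>g\<in>isoms. lam E g ^ (\<kappa> R + 1)) \<le> cA * (stab0 * real q ^ d * m ^ (\<kappa> R + 1))"
      by (simp add: mult_ac)
    also have "\<dots> \<le> cB * (stab0 * real q ^ d * m ^ (\<kappa> R + 1))"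
      using m0 stab0_pos unfolding cB_def by (intro mult_right_mono) auto
    finally show ?thesis using M0 by (simp add: mult_ac)
  qed
  have "(\<Sum>z\<in>\<Union>T \<rightarrow>\<^sub>E E \<times> E. \<Prod>S\<in>T. real (card {g\<in>isoms. \<forall>v\<in>S. g (fst (z v)) = snd (z v)}))
    \<le> (\<Sum>R\<in>X. (\<Prod>S\<in>T - {R}. cA * stab0 * m ^ \<kappa> S) * (\<Sum>g\<in>isoms. lam E g ^ (\<kappa> R + 1 + M)))"
    unfolding lam_def M_def
  proof (rule tree_incidence_sum[OF tree _ finite_isoms XT, where inc = "\<lambda>g z. g (fst z) = snd z"])
    show "\<kappa> S \<le> card S - 1" for S by (simp add: \<kappa>_def)
    show "\<kappa> S = card S - 1" if "S \<in> T - X" for S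
      using that by (auto simp: \<kappa>_def X_def L_def split: if_splits)
    show "0 \<le> cA * stab0 * m ^ \<kappa> S" for S using cA stab0_pos m0 by simp
    show "(\<Sum>g\<in>{g\<in>isoms. g (fst a) = snd a}. real (card {z\<in>E \<times> E. g (fst z) = snd z}) ^ \<kappa> S)
      \<le> cA * stab0 * m ^ \<kappa> S" if "a \<in> E \<times> E" for S a
      using pin[OF that, of S] by (simp only: lam_def)
  qed (use fE in auto)
  also have "\<dots> \<le> (\<Sum>R\<in>X. cA ^ card T * cB * stab0 ^ card T * real q ^ d * m ^ card (\<Union>T))"
  proof (rule sum_mono)
    fix R assume R: "R \<in> X"
    then have RT: "R \<in> T" using XT by blast
    have cT: "card T = Suc (card (T - {R}))" using RT fT by (metis card_Suc_Diff1)
    have pr: "(\<Prod>S\<in>T - {R}. cA * stab0 * m ^ \<kappa> S) = cA ^ card (T - {R}) * stab0 ^ card (T - {R}) * m ^ (\<Sum>S\<in>T - {R}. \<kappa> S)"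
      by (simp only: prod.distrib prod_constant power_sum)
    \<comment> \<open>The exponents of \<open>m\<close> add up to the number of vertices, whichever
      root is chosen.\<close>
    have "(\<Sum>S\<in>T - {R}. \<kappa> S) + (\<kappa> R + 1 + M) = card (\<Union>T)"
    proof -
      have "(\<Sum>S\<in>T - {R}. \<kappa> S) + \<kappa> R = (\<Sum>S\<in>T. \<kappa> S)" using RT fT by (simp add: sum.remove add.commute)
      moreover have "(\<Sum>S\<in>T. \<kappa> S) + M = (\<Sum>S\<in>T. card S - 1)"
        unfolding M_def sum.distrib[symmetric] by (intro sum.cong) (auto simp: \<kappa>_def)
      ultimately show ?thesis using card_simplex_tree_verts[OF tree ne] by linarith
    qed
    then have pm: "m ^ (\<Sum>S\<in>T - {R}. \<kappa> S) * m ^ (\<kappa> R + 1 + M) = m ^ card (\<Union>T)"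
      by (simp only: power_add[symmetric])
    have "(\<Prod>S\<in>T - {R}. cA * stab0 * m ^ \<kappa> S) * (cB * stab0 * real q ^ d * m ^ (\<kappa> R + 1 + M))
       = cA ^ card (T - {R}) * cB * (stab0 * stab0 ^ card (T - {R})) * real q ^ d
         * (m ^ (\<Sum>S\<in>T - {R}. \<kappa> S) * m ^ (\<kappa> R + 1 + M))"
      unfolding pr by (simp only: mult_ac)
    then have "(\<Prod>S\<in>T - {R}. cA * stab0 * m ^ \<kappa> S) * (cB * stab0 * real q ^ d * m ^ (\<kappa> R + 1 + M))
       = cA ^ card (T - {R}) * cB * stab0 ^ card T * real q ^ d * m ^ card (\<Union>T)"
      unfolding pm cT by (simp only: power_Suc)
    moreover have "cA ^ card (T - {R}) \<le> cA ^ card T" using cA cT by (intro power_increasing) auto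
    then have "cA ^ card (T - {R}) * (cB * stab0 ^ card T * real q ^ d * m ^ card (\<Union>T))
      \<le> cA ^ card T * (cB * stab0 ^ card T * real q ^ d * m ^ card (\<Union>T))"
      using cA m0 stab0_pos by (intro mult_right_mono) (auto simp: cB_def)
    moreover have "(\<Prod>S\<in>T - {R}. cA * stab0 * m ^ \<kappa> S) * (\<Sum>g\<in>isoms. lam E g ^ (\<kappa> R + 1 + M))
       \<le> (\<Prod>S\<in>T - {R}. cA * stab0 * m ^ \<kappa> S) * (cB * stab0 * real q ^ d * m ^ (\<kappa> R + 1 + M))"
      using root[OF R] cA m0 stab0_pos by (intro mult_left_mono prod_nonneg) auto
    ultimately show "(\<Prod>S\<in>T - {R}. cA * stab0 * m ^ \<kappa> S) * (\<Sum>g\<in>isoms. lam E g ^ (\<kappa> R + 1 + M))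
       \<le> cA ^ card T * cB * stab0 ^ card T * real q ^ d * m ^ card (\<Union>T)"
      by (simp only: mult.assoc)
  qed
  also have "\<dots> = real (card X) * (cA ^ card T * cB * stab0 ^ card T * real q ^ d * m ^ card (\<Union>T))" by simp
  also have "\<dots> \<le> real (card T) * (cA ^ card T * cB * stab0 ^ card T * real q ^ d * m ^ card (\<Union>T))"
    using card_mono[OF fT XT(1)] cA m0 stab0_pos by (intro mult_right_mono) (auto simp: cB_def)
  finally show ?thesis by (simp add: cA_def cB_def m_def mult.assoc)
qed

end

text \<open>The 4 is the square of the factor 2 lost in passing to good embeddings, the bracket is
  the constant of \<open>transporter_sum_le\<close>, and the two powers of 2 come from the
  stabilizer bound and from the count of all profiles.\<close>

definition class_const :: "'w set set \<Rightarrow> nat \<Rightarrow> nat \<Rightarrow> real" where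
  "class_const T k N = 4 * (real (card T) * pin_const k ^ card T * (pin_const k + 14 * 2 ^ (N + 1)))
     * 2 ^ (\<Sum>S\<in>T. card S - 1) * 2 ^ (\<Sum>S\<in>T. card S - 1)"

lemma class_const_pos:
  assumes "finite T" "T \<noteq> {}" shows "class_const T k N > 0"
proof -
  have "pin_const k > 0" using pin_const_ge[of k] by linarith
  moreover have "card T > 0" using assms by (simp add: card_gt_0_iff)
  ultimately show ?thesis unfolding class_const_def by (intro mult_pos_pos add_pos_pos zero_less_power) auto
qed

context quadratic_space
begin

definition profs :: "'w set set \<Rightarrow> ('w \<Rightarrow> 'v) \<Rightarrow> 'w set \<Rightarrow> 'w \<times> 'w \<Rightarrow> 'a" where
  "profs T p = (\<lambda>S\<in>T. prof S p)"

text \<open>A profile of the tree is a tuple of simplex profiles, so the count is at most a product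
  over the simplices; compatibility at shared vertices is dropped.\<close>

lemma card_all_profs_le:
  fixes T :: "'w set set"
  assumes T: "finite T" "\<And>S. S \<in> T \<Longrightarrow> finite S \<and> S \<noteq> {}"
  shows "finite (profs T ` (\<Union>T \<rightarrow>\<^sub>E V)) \<and>
    real (card (profs T ` (\<Union>T \<rightarrow>\<^sub>E V))) * (\<Prod>S\<in>T. real q ^ (\<Sum>i<min (card S - 1) d. d - 1 - i))
     \<le> 2 ^ (\<Sum>S\<in>T. card S - 1) * real q ^ (d * (\<Sum>S\<in>T. card S - 1))"
proof -
  let ?P = "\<lambda>S. prof S ` (S \<rightarrow>\<^sub>E V)" and ?e = "\<lambda>S. \<Sum>i<min (card S - 1) d. d - 1 - i"
  have one: "finite (?P S)" "card (?P S) * q ^ ?e S \<le> 2 ^ (card S - 1) * q ^ (d * (card S - 1))" if "S \<in> T" for S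
    using card_profiles_le[of S "card S - 1"] T(2)[OF that] by auto
  have sub: "profs T ` (\<Union>T \<rightarrow>\<^sub>E V) \<subseteq> (\<Pi>\<^sub>E S\<in>T. ?P S)"
  proof
    fix y assume "y \<in> profs T ` (\<Union>T \<rightarrow>\<^sub>E V)"
    then obtain p where p: "p \<in> \<Union>T \<rightarrow>\<^sub>E V" "y = profs T p" by blast
    have "prof S p \<in> ?P S" if "S \<in> T" for S
    proof (rule image_eqI[of _ _ "restrict p S"])
      show "prof S p = prof S (restrict p S)" by (simp add: prof_eq_iff)
      show "restrict p S \<in> S \<rightarrow>\<^sub>E V" using p that by (auto intro: PiE_mem)
    qed
    then show "y \<in> (\<Pi>\<^sub>E S\<in>T. ?P S)" unfolding p(2) profs_def by (simp add: restrict_PiE_iff)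
  qed
  have fin: "finite (\<Pi>\<^sub>E S\<in>T. ?P S)" using T(1) one(1) by (intro finite_PiE) auto
  have "card (profs T ` (\<Union>T \<rightarrow>\<^sub>E V)) \<le> (\<Prod>S\<in>T. card (?P S))"
    using card_mono[OF fin sub] T(1) by (simp add: card_PiE)
  then have "card (profs T ` (\<Union>T \<rightarrow>\<^sub>E V)) * (\<Prod>S\<in>T. q ^ ?e S) \<le> (\<Prod>S\<in>T. card (?P S)) * (\<Prod>S\<in>T. q ^ ?e S)"
    by (rule mult_le_mono1)
  also have "\<dots> = (\<Prod>S\<in>T. card (?P S) * q ^ ?e S)" by (rule prod.distrib[symmetric])
  also have "\<dots> \<le> (\<Prod>S\<in>T. 2 ^ (card S - 1) * q ^ (d * (card S - 1)))"
    using one(2) by (intro prod_mono) auto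
  also have "\<dots> = 2 ^ (\<Sum>S\<in>T. card S - 1) * q ^ (d * (\<Sum>S\<in>T. card S - 1))"
    by (simp only: prod.distrib power_sum sum_distrib_left)
  finally have "real (card (profs T ` (\<Union>T \<rightarrow>\<^sub>E V)) * (\<Prod>S\<in>T. q ^ ?e S))
     \<le> real (2 ^ (\<Sum>S\<in>T. card S - 1) * q ^ (d * (\<Sum>S\<in>T. card S - 1)))" by (rule of_nat_mono)
  then show ?thesis using finite_subset[OF sub fin] by simp
qed

text \<open>In a pair of good embeddings with equal profiles, each simplex S admits at least
  \<open>stab0\<close> / \<open>w S\<close> isometries carrying one copy to the other. Weighting
  pairs by these numbers turns a bound on pairs into a bound on transporters, and the weights have
  the same order as the bound for all profiles.\<close>

lemma positive_proportion_profs: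
  fixes T :: "'w set set" and E :: "'v set"
  assumes tree: "simplex_tree T" and ne: "T \<noteq> {}" and k: "k \<ge> 1" "2 * k \<le> d"
    and N: "N = k + (\<Sum>S | S \<in> T \<and> card S - 1 > k. card S - 1 - k)"
    and E: "E \<subseteq> V"
    and big1: "real q ^ (d * N + 1) \<le> (real (card E) / 2) ^ (N + 1)"
    and big2: "real q ^ (d + k) \<le> (real (card E) / 2)\<^sup>2"
    and big3: "\<And>S. S \<in> T \<Longrightarrow> 6 * (\<Sum>S\<in>T. real (card S)) * real q ^ (min (card S - 1) d - 1) \<le> real (card E) / 2"
  shows "real (card (profs T ` (\<Union>T \<rightarrow>\<^sub>E V))) \<le> class_const T k N * real (card (profs T ` (\<Union>T \<rightarrow>\<^sub>E E)))"
proof -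
  define U where "U = \<Union>T"
  define n where "n S = card S - 1" for S :: "'w set"
  define r where "r S = min (n S) d" for S
  define ex where "ex S = (\<Sum>i<r S. d - 1 - i)" for S
  have fT: "finite T" and fS: "\<And>S. S \<in> T \<Longrightarrow> finite S \<and> S \<noteq> {}"
    using tree by (auto simp: simplex_tree_def)
  have fU: "finite U" using fT fS by (auto simp: U_def)
  have cU: "card U = 1 + (\<Sum>S\<in>T. n S)" unfolding U_def n_def by (rule card_simplex_tree_verts[OF tree ne])
  have "real q ^ (d + 1) \<le> real q ^ (d + k)" using k q5 by (intro power_increasing) auto
  also note big2
  also have "(real (card E) / 2)\<^sup>2 \<le> (real (card E))\<^sup>2" by (intro power_mono) auto
  finally have "real q ^ (d + 1) \<le> (real (card E))\<^sup>2" .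
  from pruning[OF E this] obtain F where F: "F \<subseteq> E" "card E \<le> 2 * card F"
    and Fadj: "\<And>z. z \<in> F \<times> F \<Longrightarrow> real (card ((F \<times> F) \<inter> adj z)) \<le> 4 * (real (card E))\<^sup>2 / q" by blast
  have FV: "F \<subseteq> V" using F E by blast
  have fF: "finite F" using FV finV finite_subset by blast
  define f where "f = real (card F)"
  have half: "real (card E) / 2 \<le> f" using F(2) by (simp add: f_def)
  have h0: "0 \<le> real (card E) / 2" by simp
  have fpos: "f > 0"
  proof -
    have "0 < real q ^ (d + k)" using q_pos by simp
    then have "real (card E) / 2 \<noteq> 0" using big2 by (metis not_less power_zero_numeral)
    then show ?thesis using half h0 by linarith
  qed
  have b1: "real q ^ (d * N + 1) \<le> real (card F) ^ (N + 1)"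
    using order.trans[OF big1 power_mono[OF half h0]] by (simp only: f_def)
  have b2: "real q ^ (d + k) \<le> (real (card F))\<^sup>2"
    using order.trans[OF big2 power_mono[OF half h0]] by (simp only: f_def)
  have Fadj': "real (card ((F \<times> F) \<inter> adj z)) \<le> 16 * (real (card F))\<^sup>2 / q" if "z \<in> F \<times> F" for z
  proof -
    have "(real (card E))\<^sup>2 \<le> (2 * f)\<^sup>2" using half by (intro power_mono) auto
    then have "4 * (real (card E))\<^sup>2 / q \<le> 16 * (real (card F))\<^sup>2 / q"
      by (intro divide_right_mono) (auto simp: f_def power_mult_distrib)
    then show ?thesis using Fadj[OF that] by linarith
  qed
  \<comment> \<open>Each simplex receives an ordering: a base vertex and \<open>r S\<close> further
    vertices, to which Witt's theorem will be applied.\<close>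
  have "\<exists>v cs. distinct (v # cs) \<and> set (v # cs) \<subseteq> S \<and> length cs = r S \<and> (n S \<le> d \<longrightarrow> S = set (v # cs))"
    if S: "S \<in> T" for S
  proof -
    obtain l where l: "set l = S" "distinct l" using finite_distinct_list fS[OF S] by blast
    then obtain v l' where vl: "l = v # l'" using fS[OF S] by (cases l) auto
    have "length l' = n S" using l vl by (auto simp: n_def distinct_card[symmetric])
    then show ?thesis using l vl
      by (intro exI[of _ v] exI[of _ "take (r S) l'"])
        (auto simp: r_def dest: in_set_takeD)
  qed
  then obtain v0 cs where ord: "\<And>S. S \<in> T \<Longrightarrow> distinct (v0 S # cs S) \<and> set (v0 S # cs S) \<subseteq> S \<and>
      length (cs S) = r S \<and> (n S \<le> d \<longrightarrow> S = set (v0 S # cs S))" by metis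
  define bad where "bad S = {p\<in>U \<rightarrow>\<^sub>E F. \<not> generic (diffs (p (v0 S)) (map p (cs S)))}" for S
  define Good where "Good = (U \<rightarrow>\<^sub>E F) - (\<Union>S\<in>T. bad S)"
  have fUF: "finite (U \<rightarrow>\<^sub>E F)" using fU fF by (intro finite_PiE) auto
  have fGood: "finite Good" using fUF by (simp add: Good_def)
  have SU: "S \<subseteq> U" if "S \<in> T" for S using that by (auto simp: U_def)
  have cUpos: "card U \<ge> 1" using cU by simp
  have Pow: "f ^ card U = f * f ^ (card U - 1)" using cUpos by (simp add: power_eq_if)
  \<comment> \<open>With M the sum of all \<open>card S\<close>, the 6M in \<open>big3\<close> is 2M
    times the 3 of \<open>card_not_generic\<close>. Summation over T then discards at most half of
    all embeddings.\<close>
  have cbad: "(2 * (\<Sum>S\<in>T. real (card S))) * real (card (bad S)) \<le> real (card S) * f ^ card U" if S: "S \<in> T" for S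
  proof -
    have "card (bad S) \<le> r S * (3 * q ^ (r S - 1) * card F ^ (card U - 1))"
      using card_not_generic[OF fU, of "v0 S" "cs S" F] ord[OF S] SU[OF S] FV by (auto simp: bad_def)
    then have "real (card (bad S)) \<le> real (r S * (3 * q ^ (r S - 1) * card F ^ (card U - 1)))"
      by (rule of_nat_mono)
    then have "(2 * (\<Sum>S\<in>T. real (card S))) * real (card (bad S))
       \<le> (2 * (\<Sum>S\<in>T. real (card S))) * (real (r S) * (3 * real q ^ (r S - 1) * f ^ (card U - 1)))"
      by (intro mult_left_mono sum_nonneg mult_nonneg_nonneg) (auto simp: f_def)
    also have "\<dots> = (6 * (\<Sum>S\<in>T. real (card S)) * real q ^ (r S - 1)) * (real (r S) * f ^ (card U - 1))"
      by simp
    also have "\<dots> \<le> f * (real (r S) * f ^ (card U - 1))"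
      using big3[OF S] half fpos unfolding r_def n_def by (intro mult_right_mono) auto
    also have "\<dots> = real (r S) * f ^ card U" by (simp add: Pow)
    also have "\<dots> \<le> real (card S) * f ^ card U"
      using fpos by (intro mult_right_mono) (auto simp: r_def n_def)
    finally show ?thesis .
  qed
  have sumpos: "(\<Sum>S\<in>T. real (card S)) > 0"
    using fT ne fS by (intro sum_pos) (auto simp: card_gt_0_iff)
  have "(2 * (\<Sum>S\<in>T. real (card S))) * (\<Sum>S\<in>T. real (card (bad S))) \<le> (\<Sum>S\<in>T. real (card S)) * f ^ card U"
    unfolding sum_distrib_left[of "2 * (\<Sum>S\<in>T. real (card S))"] sum_distrib_right using cbad by (rule sum_mono)
  then have "(\<Sum>S\<in>T. real (card S)) * (2 * (\<Sum>S\<in>T. real (card (bad S)))) \<le> (\<Sum>S\<in>T. real (card S)) * f ^ card U"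
    by (simp only: mult_ac)
  then have sbad: "2 * (\<Sum>S\<in>T. real (card (bad S))) \<le> f ^ card U" using sumpos by simp
  have cGood: "f ^ card U \<le> 2 * real (card Good)"
  proof -
    have sub: "(\<Union>S\<in>T. bad S) \<subseteq> U \<rightarrow>\<^sub>E F" by (auto simp: bad_def)
    have "card Good = card (U \<rightarrow>\<^sub>E F) - card (\<Union>S\<in>T. bad S)"
      unfolding Good_def by (rule card_Diff_subset[OF finite_subset[OF sub fUF] sub])
    moreover have "card (\<Union>S\<in>T. bad S) \<le> (\<Sum>S\<in>T. card (bad S))" by (rule card_UN_le[OF fT])
    then have "real (card (\<Union>S\<in>T. bad S)) \<le> (\<Sum>S\<in>T. real (card (bad S)))" by (simp flip: of_nat_sum)
    moreover have "real (card (U \<rightarrow>\<^sub>E F)) = f ^ card U" using fU by (simp add: card_PiE f_def)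
    moreover have "card (\<Union>S\<in>T. bad S) \<le> card (U \<rightarrow>\<^sub>E F)" by (rule card_mono[OF fUF sub])
    ultimately show ?thesis using sbad by (simp add: of_nat_diff)
  qed
  define Pairs where "Pairs = {(p, p'). p \<in> Good \<and> p' \<in> Good \<and> profs T p = profs T p'}"
  have fPairs: "finite Pairs" by (rule finite_subset[of _ "Good \<times> Good"]) (use fGood in \<open>auto simp: Pairs_def\<close>)
  have CS: "(real (card Good))\<^sup>2 \<le> real (card (profs T ` Good)) * real (card Pairs)"
    using card_power2_le_collisions[OF fGood, of "profs T"] by (simp add: Pairs_def)
  define K where "K z = (\<Prod>S\<in>T. real (card {g\<in>isoms. \<forall>v\<in>S. g (fst (z v)) = snd (z v)}))"
    for z :: "'w \<Rightarrow> 'v \<times> 'v"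
  define w where "w S = 2 ^ n S * real q ^ ex S" for S
  define zip2 where "zip2 = (\<lambda>(p, p'). restrict (\<lambda>v. (p v, p' v)) U :: 'w \<Rightarrow> 'v \<times> 'v)"
  have Kz: "stab0 ^ card T \<le> (\<Prod>S\<in>T. w S) * K (zip2 pp)" if pp: "pp \<in> Pairs" for pp
  proof -
    obtain p p' where pp': "pp = (p, p')" "p \<in> Good" "p' \<in> Good" "profs T p = profs T p'"
      using pp by (auto simp: Pairs_def)
    have "stab0 \<le> w S * real (card {g\<in>isoms. \<forall>v\<in>S. g (fst (zip2 pp v)) = snd (zip2 pp v)})" if S: "S \<in> T" for S
    proof -
      have z: "zip2 pp v = (p v, p' v)" if "v \<in> S" for v using SU[OF S] that by (auto simp: zip2_def pp')
      have "prof S p = prof S p'" using fun_cong[OF pp'(4), of S] S by (simp add: profs_def)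
      moreover have "p v \<in> V" "p' v \<in> V" if "v \<in> S" for v
        using pp' SU[OF S] that FV by (auto simp: Good_def dest!: PiE_mem)
      moreover have "generic (diffs (p (v0 S)) (map p (cs S)))" "generic (diffs (p' (v0 S)) (map p' (cs S)))"
        using pp' S by (auto simp: Good_def bad_def)
      ultimately have "stab0 \<le> 2 ^ length (cs S) * real q ^ (\<Sum>i<length (cs S). d - 1 - i) * real (card {g\<in>isoms. \<forall>v\<in>S. g (p v) = p' v})"
        using ord[OF S] by (intro card_transporters[of "v0 S"]) (auto simp: r_def n_def)
      also have "\<dots> \<le> w S * real (card {g\<in>isoms. \<forall>v\<in>S. g (p v) = p' v})"
        using ord[OF S] by (intro mult_right_mono) (auto simp: w_def ex_def r_def intro!: mult_right_mono power_increasing)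
      also have "{g\<in>isoms. \<forall>v\<in>S. g (p v) = p' v} = {g\<in>isoms. \<forall>v\<in>S. g (fst (zip2 pp v)) = snd (zip2 pp v)}"
        using z by auto
      finally show ?thesis .
    qed
    then have "(\<Prod>S\<in>T. stab0) \<le> (\<Prod>S\<in>T. w S * real (card {g\<in>isoms. \<forall>v\<in>S. g (fst (zip2 pp v)) = snd (zip2 pp v)}))"
      using stab0_pos by (intro prod_mono) auto
    then show ?thesis by (simp add: K_def prod.distrib)
  qed
  have w0: "(\<Prod>S\<in>T. w S) \<ge> 0" by (intro prod_nonneg) (auto simp: w_def)
  have K0: "K z \<ge> 0" for z unfolding K_def by (intro prod_nonneg) auto
  have inj: "inj_on zip2 Pairs"
  proof (rule inj_onI)
    fix a b assume ab: "a \<in> Pairs" "b \<in> Pairs" "zip2 a = zip2 b"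
    obtain p p' r r' where e: "a = (p, p')" "b = (r, r')" by (cases a; cases b)
    have U': "p \<in> U \<rightarrow>\<^sub>E F" "p' \<in> U \<rightarrow>\<^sub>E F" "r \<in> U \<rightarrow>\<^sub>E F" "r' \<in> U \<rightarrow>\<^sub>E F"
      using ab e by (auto simp: Pairs_def Good_def)
    have "p v = r v" "p' v = r' v" if "v \<in> U" for v
      using fun_cong[OF ab(3), of v] that by (auto simp: zip2_def e)
    then have "p = r" "p' = r'" using U' by (auto intro: PiE_ext)
    then show "a = b" by (simp add: e)
  qed
  define C1 where "C1 = real (card T) * pin_const k ^ card T * (pin_const k + 14 * 2 ^ (N + 1))"
  have "real (card Pairs) * stab0 ^ card T = (\<Sum>pp\<in>Pairs. stab0 ^ card T)" by simp
  also have "\<dots> \<le> (\<Sum>pp\<in>Pairs. (\<Prod>S\<in>T. w S) * K (zip2 pp))" by (intro sum_mono Kz)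
  also have "\<dots> = (\<Prod>S\<in>T. w S) * (\<Sum>z\<in>zip2 ` Pairs. K z)"
    by (simp add: sum_distrib_left sum.reindex[OF inj])
  also have "\<dots> \<le> (\<Prod>S\<in>T. w S) * (\<Sum>z\<in>U \<rightarrow>\<^sub>E F \<times> F. K z)"
  proof (intro mult_left_mono sum_mono2 w0 K0)
    show "finite (U \<rightarrow>\<^sub>E F \<times> F)" using fU fF by (intro finite_PiE) auto
    show "zip2 ` Pairs \<subseteq> U \<rightarrow>\<^sub>E F \<times> F"
      by (auto simp: zip2_def Pairs_def Good_def restrict_PiE_iff intro: PiE_mem)
  qed
  also have "\<dots> \<le> (\<Prod>S\<in>T. w S) * (C1 * stab0 ^ card T * real q ^ d * (f\<^sup>2 / real q ^ d) ^ card U)"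
    unfolding K_def U_def C1_def f_def
    using transporter_sum_le[OF tree ne k N FV Fadj' b1 b2] w0 by (intro mult_left_mono) auto
  finally have "stab0 ^ card T * real (card Pairs)
      \<le> stab0 ^ card T * ((\<Prod>S\<in>T. w S) * (C1 * real q ^ d * (f\<^sup>2 / real q ^ d) ^ card U))"
    by (simp only: mult_ac)
  then have pairs: "real (card Pairs) \<le> (\<Prod>S\<in>T. w S) * (C1 * real q ^ d * (f\<^sup>2 / real q ^ d) ^ card U)"
    using stab0_pos by simp
  define c where "c = real (card (profs T ` Good))"
  define W where "W = (\<Prod>S\<in>T. w S)"
  define D where "D = real q ^ d"
  have D: "D > 0" using q_pos by (simp add: D_def)
  have c0: "c \<ge> 0" by (simp add: c_def)
  have "(f ^ card U)\<^sup>2 \<le> (2 * real (card Good))\<^sup>2" using cGood fpos by (intro power_mono) auto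
  also have "\<dots> = 4 * (real (card Good))\<^sup>2" by (simp add: power_mult_distrib)
  also have "\<dots> \<le> 4 * (c * real (card Pairs))" using CS by (simp add: c_def)
  also have "\<dots> \<le> 4 * (c * (W * (C1 * D * (f\<^sup>2 / D) ^ card U)))"
    using pairs c0 by (intro mult_left_mono) (auto simp: W_def D_def)
  also have "\<dots> = (f ^ card U)\<^sup>2 * (4 * c * W * C1 * D / D ^ card U)"
    by (simp add: power_divide power_mult[symmetric] mult.commute[of 2])
  finally have "(f ^ card U)\<^sup>2 * 1 \<le> (f ^ card U)\<^sup>2 * (4 * c * W * C1 * D / D ^ card U)" by simp
  then have "1 \<le> 4 * c * W * C1 * D / D ^ card U" using fpos by (subst (asm) mult_le_cancel_left_pos) auto
  then have "D ^ card U \<le> 4 * c * W * C1 * D" using D by (simp add: pos_le_divide_eq)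
  then have "D * D ^ (\<Sum>S\<in>T. n S) \<le> D * (4 * c * W * C1)" by (simp add: cU mult_ac)
  then have low: "D ^ (\<Sum>S\<in>T. n S) \<le> 4 * c * W * C1" using D by simp
  define Y where "Y = (\<Prod>S\<in>T. real q ^ ex S)"
  have Ypos: "Y > 0" unfolding Y_def using q_pos by (intro prod_pos) auto
  \<comment> \<open>\<open>Y\<close> is the same power of q as in the upper bound for all profiles,
    so it cancels between the two counts.\<close>
  have WY: "W = 2 ^ (\<Sum>S\<in>T. n S) * Y" by (simp only: W_def w_def Y_def prod.distrib power_sum)
  have all: "real (card (profs T ` (U \<rightarrow>\<^sub>E V))) * Y \<le> 2 ^ (\<Sum>S\<in>T. n S) * D ^ (\<Sum>S\<in>T. n S)"
    using card_all_profs_le[OF fT fS] unfolding Y_def ex_def r_def n_def U_def D_def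
    by (simp add: power_mult)
  also have "\<dots> \<le> 2 ^ (\<Sum>S\<in>T. n S) * (4 * c * W * C1)" using low by (intro mult_left_mono) auto
  also have "\<dots> = (class_const T k N * c) * Y" unfolding WY class_const_def C1_def n_def by (simp add: mult_ac)
  finally have "real (card (profs T ` (U \<rightarrow>\<^sub>E V))) \<le> class_const T k N * c" using Ypos by simp
  also have "\<dots> \<le> class_const T k N * real (card (profs T ` (U \<rightarrow>\<^sub>E E)))"
  proof (rule mult_left_mono)
    have "finite (profs T ` (U \<rightarrow>\<^sub>E V))" using card_all_profs_le[OF fT fS] by (simp add: U_def)
    moreover have "profs T ` (U \<rightarrow>\<^sub>E E) \<subseteq> profs T ` (U \<rightarrow>\<^sub>E V)" using E by (intro image_mono PiE_mono) auto
    ultimately have "finite (profs T ` (U \<rightarrow>\<^sub>E E))" by (rule finite_subset[rotated])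
    moreover have "Good \<subseteq> U \<rightarrow>\<^sub>E E" using F(1) by (auto simp: Good_def PiE_iff)
    then have "profs T ` Good \<subseteq> profs T ` (U \<rightarrow>\<^sub>E E)" by blast
    ultimately show "c \<le> real (card (profs T ` (U \<rightarrow>\<^sub>E E)))" unfolding c_def by (simp add: card_mono)
    show "class_const T k N \<ge> 0" using class_const_pos[OF fT ne] by (rule less_imp_le)
  qed
  finally show ?thesis by (simp only: U_def)
qed

end

section \<open>Finite fields inside a commutative ring type\<close>

text \<open>A filler for indices that are not commutative rings. Its two distinct constants also
  witness that 0 and 1 differ in the product.\<close>

definition two_ring :: "nat ring" where
  "two_ring = \<lparr>carrier = {0, 1}, mult = (*), one = 1, zero = 0, add = (\<lambda>a b. (a + b) mod 2)\<rparr>"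

lemma cring_two_ring: "cring two_ring"
proof (rule cringI)
  show "abelian_group two_ring"
    by (rule abelian_groupI) (auto simp: two_ring_def)
  show "comm_monoid two_ring"
    by (rule comm_monoidI) (auto simp: two_ring_def)
qed (auto simp: two_ring_def)

definition factor :: "nat ring \<Rightarrow> nat ring" where
  "factor R = (if cring R then R else two_ring)"

lemma cring_factor: "cring (factor R)"
  by (simp add: factor_def cring_two_ring)

text \<open>
  The product of all commutative rings carried by sets of natural numbers. Every such ring embeds
  as a direct factor (not preserving the unit), so that finite fields of all orders live inside a
  single type of class \<^class>\<open>comm_ring_1\<close>.
\<close>

typedef ring_product = "{f :: nat ring \<Rightarrow> nat. \<forall>R. f R \<in> carrier (factor R)}"
  by (rule exI[of _ "\<lambda>R. \<zero>\<^bsub>factor R\<^esub>"])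
    (simp add: cring.cring_simprules(2)[OF cring_factor])

lemma coord_carrier [simp]: "Rep_ring_product f R \<in> carrier (factor R)"
  using Rep_ring_product[of f] by simp

lemma coord_Abs:
  "(\<And>R. f R \<in> carrier (factor R)) \<Longrightarrow> Rep_ring_product (Abs_ring_product f) = f"
  by (rule Abs_ring_product_inverse) simp

instantiation ring_product :: comm_ring_1
begin

definition "0 = Abs_ring_product (\<lambda>R. \<zero>\<^bsub>factor R\<^esub>)"
definition "1 = Abs_ring_product (\<lambda>R. \<one>\<^bsub>factor R\<^esub>)"
definition "f + g = Abs_ring_product (\<lambda>R. Rep_ring_product f R \<oplus>\<^bsub>factor R\<^esub> Rep_ring_product g R)"
definition "f - g = Abs_ring_product (\<lambda>R. Rep_ring_product f R \<ominus>\<^bsub>factor R\<^esub> Rep_ring_product g R)"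
definition "- f = Abs_ring_product (\<lambda>R. \<ominus>\<^bsub>factor R\<^esub> Rep_ring_product f R)"
definition "f * g = Abs_ring_product (\<lambda>R. Rep_ring_product f R \<otimes>\<^bsub>factor R\<^esub> Rep_ring_product g R)"

lemma coord_ops:
  "Rep_ring_product 0 R = \<zero>\<^bsub>factor R\<^esub>"
  "Rep_ring_product 1 R = \<one>\<^bsub>factor R\<^esub>"
  "Rep_ring_product (f + g) R = Rep_ring_product f R \<oplus>\<^bsub>factor R\<^esub> Rep_ring_product g R"
  "Rep_ring_product (f - g) R = Rep_ring_product f R \<ominus>\<^bsub>factor R\<^esub> Rep_ring_product g R"
  "Rep_ring_product (- f) R = \<ominus>\<^bsub>factor R\<^esub> Rep_ring_product f R"
  "Rep_ring_product (f * g) R = Rep_ring_product f R \<otimes>\<^bsub>factor R\<^esub> Rep_ring_product g R"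
proof -
  interpret cring "factor R" for R by (rule cring_factor)
  show
    "Rep_ring_product 0 R = \<zero>\<^bsub>factor R\<^esub>"
    "Rep_ring_product 1 R = \<one>\<^bsub>factor R\<^esub>"
    "Rep_ring_product (f + g) R = Rep_ring_product f R \<oplus>\<^bsub>factor R\<^esub> Rep_ring_product g R"
    "Rep_ring_product (f - g) R = Rep_ring_product f R \<ominus>\<^bsub>factor R\<^esub> Rep_ring_product g R"
    "Rep_ring_product (- f) R = \<ominus>\<^bsub>factor R\<^esub> Rep_ring_product f R"
    "Rep_ring_product (f * g) R = Rep_ring_product f R \<otimes>\<^bsub>factor R\<^esub> Rep_ring_product g R"
    by (simp_all add: zero_ring_product_def one_ring_product_def plus_ring_product_def
        minus_ring_product_def uminus_ring_product_def times_ring_product_def coord_Abs)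
qed

lemma ring_product_eqI:
  "(\<And>R. Rep_ring_product f R = Rep_ring_product g R) \<Longrightarrow> f = g"
  using Rep_ring_product_inject[of f g] by (simp add: fun_eq_iff)

instance
proof
  fix a b c :: ring_product
  show "a * b * c = a * (b * c)" "a * b = b * a" "1 * a = a" "a + b + c = a + (b + c)"
    "a + b = b + a" "0 + a = a" "- a + a = 0" "a - b = a + - b" "(a + b) * c = a * c + b * c"
    by (rule ring_product_eqI,
        simp add: coord_ops cring.cring_simprules[OF cring_factor] a_minus_def)+
  show "(0 :: ring_product) \<noteq> 1"
  proof
    assume "(0 :: ring_product) = 1"
    then have "Rep_ring_product 0 two_ring = Rep_ring_product 1 two_ring" by simp
    then show False by (simp add: coord_ops factor_def cring_two_ring) (simp add: two_ring_def)
  qed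
qed

end

text \<open>The image is supported on the single coordinate \<open>R\<close>, so the unit of
  \<open>R\<close> becomes an idempotent; this is the element \<open>e\<close> of the
  locale.\<close>

definition emb :: "nat ring \<Rightarrow> nat \<Rightarrow> ring_product" where
  "emb R a = Abs_ring_product (\<lambda>R'. if R' = R then a else \<zero>\<^bsub>factor R'\<^esub>)"

lemma coord_emb:
  assumes "cring R" "a \<in> carrier R"
  shows "Rep_ring_product (emb R a) R' = (if R' = R then a else \<zero>\<^bsub>factor R'\<^esub>)"
  unfolding emb_def
  by (subst coord_Abs) (use assms cring.cring_simprules(2)[OF cring_factor] in \<open>auto simp: factor_def\<close>)

lemma emb_inj:
  assumes "cring R" "a \<in> carrier R" "b \<in> carrier R" "emb R a = emb R b"
  shows "a = b"
proof -
  have *: "Rep_ring_product (emb R x) R = x" if "x \<in> carrier R" for x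
    using coord_emb[OF assms(1) that] by simp
  show ?thesis using *[OF assms(2)] unfolding assms(4) *[OF assms(3)] by (rule sym)
qed

lemma emb_ops:
  assumes R: "cring R" and ab: "a \<in> carrier R" "b \<in> carrier R"
  shows "emb R (a \<oplus>\<^bsub>R\<^esub> b) = emb R a + emb R b"
    and "emb R (a \<ominus>\<^bsub>R\<^esub> b) = emb R a - emb R b"
    and "emb R (a \<otimes>\<^bsub>R\<^esub> b) = emb R a * emb R b"
    and "emb R \<zero>\<^bsub>R\<^esub> = 0"
proof -
  have f: "factor R = R" using R by (simp add: factor_def)
  have z: "\<zero>\<^bsub>factor R'\<^esub> \<oplus>\<^bsub>factor R'\<^esub> \<zero>\<^bsub>factor R'\<^esub> = \<zero>\<^bsub>factor R'\<^esub>"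
    "\<zero>\<^bsub>factor R'\<^esub> \<ominus>\<^bsub>factor R'\<^esub> \<zero>\<^bsub>factor R'\<^esub> = \<zero>\<^bsub>factor R'\<^esub>"
    "\<zero>\<^bsub>factor R'\<^esub> \<otimes>\<^bsub>factor R'\<^esub> \<zero>\<^bsub>factor R'\<^esub> = \<zero>\<^bsub>factor R'\<^esub>" for R'
    using cring.cring_simprules[OF cring_factor[of R']] by simp_all
  have c: "a \<oplus>\<^bsub>R\<^esub> b \<in> carrier R" "a \<ominus>\<^bsub>R\<^esub> b \<in> carrier R" "a \<otimes>\<^bsub>R\<^esub> b \<in> carrier R" "\<zero>\<^bsub>R\<^esub> \<in> carrier R"
    using cring.cring_simprules(1,2,4,5)[OF R] ab by auto
  note [simp] = coord_emb[OF R ab(1)] coord_emb[OF R ab(2)] coord_emb[OF R c(1)] coord_emb[OF R c(2)]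
    coord_emb[OF R c(3)] coord_emb[OF R c(4)]
  show "emb R (a \<oplus>\<^bsub>R\<^esub> b) = emb R a + emb R b"
    by (rule ring_product_eqI) (simp add: coord_ops f z(1))
  show "emb R (a \<ominus>\<^bsub>R\<^esub> b) = emb R a - emb R b"
    by (rule ring_product_eqI) (simp add: coord_ops f z(2))
  show "emb R (a \<otimes>\<^bsub>R\<^esub> b) = emb R a * emb R b"
    by (rule ring_product_eqI) (simp add: coord_ops f z(3))
  show "emb R \<zero>\<^bsub>R\<^esub> = 0"
    by (rule ring_product_eqI) (simp add: coord_ops f)
qed

text \<open>Otherwise 0 and 1 would form an additive subgroup of order 2, and Lagrange's theorem
  would make the order of the field even.\<close>

lemma one_plus_one_nonzero:
  assumes "field R" "finite (carrier R)" "odd (order R)"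
  shows "\<one>\<^bsub>R\<^esub> \<oplus>\<^bsub>R\<^esub> \<one>\<^bsub>R\<^esub> \<noteq> \<zero>\<^bsub>R\<^esub>"
proof
  interpret field R by (rule assms)
  assume 2: "\<one>\<^bsub>R\<^esub> \<oplus>\<^bsub>R\<^esub> \<one>\<^bsub>R\<^esub> = \<zero>\<^bsub>R\<^esub>"
  have "\<ominus>\<^bsub>R\<^esub> \<one>\<^bsub>R\<^esub> = \<one>\<^bsub>R\<^esub>" using 2 by (metis minus_equality one_closed)
  then have "subgroup {\<zero>\<^bsub>R\<^esub>, \<one>\<^bsub>R\<^esub>} (add_monoid R)"
    using 2 by (intro group.subgroupI[OF add.is_group]) (auto simp: a_inv_def)
  then have "card (rcosets\<^bsub>add_monoid R\<^esub> {\<zero>\<^bsub>R\<^esub>, \<one>\<^bsub>R\<^esub>}) * card {\<zero>\<^bsub>R\<^esub>, \<one>\<^bsub>R\<^esub>} = order (add_monoid R)"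
    by (rule group.lagrange[OF add.is_group])
  moreover have "card {\<zero>\<^bsub>R\<^esub>, \<one>\<^bsub>R\<^esub>} = 2" by simp
  moreover have "order (add_monoid R) = order R" by (simp add: order_def)
  ultimately have "even (order R)" by (metis dvd_triv_right)
  then show False using assms by simp
qed

text \<open>Equivalence classes are the fibres of \<open>F\<close>, so those meeting
  \<open>B\<close> correspond to the values of \<open>F\<close> on \<open>B\<close>.\<close>

lemma card_quotient_image:
  assumes "equiv A r" and F: "\<And>x y. x \<in> A \<Longrightarrow> y \<in> A \<Longrightarrow> (x, y) \<in> r \<longleftrightarrow> F x = F y" and B: "B \<subseteq> A"
  shows "card {X \<in> A // r. \<exists>x\<in>X. x \<in> B} = card (F ` B)"
proof -
  have cls: "r `` {x} = {y\<in>A. F y = F x}" if "x \<in> A" for x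
    using F[OF that] that equiv_type[OF assms(1)] by (auto simp: Image_def)
  have "bij_betw (\<lambda>v. {y\<in>A. F y = v}) (F ` B) {X \<in> A // r. \<exists>x\<in>X. x \<in> B}"
    unfolding bij_betw_def
  proof
    show "inj_on (\<lambda>v. {y\<in>A. F y = v}) (F ` B)"
    proof (rule inj_onI)
      fix v v' assume v: "v \<in> F ` B" "v' \<in> F ` B" "{y\<in>A. F y = v} = {y\<in>A. F y = v'}"
      then obtain x where "x \<in> B" "F x = v" by blast
      then have "x \<in> {y\<in>A. F y = v}" using B by blast
      then show "v = v'" using v(3) by blast
    qed
    show "(\<lambda>v. {y\<in>A. F y = v}) ` (F ` B) = {X \<in> A // r. \<exists>x\<in>X. x \<in> B}"
    proof (rule subset_antisym; rule subsetI)
      fix X assume "X \<in> (\<lambda>v. {y\<in>A. F y = v}) ` (F ` B)"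
      then obtain x where x: "x \<in> B" "X = {y\<in>A. F y = F x}" by blast
      then have "X = r `` {x}" "x \<in> X" using cls B by auto
      then show "X \<in> {X \<in> A // r. \<exists>x\<in>X. x \<in> B}" using x B quotientI[of x A r] by blast
    next
      fix X assume "X \<in> {X \<in> A // r. \<exists>x\<in>X. x \<in> B}"
      then obtain x a where x: "x \<in> X" "x \<in> B" and a: "a \<in> A" "X = r `` {a}" by (auto elim: quotientE)
      then have "X = {y\<in>A. F y = F x}" using cls by auto
      then show "X \<in> (\<lambda>v. {y\<in>A. F y = v}) ` (F ` B)" using x by blast
    qed
  qed
  then show ?thesis by (rule bij_betw_same_card[symmetric])
qed

text \<open>Coordinates from d on are 0, not \<open>undefined\<close> as in \<open>points\<close>,
  so that the set is closed under the pointwise operations of the function type.\<close>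

definition vectors :: "nat ring \<Rightarrow> nat \<Rightarrow> (nat \<Rightarrow> ring_product) set" where
  "vectors R d = {f. (\<forall>i<d. f i \<in> emb R ` carrier R) \<and> (\<forall>i\<ge>d. f i = 0)}"

definition dot :: "nat \<Rightarrow> (nat \<Rightarrow> ring_product) \<Rightarrow> (nat \<Rightarrow> ring_product) \<Rightarrow> ring_product" where
  "dot d u v = (\<Sum>i<d. u i * v i)"

definition vec :: "nat ring \<Rightarrow> nat \<Rightarrow> (nat \<Rightarrow> nat) \<Rightarrow> nat \<Rightarrow> ring_product" where
  "vec R d x = (\<lambda>i. if i < d then emb R (x i) else 0)"

lemma bij_betw_vec:
  assumes "cring R"
  shows "bij_betw (vec R d) (points R d) (vectors R d)"
  unfolding bij_betw_def
proof
  show "inj_on (vec R d) (points R d)"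
  proof (rule inj_onI)
    fix x y assume xy: "x \<in> points R d" "y \<in> points R d" "vec R d x = vec R d y"
    show "x = y"
    proof (rule PiE_ext[OF xy(1,2)[unfolded points_def]])
      fix i assume i: "i \<in> {..<d}"
      then have "emb R (x i) = emb R (y i)" using fun_cong[OF xy(3), of i] by (simp add: vec_def)
      moreover have "x i \<in> carrier R" "y i \<in> carrier R"
        using PiE_mem[OF xy(1)[unfolded points_def] i] PiE_mem[OF xy(2)[unfolded points_def] i] by auto
      ultimately show "x i = y i" using emb_inj[OF assms] by blast
    qed
  qed
  show "vec R d ` points R d = vectors R d"
  proof (rule subset_antisym; rule subsetI)
    fix f assume "f \<in> vec R d ` points R d"
    then obtain x where x: "x \<in> points R d" "f = vec R d x" by blast
    have "x i \<in> carrier R" if "i < d" for i using PiE_mem[OF x(1)[unfolded points_def], of i] that by simp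
    then show "f \<in> vectors R d" by (simp add: x(2) vec_def vectors_def)
  next
    fix f assume f: "f \<in> vectors R d"
    then have "\<forall>i. \<exists>a. i < d \<longrightarrow> a \<in> carrier R \<and> f i = emb R a" by (auto simp: vectors_def)
    then obtain x where x: "\<And>i. i < d \<Longrightarrow> x i \<in> carrier R \<and> f i = emb R (x i)" by metis
    have "restrict x {..<d} \<in> points R d" using x by (auto simp: points_def)
    moreover have "f = vec R d (restrict x {..<d})"
      using x f by (auto simp: fun_eq_iff vec_def vectors_def)
    ultimately show "f \<in> vec R d ` points R d" by blast
  qed
qed

lemma emb_finsum:
  fixes n :: nat
  assumes "cring R" "\<And>i. i < n \<Longrightarrow> f i \<in> carrier R"
  shows "(\<Oplus>\<^bsub>R\<^esub>i\<in>{..<n}. f i) \<in> carrier R \<and> emb R (\<Oplus>\<^bsub>R\<^esub>i\<in>{..<n}. f i) = (\<Sum>i<n. emb R (f i))"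
  using assms(2)
proof (induction n)
  case 0
  interpret cring R by (rule assms)
  show ?case using emb_ops(4)[OF assms(1) zero_closed zero_closed] by simp
next
  case (Suc n)
  interpret cring R by (rule assms)
  have IH: "(\<Oplus>\<^bsub>R\<^esub>i\<in>{..<n}. f i) \<in> carrier R" "emb R (\<Oplus>\<^bsub>R\<^esub>i\<in>{..<n}. f i) = (\<Sum>i<n. emb R (f i))"
    using Suc by auto
  have fn: "f n \<in> carrier R" using Suc.prems by simp
  have "(\<Oplus>\<^bsub>R\<^esub>i\<in>{..<Suc n}. f i) = f n \<oplus>\<^bsub>R\<^esub> (\<Oplus>\<^bsub>R\<^esub>i\<in>{..<n}. f i)"
    unfolding lessThan_Suc using Suc.prems by (intro finsum_insert) auto
  then show ?case using IH fn emb_ops(1)[OF assms(1) fn IH(1)] by (simp add: add.commute)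
qed

lemma dot_vec:
  assumes R: "cring R" and x: "x \<in> points R d" and y: "y \<in> points R d"
  shows "dot d (vec R d x - vec R d y) (vec R d x - vec R d y) = emb R (sq_dist R d x y)"
    and "sq_dist R d x y \<in> carrier R"
proof -
  interpret cring R by (rule R)
  have xy: "x i \<in> carrier R" "y i \<in> carrier R" if "i < d" for i
    using x y that by (auto simp: points_def intro: PiE_mem)
  have c: "(x i \<ominus>\<^bsub>R\<^esub> y i) [^]\<^bsub>R\<^esub> (2::nat) \<in> carrier R" if "i < d" for i
    using xy[OF that] by simp
  have "emb R ((x i \<ominus>\<^bsub>R\<^esub> y i) [^]\<^bsub>R\<^esub> (2::nat)) = (emb R (x i) - emb R (y i)) * (emb R (x i) - emb R (y i))"
    if "i < d" for i
  proof -
    have m: "x i \<ominus>\<^bsub>R\<^esub> y i \<in> carrier R" using xy[OF that] by simp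
    have "(x i \<ominus>\<^bsub>R\<^esub> y i) [^]\<^bsub>R\<^esub> (2::nat) = (x i \<ominus>\<^bsub>R\<^esub> y i) \<otimes>\<^bsub>R\<^esub> (x i \<ominus>\<^bsub>R\<^esub> y i)"
      using m by (simp add: numeral_2_eq_2)
    then show ?thesis using emb_ops(3)[OF R m m] emb_ops(2)[OF R xy[OF that]] by simp
  qed
  then have "emb R (sq_dist R d x y) = (\<Sum>i<d. (emb R (x i) - emb R (y i)) * (emb R (x i) - emb R (y i)))"
    unfolding sq_dist_def using emb_finsum[OF R c, of d] by simp
  then show "dot d (vec R d x - vec R d y) (vec R d x - vec R d y) = emb R (sq_dist R d x y)"
    by (simp add: dot_def vec_def fun_diff_def)
  show "sq_dist R d x y \<in> carrier R" unfolding sq_dist_def using emb_finsum[OF R c, of d] by simp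
qed

text \<open>Nondegeneracy is tested on vectors with a single nonzero entry, the embedded unit; odd
  order enters through 1 + 1 \<noteq> 0.\<close>

lemma quadratic_space_vectors:
  assumes R: "field R" and fin: "finite (carrier R)" and odd: "odd (order R)" and q: "order R \<ge> 5" and d: "d \<ge> 2"
  shows "quadratic_space (emb R ` carrier R) (emb R \<one>\<^bsub>R\<^esub>) (vectors R d) (\<lambda>a v i. a * v i) (dot d) (order R) d"
proof -
  interpret field R by (rule R)
  have cr: "cring R" by (rule is_cring)
  let ?K = "emb R ` carrier R" and ?e = "emb R \<one>\<^bsub>R\<^esub>" and ?V = "vectors R d"
  have inj: "inj_on (emb R) (carrier R)" using emb_inj[OF cr] by (auto intro: inj_onI)
  have K0: "0 \<in> ?K" using emb_ops(4)[OF cr zero_closed zero_closed] zero_closed by (metis image_eqI)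
  have Kd: "a - b \<in> ?K" and Ka: "a + b \<in> ?K" and Km: "a * b \<in> ?K" if ab: "a \<in> ?K" "b \<in> ?K" for a b
  proof -
    obtain x y where xy: "x \<in> carrier R" "a = emb R x" "y \<in> carrier R" "b = emb R y"
      using ab(1) ab(2) by (elim imageE)
    show "a - b \<in> ?K" unfolding xy(2,4) emb_ops(2)[OF cr xy(1,3), symmetric]
      by (rule imageI[OF minus_closed[OF xy(1,3)]])
    show "a + b \<in> ?K" unfolding xy(2,4) emb_ops(1)[OF cr xy(1,3), symmetric]
      by (rule imageI[OF a_closed[OF xy(1,3)]])
    show "a * b \<in> ?K" unfolding xy(2,4) emb_ops(3)[OF cr xy(1,3), symmetric]
      by (rule imageI[OF m_closed[OF xy(1,3)]])
  qed
  have e1: "?e * a = a" if aK: "a \<in> ?K" for a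
  proof -
    obtain x where x': "a = emb R x" "x \<in> carrier R" using aK by (rule imageE)
    note x = x'(2) x'(1)
    show ?thesis unfolding x(2) emb_ops(3)[OF cr one_closed x(1), symmetric] l_one[OF x(1)] ..
  qed
  have z: "emb R \<zero>\<^bsub>R\<^esub> = 0" by (rule emb_ops(4)[OF cr zero_closed zero_closed])
  have inv: "\<exists>b\<in>?K. a * b = ?e" if aK: "a \<in> ?K" "a \<noteq> 0" for a
  proof -
    obtain x where x': "a = emb R x" "x \<in> carrier R" using aK(1) by (rule imageE)
    note x = x'(2) x'(1)
    then have "x \<noteq> \<zero>\<^bsub>R\<^esub>" using aK(2) z by auto
    then have "x \<in> Units R" using x field_Units by simp
    then have u: "inv\<^bsub>R\<^esub> x \<in> carrier R" "x \<otimes>\<^bsub>R\<^esub> inv\<^bsub>R\<^esub> x = \<one>\<^bsub>R\<^esub>" by auto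
    then have "a * emb R (inv\<^bsub>R\<^esub> x) = ?e" using emb_ops(3)[OF cr x(1) u(1)] x(2) by simp
    then show ?thesis using u(1) by blast
  qed
  have two: "?e + ?e \<noteq> 0"
  proof
    assume "?e + ?e = 0"
    then have "emb R (\<one>\<^bsub>R\<^esub> \<oplus>\<^bsub>R\<^esub> \<one>\<^bsub>R\<^esub>) = emb R \<zero>\<^bsub>R\<^esub>" using emb_ops(1)[OF cr one_closed one_closed] z by simp
    then have "\<one>\<^bsub>R\<^esub> \<oplus>\<^bsub>R\<^esub> \<one>\<^bsub>R\<^esub> = \<zero>\<^bsub>R\<^esub>" by (rule emb_inj[OF cr, rotated 2]) auto
    then show False using one_plus_one_nonzero[OF R fin odd] by simp
  qed
  have vi: "v i \<in> ?K" if "v \<in> ?V" for v i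
    using that K0 by (cases "i < d") (auto simp: vectors_def)
  have cp: "finite (points R d)" "card (points R d) = order R ^ d"
    unfolding points_def order_def using fin by (auto simp: card_PiE intro: finite_PiE)
  note bij = bij_betw_vec[OF cr, of d]
  have sumK: "(\<Sum>i<n. g i) \<in> ?K" if "\<And>i. g i \<in> ?K" for g and n :: nat
    using K0 Ka that by (induction n) auto
  show ?thesis
  proof
    show "finite ?K" "card ?K = order R" "order R \<ge> 5" "0 \<in> ?K" "?e \<in> ?K" "?e + ?e \<noteq> 0" "2 \<le> d"
      using fin q d K0 two by (auto simp: card_image[OF inj] order_def)
    show "finite ?V" using bij cp(1) by (simp add: bij_betw_finite)
    show "card ?V = order R ^ d" using bij_betw_same_card[OF bij] cp(2) by simp
    show "0 \<in> ?V" using K0 by (simp add: vectors_def)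
    show "u - v \<in> ?V" if "u \<in> ?V" "v \<in> ?V" for u v
      using that Kd by (auto simp: vectors_def fun_diff_def)
    show "(\<lambda>i. a * v i) \<in> ?V" if "a \<in> ?K" "v \<in> ?V" for a v
      using that Km by (auto simp: vectors_def)
    show "(\<lambda>i. a * (b * v i)) = v" if "a * b = ?e" "v \<in> ?V" for a b v
    proof
      fix i show "a * (b * v i) = v i" using that(1) e1[OF vi[OF that(2)]] by (simp add: mult.assoc[symmetric])
    qed
    show "(\<lambda>i. (a + b) * v i) = (\<lambda>i. a * v i) + (\<lambda>i. b * v i)" for a b and v :: "nat \<Rightarrow> ring_product"
      by (simp add: fun_eq_iff distrib_right)
    show "dot d u v \<in> ?K" if "u \<in> ?V" "v \<in> ?V" for u v
      unfolding dot_def using vi that Km by (intro sumK) auto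
    show "dot d u v = dot d v u" for u v by (simp add: dot_def mult.commute)
    show "dot d (u - v) w = dot d u w - dot d v w" for u v w
      by (simp add: dot_def fun_diff_def left_diff_distrib sum_subtractf)
    show "dot d (\<lambda>i. a * u i) v = a * dot d u v" for a u v
      by (simp add: dot_def sum_distrib_left mult.assoc)
    fix v assume v: "v \<in> ?V" and 0: "\<And>w. w \<in> ?V \<Longrightarrow> dot d v w = 0"
    show "v = 0"
    proof
      fix j show "v j = 0 j"
      proof (cases "j < d")
        case True
        have "(\<lambda>i. if i = j then ?e else 0) \<in> ?V" using K0 True by (auto simp: vectors_def)
        from 0[OF this] have "(\<Sum>i<d. v i * (if i = j then ?e else 0)) = 0" by (simp add: dot_def)
        moreover have "(\<Sum>i<d. v i * (if i = j then ?e else 0)) = (\<Sum>i<d. if i = j then v i else 0)"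
          using e1[OF vi[OF v]] by (intro sum.cong) (auto simp: mult.commute)
        ultimately show ?thesis using True by simp
      qed (use v in \<open>simp add: vectors_def\<close>)
    qed
  qed (use Kd Km e1 inv in auto)
qed

text \<open>\<open>profs\<close> records all ordered pairs within each simplex, the diagonal
  included, where the distance is always 0. Since \<open>tree_adj\<close> joins precisely the
  distinct vertices of a common simplex, it induces the same partition as
  \<open>congruence\<close>.\<close>

lemma class_counts:
  fixes T :: "'v set set"
  assumes qs: "quadratic_space (emb R ` carrier R) (emb R \<one>\<^bsub>R\<^esub>) (vectors R d) (\<lambda>a v i. a * v i) (dot d) (order R) d"
    and R: "cring R" and E: "E \<subseteq> points R d" and T: "T \<noteq> {}"
  shows "card (congruence_classes_in R d (\<Union>T) (tree_adj T) E)
      = card (quadratic_space.profs (dot d) T ` (\<Union>T \<rightarrow>\<^sub>E vec R d ` E))"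
proof -
  interpret quadratic_space "emb R ` carrier R" "emb R \<one>\<^bsub>R\<^esub>" "vectors R d" "\<lambda>a v i. a * v i" "dot d" "order R" d
    by (rule qs)
  let ?U = "\<Union>T" and ?A = "embeddings R d (\<Union>T)" and ?r = "congruence R d (\<Union>T) (tree_adj T)"
  define F where "F p = profs T (\<lambda>v\<in>?U. vec R d (p v))" for p :: "'v \<Rightarrow> nat \<Rightarrow> nat"
  have F: "(p, p') \<in> ?r \<longleftrightarrow> F p = F p'" if p: "p \<in> ?A" "p' \<in> ?A" for p p'
  proof -
    have pts: "p v \<in> points R d" "p' v \<in> points R d" if "v \<in> ?U" for v
      using p that by (auto simp: embeddings_def intro: PiE_mem)
    have Qe: "Q (vec R d (p u) - vec R d (p v)) = Q (vec R d (p' u) - vec R d (p' v))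
        \<longleftrightarrow> sq_dist R d (p u) (p v) = sq_dist R d (p' u) (p' v)" if "u \<in> ?U" "v \<in> ?U" for u v
      using dot_vec[OF R pts(1)[OF that(1)] pts(1)[OF that(2)]] dot_vec[OF R pts(2)[OF that(1)] pts(2)[OF that(2)]]
        emb_inj[OF R] unfolding Q_def by metis
    have in_U: "u \<in> ?U" if "S \<in> T" "u \<in> S" for u S using that by blast
    have "F p = F p' \<longleftrightarrow> (\<forall>S\<in>T. prof S (\<lambda>v\<in>?U. vec R d (p v)) = prof S (\<lambda>v\<in>?U. vec R d (p' v)))"
      unfolding F_def profs_def by (auto simp: fun_eq_iff)
    also have "\<dots> \<longleftrightarrow> (\<forall>S\<in>T. \<forall>u\<in>S. \<forall>v\<in>S. Q (vec R d (p u) - vec R d (p v)) = Q (vec R d (p' u) - vec R d (p' v)))"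
      unfolding prof_eq_iff
    proof (intro ball_cong refl)
      fix S u v assume "S \<in> T" "u \<in> S" "v \<in> S"
      then have "u \<in> ?U" "v \<in> ?U" by (blast intro: in_U)+
      then show "Q (restrict (\<lambda>v. vec R d (p v)) ?U u - restrict (\<lambda>v. vec R d (p v)) ?U v)
            = Q (restrict (\<lambda>v. vec R d (p' v)) ?U u - restrict (\<lambda>v. vec R d (p' v)) ?U v)
          \<longleftrightarrow> Q (vec R d (p u) - vec R d (p v)) = Q (vec R d (p' u) - vec R d (p' v))"
        by (simp only: restrict_apply')
    qed
    also have "\<dots> \<longleftrightarrow> (\<forall>S\<in>T. \<forall>u\<in>S. \<forall>v\<in>S. u \<noteq> v \<longrightarrow> sq_dist R d (p u) (p v) = sq_dist R d (p' u) (p' v))"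
    proof (intro ball_cong refl)
      fix S u v assume "S \<in> T" "u \<in> S" "v \<in> S"
      then have "u \<in> ?U" "v \<in> ?U" by (blast intro: in_U)+
      then show "Q (vec R d (p u) - vec R d (p v)) = Q (vec R d (p' u) - vec R d (p' v))
          \<longleftrightarrow> (u \<noteq> v \<longrightarrow> sq_dist R d (p u) (p v) = sq_dist R d (p' u) (p' v))"
        by (cases "u = v") (simp_all only: Qe diff_self simp_thms)
    qed
    also have "\<dots> \<longleftrightarrow> (p, p') \<in> ?r" using p by (auto simp: congruence_def tree_adj_def)
    finally show ?thesis by simp
  qed
  define B where "B = {p\<in>?A. p ` ?U \<subseteq> E}"
  have "congruence_classes_in R d ?U (tree_adj T) E = {X \<in> ?A // ?r. \<exists>x\<in>X. x \<in> B}"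
  proof -
    have "x \<in> ?A" if "X \<in> ?A // ?r" "x \<in> X" for X x
      using that by (auto simp: quotient_def congruence_def)
    then show ?thesis unfolding congruence_classes_in_def congruence_classes_def B_def by blast
  qed
  moreover have "B \<subseteq> ?A" by (auto simp: B_def)
  ultimately have "card (congruence_classes_in R d ?U (tree_adj T) E) = card (F ` B)"
    using card_quotient_image[OF equiv_congruence F] by (simp only:)
  also have "F ` B = profs T ` ((\<lambda>p. \<lambda>v\<in>?U. vec R d (p v)) ` B)" by (auto simp: F_def image_image)
  also have "(\<lambda>p. \<lambda>v\<in>?U. vec R d (p v)) ` B = ?U \<rightarrow>\<^sub>E vec R d ` E"
  proof (rule subset_antisym; rule subsetI)
    fix h assume "h \<in> (\<lambda>p. \<lambda>v\<in>?U. vec R d (p v)) ` B"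
    then obtain p where p: "h = (\<lambda>v\<in>?U. vec R d (p v))" "p ` ?U \<subseteq> E" by (auto simp: B_def)
    have "p v \<in> E" if "v \<in> ?U" for v using p(2) imageI[OF that, of p] by (rule subsetD)
    then show "h \<in> ?U \<rightarrow>\<^sub>E vec R d ` E" unfolding p(1) by (simp only: restrict_PiE_iff) blast
  next
    fix h assume h: "h \<in> ?U \<rightarrow>\<^sub>E vec R d ` E"
    then have "\<forall>v. \<exists>x. v \<in> ?U \<longrightarrow> x \<in> E \<and> h v = vec R d x" by (auto dest: PiE_mem)
    then obtain p where p: "\<And>v. v \<in> ?U \<Longrightarrow> p v \<in> E \<and> h v = vec R d (p v)" by metis
    have "restrict p ?U \<in> B" using p E by (auto simp: B_def embeddings_def)
    moreover have "h = (\<lambda>v\<in>?U. vec R d (restrict p ?U v))"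
    proof
      fix v show "h v = (\<lambda>v\<in>?U. vec R d (restrict p ?U v)) v"
        using p[of v] PiE_arb[OF h, of v] by (cases "v \<in> ?U") simp_all
    qed
    ultimately show "h \<in> (\<lambda>p. \<lambda>v\<in>?U. vec R d (p v)) ` B" by blast
  qed
  finally show ?thesis .
qed

text \<open>The proportion of non-generic embeddings is of order q^(min n d - 1)/|E|, so this keeps
  it bounded at the threshold. Dimensions up to k are handled by the second term of s; a larger one
  is at most \<open>N\<close> and is handled by the first.\<close>

lemma threshold_ge_simplex_dim:
  fixes d N k n :: nat and s :: real
  assumes s: "s = max ((real d * real N + 1) / (real N + 1)) (real k + (real d - 1) / 2)"
    and n: "n \<le> k \<or> n \<le> N" and d: "d \<ge> 2"
  shows "real (min n d - 1) \<le> s"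
proof (cases "n \<le> k")
  case True
  then have "real (min n d - 1) \<le> real k" by linarith
  also have "\<dots> \<le> real k + (real d - 1) / 2" using d by simp
  finally show ?thesis unfolding s by linarith
next
  case False
  define r where "r = min n d"
  have r: "r \<le> d" "r \<le> N" using n False by (auto simp: r_def)
  show ?thesis
  proof (cases "r = 0")
    case True
    have "0 \<le> (real d * real N + 1) / (real N + 1)" by simp
    then show ?thesis using True unfolding s r_def by (simp add: le_max_iff_disj)
  next
    case False
    have "(real r - 1) * (real N + 1) \<le> real d * real N + 1"
    proof -
      have "real r * real N \<le> real d * real N" using r by (intro mult_right_mono) auto
      then show ?thesis using r by (simp add: algebra_simps)
    qed
    then have "real r - 1 \<le> (real d * real N + 1) / (real N + 1)" by (simp add: pos_le_divide_eq)
    moreover have "real (min n d - 1) = real r - 1" using False by (simp add: r_def of_nat_diff)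
    ultimately show ?thesis unfolding s by linarith
  qed
qed

lemma pow_le_of_powr:
  fixes Q e C s :: real
  assumes Q: "Q \<ge> 1" and C: "C \<ge> 1" and e: "C * Q powr s \<le> e" and ab: "real a \<le> s * real b"
  shows "Q ^ a \<le> e ^ b"
proof -
  have "Q ^ a = Q powr real a" using Q by (simp add: powr_realpow)
  also have "\<dots> \<le> Q powr (s * real b)" using Q ab by (intro powr_mono) auto
  also have "\<dots> = (Q powr s) ^ b" using Q by (simp add: powr_powr[symmetric] powr_realpow)
  also have "\<dots> \<le> e ^ b"
  proof (rule power_mono)
    have "1 * Q powr s \<le> C * Q powr s" using C by (intro mult_right_mono) auto
    then show "Q powr s \<le> e" using e by simp
  qed simp
  finally show ?thesis .
qed

theorem theorem1p5:
  fixes d k N :: nat and s :: real and T :: "'v set set"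
  assumes "d \<ge> 2"
    and "simplex_tree T"
    and "1 \<le> k" and "real k < (real d + 1) / 2"
    and "N = k + (\<Sum>S | S \<in> T \<and> simplex_dim S > k. simplex_dim S - k)"
    and "s = max ((real d * real N + 1) / (real N + 1)) (real k + (real d - 1) / 2)"
  shows "\<exists>C>0. \<exists>c>0. \<forall>(R :: nat ring) E.
    field R \<longrightarrow> finite (carrier R) \<longrightarrow> odd (order R) \<longrightarrow>
    E \<subseteq> points R d \<longrightarrow> real (card E) \<ge> C * real (order R) powr s \<longrightarrow>
    real (card (congruence_classes_in R d (tree_verts T) (tree_adj T) E))
      \<ge> c * real (card (congruence_classes R d (tree_verts T) (tree_adj T)))"
proof (cases "T = {}")
  \<comment> \<open>The empty family satisfies \<open>simplex_tree\<close>. Its only embedding is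
    the empty one, whose image lies in every set.\<close>
  case True
  have "congruence_classes_in R d (tree_verts T) (tree_adj T) E = congruence_classes R d (tree_verts T) (tree_adj T)"
    for R :: "nat ring" and E
  proof -
    have "\<exists>p\<in>X. p ` {} \<subseteq> E" if "X \<in> congruence_classes R d {} (tree_adj T)" for X
      using that in_quotient_imp_non_empty[OF equiv_congruence] unfolding congruence_classes_def by blast
    then show ?thesis using True by (auto simp: congruence_classes_in_def tree_verts_def)
  qed
  then show ?thesis by (intro exI[of _ 1] conjI) auto
next
  case False
  define M where "M = (\<Sum>S\<in>T. real (card S))"
  \<comment> \<open>The 3^d rules out fields of order below 5, over which E would exceed the whole
    space. The 2 and the 12M leave C/2 \<ge> 1 and C/2 \<ge> 6M for the largeness conditions, which
    are stated for half of |E|.\<close>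
  define C where "C = 3 ^ d + 2 + 12 * M"
  define c where "c = 1 / class_const T k N"
  have M0: "M \<ge> 0" by (simp add: M_def sum_nonneg)
  have C3: "C > 3 ^ d" using M0 by (simp add: C_def)
  have C2: "C \<ge> 2" using M0 by (simp add: C_def)
  have CM: "C \<ge> 12 * M" by (simp add: C_def)
  have finT: "finite T" using assms(2) by (simp add: simplex_tree_def)
  have "real (2 * k) < real (d + 1)" using assms(4) by (simp add: field_simps)
  then have k2: "2 * k \<le> d" unfolding of_nat_less_iff by simp
  have N': "N = k + (\<Sum>S | S \<in> T \<and> card S - 1 > k. card S - 1 - k)"
    using assms(5) by (simp add: simplex_dim_def)
  have s0: "s \<ge> 0" unfolding assms(6) by (simp add: le_max_iff_disj)
  have sd: "(real d * real N + 1) / (real N + 1) \<le> s" and sk: "real k + (real d - 1) / 2 \<le> s"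
    using assms(6) by simp_all
  have dim: "card S - 1 \<le> k \<or> card S - 1 \<le> N" if "S \<in> T" for S
  proof (cases "card S - 1 > k")
    case True
    then have "card S - 1 - k \<le> (\<Sum>S | S \<in> T \<and> card S - 1 > k. card S - 1 - k)"
      using that finT by (intro member_le_sum) auto
    then show ?thesis using N' by linarith
  qed auto
  have main: "c * real (card (congruence_classes R d (tree_verts T) (tree_adj T)))
      \<le> real (card (congruence_classes_in R d (tree_verts T) (tree_adj T) E))"
    if R: "field R" "finite (carrier R)" "odd (order R)" and E: "E \<subseteq> points R d"
      and big: "C * real (order R) powr s \<le> real (card E)" for R :: "nat ring" and E
  proof -
    interpret field R by (rule R)
    have cr: "cring R" by (rule is_cring)
    define q where "q = order R"
    have "card {\<zero>\<^bsub>R\<^esub>, \<one>\<^bsub>R\<^esub>} \<le> card (carrier R)" using R(2) by (intro card_mono) auto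
    then have "q \<ge> 2" by (simp add: q_def order_def)
    then have q1: "real q \<ge> 1" by simp
    have fp: "finite (points R d)" and cp: "card (points R d) = q ^ d"
      using R(2) by (auto simp: points_def q_def order_def card_PiE intro: finite_PiE)
    have Eq: "real (card E) \<le> real q ^ d" using card_mono[OF fp E] cp by (metis of_nat_mono of_nat_power)
    have "real q powr 0 \<le> real q powr s" using q1 s0 by (intro powr_mono) auto
    then have "C * 1 \<le> C * real q powr s" using C2 q1 by (intro mult_left_mono) auto
    then have Ce: "C \<le> real (card E)" using big by (simp add: q_def)
    have q5: "q \<ge> 5"
    proof (rule ccontr)
      assume "\<not> q \<ge> 5"
      then have "q \<le> 3" using R(3) by (auto simp: q_def elim!: oddE)
      then have "real q ^ d \<le> 3 ^ d" by (intro power_mono) auto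
      then show False using Eq Ce C3 by linarith
    qed
    define F where "F = vec R d ` E"
    have bij: "bij_betw (vec R d) (points R d) (vectors R d)" by (rule bij_betw_vec[OF cr])
    have F: "F \<subseteq> vectors R d" "card F = card E"
      using bij E unfolding F_def bij_betw_def by (auto intro: card_image inj_on_subset)
    have half: "C / 2 * real q powr s \<le> real (card F) / 2" using big F(2) by (simp add: q_def)
    have qs: "quadratic_space (emb R ` carrier R) (emb R \<one>\<^bsub>R\<^esub>) (vectors R d) (\<lambda>a v i. a * v i) (dot d) q d"
      unfolding q_def using q5 by (intro quadratic_space_vectors R assms(1)) (simp add: q_def)
    have "real (card (quadratic_space.profs (dot d) T ` (\<Union>T \<rightarrow>\<^sub>E vectors R d)))
      \<le> class_const T k N * real (card (quadratic_space.profs (dot d) T ` (\<Union>T \<rightarrow>\<^sub>E F)))"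
    proof (rule quadratic_space.positive_proportion_profs[OF qs assms(2) False assms(3) k2 N' F(1)])
      show "real q ^ (d * N + 1) \<le> (real (card F) / 2) ^ (N + 1)"
      proof (rule pow_le_of_powr[OF q1 _ half])
        show "real (d * N + 1) \<le> s * real (N + 1)"
          using sd by (simp add: pos_divide_le_eq add.commute)
      qed (use C2 in simp)
      show "real q ^ (d + k) \<le> (real (card F) / 2)\<^sup>2"
        using sk C2 assms(3) by (intro pow_le_of_powr[OF q1 _ half]) (auto simp: field_simps)
      show "6 * (\<Sum>S\<in>T. real (card S)) * real q ^ (min (card S - 1) d - 1) \<le> real (card F) / 2"
        if S: "S \<in> T" for S
      proof -
        have "real q ^ (min (card S - 1) d - 1) \<le> (real q powr s) ^ 1"
          using threshold_ge_simplex_dim[OF assms(6) dim[OF S] assms(1)]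
          by (intro pow_le_of_powr[OF q1, of 1 s]) auto
        then have "6 * M * real q ^ (min (card S - 1) d - 1) \<le> C / 2 * real q powr s"
          using M0 CM by (intro mult_mono) auto
        then show ?thesis using half by (simp add: M_def)
      qed
    qed
    moreover have "card (congruence_classes_in R d (tree_verts T) (tree_adj T) E)
        = card (quadratic_space.profs (dot d) T ` (\<Union>T \<rightarrow>\<^sub>E F))"
      unfolding tree_verts_def F_def using class_counts[OF qs[unfolded q_def] cr E False] .
    \<comment> \<open>The total number of classes is the count for E equal to the whole space, so
      \<open>class_counts\<close> treats both sides.\<close>
    moreover have "congruence_classes R d (tree_verts T) (tree_adj T)
        = congruence_classes_in R d (tree_verts T) (tree_adj T) (points R d)"
    proof -
      have "\<exists>p\<in>X. p ` tree_verts T \<subseteq> points R d" if "X \<in> congruence_classes R d (tree_verts T) (tree_adj T)" for X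
      proof -
        have "X \<noteq> {}" "X \<subseteq> embeddings R d (tree_verts T)"
          using that in_quotient_imp_non_empty[OF equiv_congruence] in_quotient_imp_subset[OF equiv_congruence]
          unfolding congruence_classes_def by blast+
        then obtain p where "p \<in> X" "p \<in> embeddings R d (tree_verts T)" by blast
        then show ?thesis by (intro bexI[of _ p]) (auto simp: embeddings_def dest: PiE_mem)
      qed
      then show ?thesis by (auto simp: congruence_classes_in_def)
    qed
    moreover have "card (congruence_classes_in R d (tree_verts T) (tree_adj T) (points R d))
        = card (quadratic_space.profs (dot d) T ` (\<Union>T \<rightarrow>\<^sub>E vectors R d))"
      using class_counts[OF qs[unfolded q_def] cr subset_refl False] bij
      by (simp add: tree_verts_def bij_betw_def)
    ultimately have "real (card (congruence_classes R d (tree_verts T) (tree_adj T)))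
      \<le> class_const T k N * real (card (congruence_classes_in R d (tree_verts T) (tree_adj T) E))" by simp
    then show ?thesis
      using class_const_pos[OF finT False, of k N] by (simp add: c_def pos_divide_le_eq mult.commute)
  qed
  have "c > 0" using class_const_pos[OF finT False, of k N] by (simp add: c_def)
  moreover have "C > 0" using C2 by simp
  ultimately show ?thesis using main by blast
qed

end
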